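(* Let $\mathbf{A}_1$ and $\mathbf{A}_2$ be group systems, where for $\iota\in\{1,2\}$ the system $\mathbf{A}_\iota=(A_\iota,\mu_\iota,\alpha_\iota)$ is built from the free group $\Gamma_\iota$ on the alphabet $S_\iota$ and an automorphism $T_\iota$ of $\Gamma_\iota$ induced by a bijection of $S_\iota$. Suppose that $\mathbf{A}_1$ is ergodic and $S_1$ is countably infinite, and that $\mathbf{A}_2$ is an identity system and $S_2$ is finite or countably infinite. Then $\mathbf{A}_1$ and $\mathbf{A}_2$ are r-disjoint.
   Context: All dynamics here are actions of $\mathbb{Z}$, given by a single automorphism. Inner products are linear in the second variable. Group systems: let $\Gamma$ be the free group on an alphabet $S$, and $T$ an automorphism of $\Gamma$ obtained from a bijection $S\to S$. Let $H=\ell^2(\Gamma)$, let $A=C_r^*(\Gamma)\subset B(H)$ be the reduced group C*-algebra, generated by the left regular representation $[\lambda(g)f](h)=f(g^{-1}h)$, let $\Omega\in H$ be the function with $\Omega(1)=1$ and $\Omega(g)=0$ for $g\neq1$, and let $\mu(a)=\langle\Omega,a\Omega\rangle$ for $a\in A$. Let $U:H\to H$ be the unitary $Uf=f\circ T^{-1}$ and $\alpha(a)=UaU^*$ for $a\in A$, a $*$-automorphism of $A$ with $\alpha(\lambda(g))=\lambda(Tg)$. The triple $(A,\mu,\alpha)$, with $\mathbb{Z}$ acting by $n\mapsto\alpha^n$, is called a *group system*. Its GNS representation is the inclusion $A\subset B(H)$ with cyclic vector $\Omega$. It is *ergodic* if $\{x\in H:U^nx=x\text{ for all }n\in\mathbb{Z}\}=\mathbb{C}\Omega$,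 and it is an *identity system* if $\alpha=\mathrm{id}_A$. Reduced free product: for $\iota\in\{1,2\}$ let $H_\iota=\ell^2(\Gamma_\iota)$, let $\Omega_\iota\in H_\iota$ be the function with $\Omega_\iota(1)=1$ and $\Omega_\iota(g)=0$ for $g\in\Gamma_\iota\setminus\{1\}$, and let $U_\iota:H_\iota\to H_\iota$ be the unitary $U_\iota f=f\circ T_\iota^{-1}$, so that $A_\iota=C_r^*(\Gamma_\iota)\subset B(H_\iota)$, $\mu_\iota(a)=\langle\Omega_\iota,a\Omega_\iota\rangle$ and $\alpha_\iota(a)=U_\iota aU_\iota^*$ for $a\in A_\iota$; and let $H_\iota^\circ=H_\iota\ominus\mathbb{C}\Omega_\iota$. Let $$H:=\mathbb{C}\Omega\oplus\bigoplus_{n\ge1}\Big(\bigoplus_{\iota_1\ne\iota_2\ne\cdots\ne\iota_n}H_{\iota_1}^\circ\otimes\cdots\otimes H_{\iota_n}^\circ\Big),$$ with $\Omega$ a unit vector and adjacent indices $\iota_j\in\{1,2\}$ distinct. Let $H(\iota)\subset H$ be the closed subspace consisting of $\mathbb{C}\Omega$ and the summands with $\iota_1\neq\iota$, and let $V_\iota:H_\iota\otimes H(\iota)\to H$ be the unitary determined by $\Omega_\iota\otimes\Omega\mapsto\Omega$, $x\otimes\Omega\mapsto x$, $\Omega_\iota\otimes y\mapsto y$, $x\otimes y\mapsto x\otimes y$ for $x\in H_\iota^\circ$ and $y$ in a summand $H_{\iota_1}^\circ\otimes\cdots\otimes H_{\iota_n}^\circ$ with $\iota_1\ne\iota$. Define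 $\Lambda_\iota:A_\iota\to B(H)$ by $\Lambda_\iota(a)=V_\iota(a\otimes1)V_\iota^*$. Let $R$ be the C*-subalgebra of $B(H)$ generated by $\Lambda_1(A_1)\cup\Lambda_2(A_2)$ and $\varphi(a)=\langle\Omega,a\Omega\rangle$ for $a\in R$; thus $(R,\varphi)=(A_1,\mu_1)*(A_2,\mu_2)$ is the reduced free product. Let $U$ be the unitary on $H$ with $U\Omega=\Omega$ and $U(x_1\otimes\cdots\otimes x_n)=(U_{\iota_1}x_1)\otimes\cdots\otimes(U_{\iota_n}x_n)$ for $x_j\in H_{\iota_j}^\circ$, and let $\rho(a)=UaU^*$ for $a\in R$; this is a $*$-automorphism of $R$ with $\varphi\circ\rho=\varphi$. An *r-joining* of $\mathbf{A}_1$ and $\mathbf{A}_2$ is a state $\omega$ on $R$ such that $\omega\circ\Lambda_\iota=\mu_\iota$ for $\iota=1,2$ and $\omega\circ\rho^n=\omega$ for all $n\in\mathbb{Z}$; the set of all r-joinings is denoted $J_r(\mathbf{A}_1,\mathbf{A}_2)$, and it contains $\varphi$. The systems $\mathbf{A}_1$ and $\mathbf{A}_2$ are *r-disjoint* if $J_r(\mathbf{A}_1,\mathbf{A}_2)=\{\varphi\}$. *)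

theory Defs
  imports "HOL-Analysis.Analysis" "HOL-Algebra.Group"
begin

section \<open>Square-summable functions\<close>

typedef 'x ell2 = "{f :: 'x \<Rightarrow> complex. (\<lambda>x. (cmod (f x))\<^sup>2) summable_on UNIV}"
  morphisms coef Abs_ell2
  by (intro exI[of _ "\<lambda>_. 0"]) auto

setup_lifting type_definition_ell2

lemma coef_summable: "(\<lambda>x. (cmod (coef f x))\<^sup>2) summable_on A"
  using coef[of f] summable_on_subset_banach[of _ UNIV A] by auto

lemma coef_eqI: "(\<And>x. coef f x = coef g x) \<Longrightarrow> f = g"
  by transfer auto

lemma sqsum_add:
  fixes f g :: "'x \<Rightarrow> complex"
  assumes "(\<lambda>x. (cmod (f x))\<^sup>2) summable_on A" "(\<lambda>x. (cmod (g x))\<^sup>2) summable_on A"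
  shows "(\<lambda>x. (cmod (f x + g x))\<^sup>2) summable_on A"
proof (rule summable_on_comparison_test)
  show "(\<lambda>x. 2 * (cmod (f x))\<^sup>2 + 2 * (cmod (g x))\<^sup>2) summable_on A"
    by (intro summable_on_add summable_on_cmult_right assms)
  show "(cmod (f x + g x))\<^sup>2 \<le> 2 * (cmod (f x))\<^sup>2 + 2 * (cmod (g x))\<^sup>2" for x
  proof -
    have "(cmod (f x + g x))\<^sup>2 \<le> (cmod (f x) + cmod (g x))\<^sup>2"
      by (intro power_mono norm_triangle_ineq) auto
    also have "\<dots> \<le> 2 * (cmod (f x))\<^sup>2 + 2 * (cmod (g x))\<^sup>2"
      using sum_squares_bound[of "cmod (f x)" "cmod (g x)"] by (simp add: power2_sum)
    finally show ?thesis .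
  qed
qed auto

lemma sqsum_mult:
  fixes f :: "'x \<Rightarrow> complex"
  assumes "(\<lambda>x. (cmod (f x))\<^sup>2) summable_on A"
  shows "(\<lambda>x. (cmod (c * f x))\<^sup>2) summable_on A"
  using assms by (simp add: norm_mult power_mult_distrib summable_on_cmult_right)

lemma sqsum_prod:
  fixes f g :: "'x \<Rightarrow> complex"
  assumes "(\<lambda>x. (cmod (f x))\<^sup>2) summable_on A" "(\<lambda>x. (cmod (g x))\<^sup>2) summable_on A"
  shows "(\<lambda>x. cnj (f x) * g x) summable_on A"
proof (rule abs_summable_summable)
  show "(\<lambda>x. norm (cnj (f x) * g x)) summable_on A"
    by (rule abs_summable_product)
       (use assms in \<open>simp_all add: norm_mult power2_eq_square\<close>)
qed

instantiation ell2 :: (type) real_inner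
begin

lift_definition zero_ell2 :: "'a ell2" is "\<lambda>_. 0" by simp

lift_definition plus_ell2 :: "'a ell2 \<Rightarrow> 'a ell2 \<Rightarrow> 'a ell2" is "\<lambda>f g x. f x + g x"
  by (rule sqsum_add)

lift_definition uminus_ell2 :: "'a ell2 \<Rightarrow> 'a ell2" is "\<lambda>f x. - f x" by simp

lift_definition minus_ell2 :: "'a ell2 \<Rightarrow> 'a ell2 \<Rightarrow> 'a ell2" is "\<lambda>f g x. f x - g x"
  using sqsum_add[of _ _ "\<lambda>x. - _ x"] by simp

lift_definition scaleR_ell2 :: "real \<Rightarrow> 'a ell2 \<Rightarrow> 'a ell2" is "\<lambda>r f x. of_real r * f x"
  by (rule sqsum_mult)

definition inner_ell2 :: "'a ell2 \<Rightarrow> 'a ell2 \<Rightarrow> real"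
  where "inner_ell2 f g = Re (\<Sum>\<^sub>\<infinity>x. cnj (coef f x) * coef g x)"

definition norm_ell2 :: "'a ell2 \<Rightarrow> real"
  where "norm_ell2 f = sqrt (inner f f)"

definition dist_ell2 :: "'a ell2 \<Rightarrow> 'a ell2 \<Rightarrow> real"
  where "dist_ell2 f g = norm (f - g)"

definition sgn_ell2 :: "'a ell2 \<Rightarrow> 'a ell2"
  where "sgn_ell2 f = inverse (norm f) *\<^sub>R f"

definition uniformity_ell2 :: "('a ell2 \<times> 'a ell2) filter"
  where "uniformity_ell2 = (INF e\<in>{0<..}. principal {(x, y). dist x y < e})"

definition open_ell2 :: "'a ell2 set \<Rightarrow> bool"
  where "open_ell2 U \<longleftrightarrow> (\<forall>x\<in>U. eventually (\<lambda>(x', y). x' = x \<longrightarrow> y \<in> U) uniformity)"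

instance
proof
  fix x y z :: "'a ell2" and r s :: real
  have summ: "(\<lambda>i. cnj (coef f i) * coef g i) summable_on UNIV" for f g :: "'a ell2"
    by (intro sqsum_prod coef_summable)
  have inn: "inner f g = (\<Sum>\<^sub>\<infinity>i. Re (cnj (coef f i) * coef g i))" for f g :: "'a ell2"
    unfolding inner_ell2_def by (rule infsum_Re[symmetric, OF summ])
  have summ': "(\<lambda>i. Re (cnj (coef f i) * coef g i)) summable_on UNIV" for f g :: "'a ell2"
    by (rule summable_on_Re[OF summ])
  show "x + y + z = x + (y + z)" by transfer (simp add: add.assoc)
  show "x + y = y + x" by transfer (simp add: add.commute)
  show "0 + x = x" by transfer simp
  show "- x + x = 0" by transfer simp
  show "x - y = x + - y" by transfer simp
  show "r *\<^sub>R (x + y) = r *\<^sub>R x + r *\<^sub>R y" by transfer (simp add: algebra_simps)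
  show "(r + s) *\<^sub>R x = r *\<^sub>R x + s *\<^sub>R x" by transfer (simp add: algebra_simps)
  show "r *\<^sub>R s *\<^sub>R x = (r * s) *\<^sub>R x" by transfer (simp add: algebra_simps)
  show "1 *\<^sub>R x = x" by transfer simp
  show "dist x y = norm (x - y)" by (rule dist_ell2_def)
  show "sgn x = inverse (norm x) *\<^sub>R x" by (rule sgn_ell2_def)
  show "uniformity = (INF e\<in>{0<..}. principal {(x :: 'a ell2, y). dist x y < e})"
    by (rule uniformity_ell2_def)
  show "open U \<longleftrightarrow> (\<forall>x\<in>U. \<forall>\<^sub>F (x', y) in uniformity. x' = x \<longrightarrow> y \<in> U)" for U :: "'a ell2 set"
    by (rule open_ell2_def)
  show "inner x y = inner y x"
    unfolding inn by (rule infsum_cong) (simp add: mult.commute)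
  show "inner (x + y) z = inner x z + inner y z"
    unfolding inn
    by (subst infsum_add[symmetric, OF summ' summ'], rule infsum_cong)
       (simp add: plus_ell2.rep_eq algebra_simps)
  show "inner (r *\<^sub>R x) y = r * inner x y"
    unfolding inn
    by (subst infsum_cmult_right'[symmetric], rule infsum_cong)
       (simp add: scaleR_ell2.rep_eq algebra_simps)
  have ixx: "inner x x = (\<Sum>\<^sub>\<infinity>i. (cmod (coef x i))\<^sup>2)"
    unfolding inn by (rule infsum_cong) (simp add: cmod_power2 flip: power2_eq_square)
  show "0 \<le> inner x x" unfolding ixx by (rule infsum_nonneg) simp
  show "inner x x = 0 \<longleftrightarrow> x = 0"
  proof
    assume "inner x x = 0"
    then have "(cmod (coef x i))\<^sup>2 = 0" for i
      using nonneg_infsum_le_0D[OF _ coef_summable[of x UNIV]] unfolding ixx by auto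
    then show "x = 0" by (intro coef_eqI) (simp add: zero_ell2.rep_eq)
  qed (simp add: inn zero_ell2.rep_eq)
  show "norm x = sqrt (inner x x)" by (rule norm_ell2_def)
qed

end

definition cinner :: "'x ell2 \<Rightarrow> 'x ell2 \<Rightarrow> complex"
  where "cinner f g = (\<Sum>\<^sub>\<infinity>x. cnj (coef f x) * coef g x)"

lemma inner_eq_Re_cinner: "inner f g = Re (cinner f g)"
  by (simp add: inner_ell2_def cinner_def)

lemma norm_ell2_sq: "(norm f)\<^sup>2 = (\<Sum>\<^sub>\<infinity>x. (cmod (coef f x))\<^sup>2)"
proof -
  have "(norm f)\<^sup>2 = inner f f" by (simp add: power2_norm_eq_inner)
  also have "\<dots> = (\<Sum>\<^sub>\<infinity>i. Re (cnj (coef f i) * coef f i))"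
    unfolding inner_ell2_def by (intro infsum_Re[symmetric] sqsum_prod coef_summable)
  also have "\<dots> = (\<Sum>\<^sub>\<infinity>x. (cmod (coef f x))\<^sup>2)"
    by (rule infsum_cong) (simp add: cmod_power2 flip: power2_eq_square)
  finally show ?thesis .
qed

definition ket :: "'x \<Rightarrow> 'x ell2"
  where "ket x = Abs_ell2 (\<lambda>y. if y = x then 1 else 0)"

lemma coef_ket: "coef (ket x) y = (if y = x then 1 else 0)"
  unfolding ket_def
  by (subst Abs_ell2_inverse)
     (auto intro!: finite_nonzero_values_imp_summable_on finite_subset[of _ "{x}"] split: if_splits)

lift_definition scaleC :: "complex \<Rightarrow> 'x ell2 \<Rightarrow> 'x ell2" is "\<lambda>c f x. c * f x"
  by (rule sqsum_mult)

lift_definition cscale :: "complex \<Rightarrow> 'x ell2 \<Rightarrow>\<^sub>L 'x ell2" is scaleC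
proof
  fix c :: complex and f g :: "'x ell2" and r :: real
  show "scaleC c (f + g) = scaleC c f + scaleC c g"
    by (rule coef_eqI) (simp add: scaleC.rep_eq plus_ell2.rep_eq algebra_simps)
  show "scaleC c (r *\<^sub>R f) = r *\<^sub>R scaleC c f"
    by (rule coef_eqI) (simp add: scaleC.rep_eq scaleR_ell2.rep_eq algebra_simps)
  have "norm (scaleC c h) = norm h * cmod c" for h :: "'x ell2"
  proof (rule power2_eq_imp_eq)
    show "(norm (scaleC c h))\<^sup>2 = (norm h * cmod c)\<^sup>2"
      unfolding norm_ell2_sq power_mult_distrib
      by (simp add: scaleC.rep_eq norm_mult power_mult_distrib infsum_cmult_right' mult.commute)
  qed auto
  then show "\<exists>K. \<forall>h :: 'x ell2. norm (scaleC c h) \<le> norm h * K" by auto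
qed

lemma scaleC_simps:
  "coef (scaleC c f) x = c * coef f x" "coef (f + g) x = coef f x + coef g x"
  "coef (r *\<^sub>R f) x = of_real r * coef f x" "coef (f - g) x = coef f x - coef g x"
  "coef 0 x = 0" "cscale c f = scaleC c f"
  by (simp_all add: scaleC.rep_eq plus_ell2.rep_eq scaleR_ell2.rep_eq minus_ell2.rep_eq
      zero_ell2.rep_eq cscale.rep_eq)

lemma coef_sum: "coef (sum h F) x = (\<Sum>i\<in>F. coef (h i) x)"
  by (induction F rule: infinite_finite_induct) (simp_all add: scaleC_simps)

lemma cinner_summable: "(\<lambda>x. cnj (coef f x) * coef g x) summable_on UNIV"
  by (intro sqsum_prod coef_summable)

lemma cinner_add_right: "cinner f (g + h) = cinner f g + cinner f h"
  unfolding cinner_def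
  by (subst infsum_add[symmetric, OF cinner_summable cinner_summable], rule infsum_cong)
     (simp add: scaleC_simps algebra_simps)

lemma cinner_scale_right: "cinner f (scaleC c g) = c * cinner f g"
  unfolding cinner_def
  by (subst infsum_cmult_right'[symmetric], rule infsum_cong) (simp add: scaleC_simps algebra_simps)

lemma cinner_commute: "cinner g f = cnj (cinner f g)"
  unfolding cinner_def by (subst infsum_cnj[symmetric]) (simp add: mult.commute)

lemma cinner_ket_right: "cinner f (ket x) = cnj (coef f x)"
proof -
  have "cinner f (ket x) = (\<Sum>\<^sub>\<infinity>y\<in>{x}. cnj (coef f y) * coef (ket x) y)"
    unfolding cinner_def by (rule infsum_cong_neutral) (auto simp: coef_ket)
  then show ?thesis by (simp add: coef_ket)
qed

lemma bounded_linear_cinner_right: "bounded_linear (cinner f)"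
proof -
  have eq: "cinner f = (\<lambda>g. of_real (inner f g) + \<i> * of_real (inner f (cscale (- \<i>) g)))"
  proof
    fix g
    have "inner f (cscale (- \<i>) g) = Im (cinner f g)"
      by (simp add: inner_eq_Re_cinner scaleC_simps cinner_scale_right)
    then show "cinner f g = of_real (inner f g) + \<i> * of_real (inner f (cscale (- \<i>) g))"
      by (simp add: inner_eq_Re_cinner complex_eq_iff)
  qed
  show ?thesis unfolding eq
    by (intro bounded_linear_add bounded_linear_const_mult
        bounded_linear_compose[OF bounded_linear_of_real]
        bounded_linear_compose[OF bounded_linear_inner_right]
        bounded_linear_compose[OF bounded_linear_inner_right] blinfun.bounded_linear_right
        bounded_linear_ident)
qed

lemma ket_has_sum: "((\<lambda>x. scaleC (coef f x) (ket x)) has_sum f) UNIV"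
  unfolding has_sum_def
proof (rule Lim_null[THEN iffD2], rule tendsto_norm_zero_cancel)
  let ?S = "\<lambda>F. \<Sum>x\<in>F. scaleC (coef f x) (ket x)"
  have n2: "(norm (?S F - f))\<^sup>2 = (norm f)\<^sup>2 - (\<Sum>x\<in>F. (cmod (coef f x))\<^sup>2)" if "finite F" for F
  proof -
    have c: "coef (?S F - f) x = (if x \<in> F then 0 else - coef f x)" for x
      using that by (auto simp: scaleC_simps coef_sum coef_ket if_distrib sum.delta cong: if_cong)
    have "(norm (?S F - f))\<^sup>2 = (\<Sum>\<^sub>\<infinity>x\<in>UNIV - F. (cmod (coef f x))\<^sup>2)"
      unfolding norm_ell2_sq c by (rule infsum_cong_neutral) auto
    also have "\<dots> = (\<Sum>\<^sub>\<infinity>x. (cmod (coef f x))\<^sup>2) - (\<Sum>\<^sub>\<infinity>x\<in>F. (cmod (coef f x))\<^sup>2)"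
      by (rule infsum_Diff) (auto intro: coef_summable)
    finally show ?thesis using that by (simp add: norm_ell2_sq)
  qed
  have "((\<lambda>F. (norm f)\<^sup>2 - (\<Sum>x\<in>F. (cmod (coef f x))\<^sup>2)) \<longlongrightarrow> (norm f)\<^sup>2 - (norm f)\<^sup>2)
      (finite_subsets_at_top UNIV)"
    by (intro tendsto_diff tendsto_const)
       (use has_sum_infsum[OF coef_summable[of f UNIV]] in \<open>simp add: has_sum_def norm_ell2_sq\<close>)
  moreover have ev: "\<forall>\<^sub>F F in finite_subsets_at_top UNIV.
      (norm f)\<^sup>2 - (\<Sum>x\<in>F. (cmod (coef f x))\<^sup>2) = (norm (?S F - f))\<^sup>2"
    by (rule eventually_finite_subsets_at_top_weakI) (simp add: n2)
  ultimately have "((\<lambda>F. (norm (?S F - f))\<^sup>2) \<longlongrightarrow> 0) (finite_subsets_at_top UNIV)"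
    using Lim_transform_eventually[OF _ ev] by simp
  then have "((\<lambda>F. sqrt ((norm (?S F - f))\<^sup>2)) \<longlongrightarrow> sqrt 0) (finite_subsets_at_top UNIV)"
    by (rule tendsto_real_sqrt)
  then show "((\<lambda>F. norm (?S F - f)) \<longlongrightarrow> 0) (finite_subsets_at_top UNIV)" by simp
qed

section \<open>Bounded operators\<close>

type_synonym 'x op = "'x ell2 \<Rightarrow>\<^sub>L 'x ell2"

definition adj :: "('x ell2 \<Rightarrow>\<^sub>L 'y ell2) \<Rightarrow> ('y ell2 \<Rightarrow>\<^sub>L 'x ell2)"
  where "adj T = (THE T' :: 'y ell2 \<Rightarrow>\<^sub>L 'x ell2. \<forall>f g. cinner (T' f) g = cinner f (T g))"

lemma adj_unique:
  fixes T :: "'x ell2 \<Rightarrow>\<^sub>L 'y ell2" and T' :: "'y ell2 \<Rightarrow>\<^sub>L 'x ell2"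
  assumes "\<And>f g. cinner (T' f) g = cinner f (T g)"
  shows "adj T = T'"
  unfolding adj_def
proof (rule the_equality)
  fix T'' :: "'y ell2 \<Rightarrow>\<^sub>L 'x ell2" assume a: "\<forall>f g. cinner (T'' f) g = cinner f (T g)"
  show "T'' = T'"
  proof (rule blinfun_eqI, rule coef_eqI)
    fix f x
    have "cinner (T'' f) (ket x) = cinner (T' f) (ket x)" using a assms by simp
    then show "coef (T'' f) x = coef (T' f) x" by (simp add: cinner_ket_right)
  qed
qed (use assms in simp)

lemma cinner_adj_left:
  fixes T :: "'x ell2 \<Rightarrow>\<^sub>L 'y ell2"
  assumes lin: "\<And>c f. T (scaleC c f) = scaleC c (T f)"
  shows "cinner (adj T f) g = cinner f (T g)"
proof -
  define y where "y f x = cinner (T (ket x)) f" for f x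
  have fin: "(\<Sum>x\<in>F. (cmod (y f x))\<^sup>2) \<le> (norm T * norm f)\<^sup>2" if F: "finite F" for f F
  proof -
    define s where "s = (\<Sum>x\<in>F. (cmod (y f x))\<^sup>2)"
    define v where "v = (\<Sum>x\<in>F. scaleC (y f x) (ket x))"
    have cv: "coef v x = (if x \<in> F then y f x else 0)" for x
      using F by (simp add: v_def coef_sum scaleC_simps coef_ket if_distrib sum.delta cong: if_cong)
    have "(norm v)\<^sup>2 = (\<Sum>\<^sub>\<infinity>x\<in>F. (cmod (y f x))\<^sup>2)"
      unfolding norm_ell2_sq cv by (rule infsum_cong_neutral) auto
    then have nv: "(norm v)\<^sup>2 = s" using F by (simp add: s_def)
    have "cinner f (T v) = (\<Sum>x\<in>F. cinner f (scaleC (y f x) (T (ket x))))"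
      by (simp add: v_def blinfun.sum_right lin
          bounded_linear.linear[OF bounded_linear_cinner_right, THEN linear_sum])
    also have "\<dots> = of_real s"
      unfolding s_def of_real_sum
      by (rule sum.cong)
         (simp_all add: cinner_scale_right y_def cinner_commute[of f "blinfun_apply T _"]
           complex_norm_square flip: complex_norm_square)
    finally have "s = inner f (T v)" by (simp add: inner_eq_Re_cinner)
    also have "\<dots> \<le> norm f * norm (T v)" by (rule norm_cauchy_schwarz)
    also have "\<dots> \<le> norm f * (norm T * norm v)" by (intro mult_left_mono norm_blinfun) auto
    finally have "norm v * norm v \<le> norm v * (norm T * norm f)"
      using nv by (simp add: power2_eq_square mult_ac)
    then have "norm v \<le> norm T * norm f"
      by (cases "norm v = 0") (auto simp: mult_le_cancel_left)
    then show ?thesis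
      unfolding s_def[symmetric] nv[symmetric] by (intro power_mono) auto
  qed
  have sy: "(\<lambda>x. (cmod (y f x))\<^sup>2) summable_on UNIV" for f
    by (rule nonneg_bounded_partial_sums_imp_summable_on[where C = "(norm T * norm f)\<^sup>2"])
       (auto simp: eventually_finite_subsets_at_top intro!: exI[of _ "{}"] fin)
  define A where "A f = Abs_ell2 (y f)" for f
  have cA: "coef (A f) x = y f x" for f x
    unfolding A_def using sy by (subst Abs_ell2_inverse) auto
  have nA: "norm (A f) \<le> norm f * norm T" for f
  proof (rule power2_le_imp_le)
    show "(norm (A f))\<^sup>2 \<le> (norm f * norm T)\<^sup>2"
      unfolding norm_ell2_sq cA using fin[of _ f] by (intro infsum_le_finite_sums sy) (auto simp: mult.commute)
  qed auto
  have "bounded_linear A"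
  proof
    show "A (f + g) = A f + A g" for f g
      by (rule coef_eqI) (simp add: cA scaleC_simps y_def cinner_add_right)
    show "A (r *\<^sub>R f) = r *\<^sub>R A f" for r f
      by (rule coef_eqI)
         (simp add: cA scaleC_simps y_def linear_scale[OF bounded_linear.linear[OF bounded_linear_cinner_right]]
           scaleR_conv_of_real)
    show "\<exists>K. \<forall>f. norm (A f) \<le> norm f * K" using nA by auto
  qed
  then have BA: "blinfun_apply (Blinfun A) f = A f" for f by (simp add: bounded_linear_Blinfun_apply)
  have main: "cinner (Blinfun A f) g = cinner f (T g)" for f g
  proof -
    have "((\<lambda>x. cinner f (T (scaleC (coef g x) (ket x)))) has_sum cinner f (T g)) UNIV"
      using has_sum_bounded_linear[OF bounded_linear_compose[OF bounded_linear_cinner_right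
            blinfun.bounded_linear_right] ket_has_sum[of g], of f T] by (simp add: o_def)
    moreover have "cinner f (T (scaleC (coef g x) (ket x))) = cnj (coef (A f) x) * coef g x" for x
      by (simp add: lin cinner_scale_right cA y_def cinner_commute[of "blinfun_apply T _" f])
    ultimately show ?thesis unfolding BA cinner_def[of "A f"] by (simp add: infsumI)
  qed
  show ?thesis using adj_unique[OF main] main by simp
qed

definition ell2_on :: "'x set \<Rightarrow> 'x ell2 set"
  where "ell2_on X = {f. \<forall>x. x \<notin> X \<longrightarrow> coef f x = 0}"

text \<open>
  All the Hilbert spaces below are of the form \<open>ell2_on X\<close>, a closed subspace of \<^typ>\<open>'x ell2\<close>.
  A bounded operator on \<open>ell2_on X\<close> is represented by its extension by zero on the
  orthogonal complement \<open>ell2_on (- X)\<close>, which preserves sums, products, adjoints and norms;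
  the identity of \<open>B(ell2_on X)\<close> is thus the projection \<open>unit_op X\<close>.
\<close>

definition bounded_ops :: "'x set \<Rightarrow> 'x op set"
  where "bounded_ops X = {a :: 'x op. (\<forall>c f. a (scaleC c f) = scaleC c (a f)) \<and>
    (\<forall>f. a f \<in> ell2_on X) \<and> (\<forall>f\<in>ell2_on (- X). a f = 0)}"

text \<open>
  \<open>pull X \<pi>\<close> is the operator \<open>f \<mapsto> f \<circ> \<pi>\<close> into \<open>ell2_on X\<close>; it is only
  meaningful, and only used, for \<open>\<pi>\<close> injective on \<open>X\<close>.
\<close>

lemma sqsum_pull:
  "(\<lambda>x. (cmod (if x \<in> X \<and> inj_on \<pi> X then coef f (\<pi> x) else 0))\<^sup>2) summable_on UNIV"
proof (cases "inj_on \<pi> X")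
  case True
  have "((\<lambda>y. (cmod (coef f y))\<^sup>2) \<circ> \<pi>) summable_on X"
    by (subst summable_on_reindex[OF True, symmetric]) (rule coef_summable)
  then show ?thesis
    using True by (subst summable_on_cong_neutral[where T = X]) (auto simp: o_def)
qed simp

lift_definition pull :: "'x set \<Rightarrow> ('x \<Rightarrow> 'y) \<Rightarrow> 'y ell2 \<Rightarrow>\<^sub>L 'x ell2" is
  "\<lambda>X \<pi> f. Abs_ell2 (\<lambda>x. if x \<in> X \<and> inj_on \<pi> X then coef f (\<pi> x) else 0)"
proof
  fix X :: "'x set" and \<pi> :: "'x \<Rightarrow> 'y"
  define P where "P f = Abs_ell2 (\<lambda>x. if x \<in> X \<and> inj_on \<pi> X then coef f (\<pi> x) else 0)" for f
  have c: "coef (P f) x = (if x \<in> X \<and> inj_on \<pi> X then coef f (\<pi> x) else 0)" for f x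
    unfolding P_def by (subst Abs_ell2_inverse) (use sqsum_pull in auto)
  show "P (f + g) = P f + P g" for f g by (rule coef_eqI) (simp add: c scaleC_simps)
  show "P (r *\<^sub>R f) = r *\<^sub>R P f" for r f by (rule coef_eqI) (simp add: c scaleC_simps)
  have "norm (P f) \<le> norm f * 1" for f
  proof (rule power2_le_imp_le)
    show "(norm (P f))\<^sup>2 \<le> (norm f * 1)\<^sup>2"
    proof (cases "inj_on \<pi> X")
      case True
      have "(norm (P f))\<^sup>2 = (\<Sum>\<^sub>\<infinity>x\<in>X. (cmod (coef f (\<pi> x)))\<^sup>2)"
        unfolding norm_ell2_sq c by (rule infsum_cong_neutral) (auto simp: True)
      also have "\<dots> = (\<Sum>\<^sub>\<infinity>y\<in>\<pi> ` X. (cmod (coef f y))\<^sup>2)"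
        by (subst infsum_reindex[OF True]) (simp add: o_def)
      also have "\<dots> \<le> (norm f)\<^sup>2"
        unfolding norm_ell2_sq by (rule infsum_mono2) (auto intro: coef_summable)
      finally show ?thesis by simp
    qed (simp add: norm_ell2_sq c infsum_nonneg)
  qed auto
  then show "\<exists>K. \<forall>f. norm (P f) \<le> norm f * K" by blast
qed

lemma coef_pull: "inj_on \<pi> X \<Longrightarrow> coef (pull X \<pi> f) x = (if x \<in> X then coef f (\<pi> x) else 0)"
  unfolding pull.rep_eq by (subst Abs_ell2_inverse) (use sqsum_pull[of X \<pi> f] in auto)

definition unit_op :: "'x set \<Rightarrow> 'x op"
  where "unit_op X = pull X (\<lambda>x. x)"

text \<open>The Hilbert space tensor product of \<open>ell2_on X\<close> and \<open>ell2_on Y\<close> is \<open>ell2_on (X \<times> Y)\<close>.\<close>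

lift_definition tensor :: "'x ell2 \<Rightarrow> 'y ell2 \<Rightarrow> ('x \<times> 'y) ell2" (infixr \<open>\<otimes>\<^sub>2\<close> 70) is
  "\<lambda>f g (x, y). f x * g y"
proof -
  fix f :: "'x \<Rightarrow> complex" and g :: "'y \<Rightarrow> complex"
  assume "(\<lambda>x. (cmod (f x))\<^sup>2) summable_on UNIV" "(\<lambda>y. (cmod (g y))\<^sup>2) summable_on UNIV"
  then have "(\<lambda>(x, y). (cmod (f x))\<^sup>2 * (cmod (g y))\<^sup>2) summable_on UNIV \<times> UNIV"
    by (intro summable_on_SigmaI[where g = "\<lambda>x. (cmod (f x))\<^sup>2 * (\<Sum>\<^sub>\<infinity>y. (cmod (g y))\<^sup>2)"])
       (auto intro!: has_sum_cmult_right summable_on_cmult_left)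
  then show "(\<lambda>p. (cmod (case p of (x, y) \<Rightarrow> f x * g y))\<^sup>2) summable_on UNIV"
    by (simp add: case_prod_unfold norm_mult power_mult_distrib)
qed

lift_definition slice :: "'y \<Rightarrow> ('x \<times> 'y) ell2 \<Rightarrow> 'x ell2" is "\<lambda>y f x. f (x, y)"
proof -
  fix y :: 'y and f :: "'x \<times> 'y \<Rightarrow> complex"
  assume "(\<lambda>p. (cmod (f p))\<^sup>2) summable_on UNIV"
  then have "(\<lambda>p. (cmod (f p))\<^sup>2) summable_on (\<lambda>x. (x, y)) ` UNIV"
    by (rule summable_on_subset_banach) simp
  then show "(\<lambda>x. (cmod (f (x, y)))\<^sup>2) summable_on UNIV"
    by (subst (asm) summable_on_reindex) (auto simp: inj_on_def o_def)
qed

lemma swap_summable: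
  "(f :: 'x \<times> 'y \<Rightarrow> real) summable_on UNIV \<longleftrightarrow> (\<lambda>(y, x). f (x, y)) summable_on UNIV \<times> UNIV"
  by (subst summable_on_reindex_bij_betw[of prod.swap UNIV UNIV f, symmetric])
     (auto simp: case_prod_unfold prod.swap_def intro: bij_swap[unfolded prod.swap_def])

lemma norm_slice_has_sum: "((\<lambda>y. (norm (slice y f))\<^sup>2) has_sum (norm f)\<^sup>2) UNIV"
proof -
  have s: "(\<lambda>(y, x). (cmod (coef f (x, y)))\<^sup>2) summable_on UNIV \<times> UNIV"
    using coef_summable[of f UNIV] swap_summable[of "\<lambda>p. (cmod (coef f p))\<^sup>2"] by simp
  have "(\<Sum>\<^sub>\<infinity>y. (norm (slice y f))\<^sup>2) = (\<Sum>\<^sub>\<infinity>(y, x)\<in>UNIV \<times> UNIV. (cmod (coef f (x, y)))\<^sup>2)"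
    unfolding norm_ell2_sq slice.rep_eq by (rule infsum_Sigma'_banach[OF s])
  also have "\<dots> = (norm f)\<^sup>2"
    unfolding norm_ell2_sq
    by (subst infsum_reindex_bij_betw[of prod.swap UNIV UNIV, symmetric])
       (auto simp: case_prod_unfold prod.swap_def intro: bij_swap[unfolded prod.swap_def])
  finally show ?thesis
    using summable_on_Sigma_banach[OF s] by (simp add: norm_ell2_sq slice.rep_eq has_sum_iff)
qed

lemma amp_aux:
  fixes a :: "'x ell2 \<Rightarrow> 'x ell2" and f :: "('x \<times> 'y) ell2"
  assumes "bounded_linear a"
  shows "(\<lambda>p. (cmod (case p of (x, y) \<Rightarrow> coef (a (slice y f)) x))\<^sup>2) summable_on UNIV"
proof (subst swap_summable, rule summable_on_SigmaI)
  obtain K where K: "norm (a h) \<le> norm h * K" for h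
    using bounded_linear.bounded[OF assms] by blast
  show "(\<lambda>y. (norm (a (slice y f)))\<^sup>2) summable_on UNIV"
  proof (rule summable_on_comparison_test)
    show "(\<lambda>y. (norm (slice y f))\<^sup>2 * K\<^sup>2) summable_on UNIV"
      using norm_slice_has_sum[of f] by (intro summable_on_cmult_left) (auto simp: has_sum_iff)
    show "(norm (a (slice y f)))\<^sup>2 \<le> (norm (slice y f))\<^sup>2 * K\<^sup>2" for y
      using power_mono[OF K[of "slice y f"], of 2] by (simp add: power_mult_distrib)
  qed auto
  show "((\<lambda>x. case (y, x) of (y, x) \<Rightarrow> (cmod (case (x, y) of (x, y) \<Rightarrow> coef (a (slice y f)) x))\<^sup>2)
      has_sum (norm (a (slice y f)))\<^sup>2) UNIV" for y
    by (simp add: norm_ell2_sq coef_summable)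
qed auto

text \<open>\<open>amp a\<close> is \<open>a \<otimes> 1\<close>: it applies \<open>a\<close> to the first variable of \<open>f\<close>, see \<open>coef_amp\<close> and \<open>amp_tensor\<close>.\<close>

lift_definition amp :: "'x op \<Rightarrow> ('x \<times> 'y) op" is
  "\<lambda>a f. Abs_ell2 (\<lambda>(x, y). coef (a (slice y f)) x)"
proof
  fix a :: "'x ell2 \<Rightarrow> 'x ell2" assume bl: "bounded_linear a"
  define A where "A f = Abs_ell2 (\<lambda>(x, y). coef (a (slice y f)) x)" for f :: "('x \<times> 'y) ell2"
  have c: "coef (A f) (x, y) = coef (a (slice y f)) x" for f x y
    unfolding A_def by (subst Abs_ell2_inverse) (use amp_aux[OF bl] in auto)
  have sl: "slice y (A f) = a (slice y f)" for y f by (rule coef_eqI) (simp add: slice.rep_eq c)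
  have s1: "slice y (f + g) = slice y f + slice y g" for y :: 'y and f g :: "('x \<times> 'y) ell2"
    by (rule coef_eqI) (simp add: slice.rep_eq scaleC_simps)
  have s2: "slice y (r *\<^sub>R f) = r *\<^sub>R slice y f" for y :: 'y and f :: "('x \<times> 'y) ell2" and r
    by (rule coef_eqI) (simp add: slice.rep_eq scaleC_simps)
  show "A (f + g) = A f + A g" for f g
    by (rule coef_eqI) (auto simp: c scaleC_simps s1 linear_add[OF bounded_linear.linear[OF bl]])
  show "A (r *\<^sub>R f) = r *\<^sub>R A f" for r f
    by (rule coef_eqI) (auto simp: c scaleC_simps s2 linear_scale[OF bounded_linear.linear[OF bl]])
  obtain K where K: "norm (a h) \<le> norm h * K" "K \<ge> 0" for h
    using bounded_linear.nonneg_bounded[OF bl] by blast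
  have "norm (A f) \<le> norm f * K" for f
  proof (rule power2_le_imp_le)
    have "((\<lambda>y. (norm (slice y f))\<^sup>2 * K\<^sup>2) has_sum (norm f)\<^sup>2 * K\<^sup>2) UNIV"
      by (intro has_sum_cmult_left norm_slice_has_sum)
    moreover have "(norm (slice y (A f)))\<^sup>2 \<le> (norm (slice y f))\<^sup>2 * K\<^sup>2" for y
      using power_mono[OF K(1)[of "slice y f"], of 2] by (simp add: power_mult_distrib sl)
    ultimately show "(norm (A f))\<^sup>2 \<le> (norm f * K)\<^sup>2"
      unfolding power_mult_distrib by (rule has_sum_mono[OF norm_slice_has_sum[of "A f"]])
  qed (use K in auto)
  then show "\<exists>K. \<forall>f. norm (A f) \<le> norm f * K" by blast
qed

lemma coef_amp: "coef (amp a f) (x, y) = coef (a (slice y f)) x"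
  unfolding amp.rep_eq
  by (subst Abs_ell2_inverse) (use amp_aux[OF blinfun.bounded_linear_right[of a], of f] in auto)

lemma amp_tensor:
  fixes a :: "'x op"
  assumes "\<And>c f. a (scaleC c f) = scaleC c (a f)"
  shows "amp a (f \<otimes>\<^sub>2 g) = a f \<otimes>\<^sub>2 g"
proof (rule coef_eqI, clarify)
  fix x y
  have "slice y (f \<otimes>\<^sub>2 g) = scaleC (coef g y) f"
    by (rule coef_eqI) (simp add: slice.rep_eq tensor.rep_eq scaleC_simps)
  then show "coef (amp a (f \<otimes>\<^sub>2 g)) (x, y) = coef (a f \<otimes>\<^sub>2 g) (x, y)"
    by (simp add: coef_amp tensor.rep_eq assms scaleC_simps)
qed

section \<open>C*-algebras of operators\<close>

definition cstar_subalgebra :: "'x set \<Rightarrow> 'x op set \<Rightarrow> bool"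
  where "cstar_subalgebra X A \<longleftrightarrow> A \<subseteq> bounded_ops X \<and> 0 \<in> A \<and>
    (\<forall>a\<in>A. \<forall>b\<in>A. a + b \<in> A \<and> a o\<^sub>L b \<in> A) \<and> (\<forall>c. \<forall>a\<in>A. cscale c o\<^sub>L a \<in> A) \<and>
    (\<forall>a\<in>A. adj a \<in> A) \<and> closed A"

definition cstar_generated :: "'x set \<Rightarrow> 'x op set \<Rightarrow> 'x op set"
  where "cstar_generated X M = \<Inter>{A. cstar_subalgebra X A \<and> M \<subseteq> A}"

definition is_state :: "'x set \<Rightarrow> 'x op set \<Rightarrow> ('x op \<Rightarrow> complex) \<Rightarrow> bool"
  where "is_state X A \<omega> \<longleftrightarrow>
    (\<forall>a\<in>A. \<forall>b\<in>A. \<omega> (a + b) = \<omega> a + \<omega> b) \<and> (\<forall>c. \<forall>a\<in>A. \<omega> (cscale c o\<^sub>L a) = c * \<omega> a) \<and>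
    (\<forall>a\<in>A. \<omega> (adj a o\<^sub>L a) \<in> \<real>\<^sub>\<ge>\<^sub>0) \<and> \<omega> (unit_op X) = 1"

text \<open>Negative powers refer to the inverse of \<open>f\<close> as a bijection of \<open>A\<close>.\<close>

definition int_iterate :: "'a set \<Rightarrow> ('a \<Rightarrow> 'a) \<Rightarrow> int \<Rightarrow> 'a \<Rightarrow> 'a"
  where "int_iterate A f n = (if n \<ge> 0 then f ^^ nat n else inv_into A f ^^ nat (- n))"

section \<open>Group systems\<close>

definition cancels :: "'s \<times> bool \<Rightarrow> 's \<times> bool \<Rightarrow> bool"
  where "cancels p q \<longleftrightarrow> fst p = fst q \<and> snd p \<noteq> snd q"

definition red_cons :: "'s \<times> bool \<Rightarrow> ('s \<times> bool) list \<Rightarrow> ('s \<times> bool) list"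
  where "red_cons p w = (if w \<noteq> [] \<and> cancels p (hd w) then tl w else p # w)"

text \<open>Words are reduced; \<open>(s, True)\<close> stands for the letter \<open>s\<close> and \<open>(s, False)\<close> for its inverse.\<close>

definition free_group :: "'s set \<Rightarrow> ('s \<times> bool) list monoid"
  where "free_group S = \<lparr>carrier = {w. set w \<subseteq> S \<times> UNIV \<and> successively (\<lambda>p q. \<not> cancels p q) w},
    mult = (\<lambda>u v. foldr red_cons u v), one = []\<rparr>"

lemma red_cons_simps: "red_cons p [] = [p]" "red_cons p (q # w) = (if cancels p q then w else p # q # w)"
  by (auto simp: red_cons_def)

abbreviation freely_reduced :: "('s \<times> bool) list \<Rightarrow> bool"
  where "freely_reduced \<equiv> successively (\<lambda>p q. \<not> cancels p q)"

lemma red_cons_reduced: "freely_reduced w \<Longrightarrow> freely_reduced (red_cons p w)"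
  by (cases w) (auto simp: red_cons_simps successively_Cons)

lemma foldr_red_cons_reduced: "freely_reduced w \<Longrightarrow> freely_reduced (foldr red_cons u w)"
  by (induction u) (auto intro: red_cons_reduced)

lemma foldr_red_cons_set: "set (foldr red_cons u w) \<subseteq> set u \<union> set w"
proof (induction u)
  case (Cons p u)
  have "set (red_cons p v) \<subseteq> insert p (set v)" for v :: "('a \<times> bool) list"
    by (cases v) (auto simp: red_cons_simps)
  from this[of "foldr red_cons u w"] Cons show ?case by auto
qed simp

lemma red_cons_cancel:
  assumes "cancels p q" "freely_reduced w"
  shows "red_cons p (red_cons q w) = w"
proof (cases w)
  case (Cons r v)
  show ?thesis
  proof (cases "cancels q r")
    case True
    then have "r = p" using assms(1) by (cases p; cases q; cases r) (auto simp: cancels_def)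
    moreover have "v = [] \<or> \<not> cancels r (hd v)" using assms(2) Cons by (auto simp: successively_Cons)
    ultimately show ?thesis using True Cons by (cases v) (auto simp: red_cons_simps)
  qed (use assms Cons in \<open>auto simp: red_cons_simps\<close>)
qed (use assms in \<open>simp add: red_cons_simps\<close>)

lemma foldr_red_cons_red_cons:
  assumes "freely_reduced w"
  shows "foldr red_cons (red_cons p u) w = red_cons p (foldr red_cons u w)"
  by (cases u) (auto simp: red_cons_simps red_cons_cancel assms foldr_red_cons_reduced)

lemma foldr_red_cons_assoc:
  assumes "freely_reduced w"
  shows "foldr red_cons (foldr red_cons u v) w = foldr red_cons u (foldr red_cons v w)"
  by (induction u) (simp_all add: foldr_red_cons_red_cons assms)

lemma foldr_red_cons_Nil: "freely_reduced u \<Longrightarrow> foldr red_cons u [] = u"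
proof (induction u)
  case (Cons p u)
  then show ?case by (cases u) (auto simp: red_cons_simps)
qed simp

lemma foldr_red_cons_inv:
  "freely_reduced v \<Longrightarrow> foldr red_cons (rev (map (apsnd Not) u)) (foldr red_cons u v) = v"
proof (induction u arbitrary: v)
  case (Cons p u)
  have "cancels (apsnd Not p) p" by (cases p) (simp add: cancels_def)
  then show ?case using Cons by (simp add: red_cons_cancel foldr_red_cons_reduced)
qed simp

lemma group_free_group: "group (free_group S)"
proof (rule groupI)
  fix x assume "x \<in> carrier (free_group S)"
  then have x: "set x \<subseteq> S \<times> UNIV" "freely_reduced x" by (auto simp: free_group_def)
  let ?y = "rev (map (apsnd Not) x)"
  have "set ?y \<subseteq> S \<times> UNIV" using x by force
  moreover have "freely_reduced ?y"
    using x(2) by (auto simp: successively_rev successively_map cancels_def elim!: successively_mono)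
  moreover have "foldr red_cons ?y x = []"
    using foldr_red_cons_inv[of "[]" x] foldr_red_cons_Nil[OF x(2)] by simp
  ultimately show "\<exists>y\<in>carrier (free_group S). y \<otimes>\<^bsub>free_group S\<^esub> x = \<one>\<^bsub>free_group S\<^esub>"
    unfolding free_group_def by (intro bexI[of _ ?y]) simp_all
qed (use foldr_red_cons_set in \<open>fastforce simp: free_group_def foldr_red_cons_reduced foldr_red_cons_assoc\<close>)+

definition free_group_map :: "('s \<Rightarrow> 't) \<Rightarrow> ('s \<times> bool) list \<Rightarrow> ('t \<times> bool) list"
  where "free_group_map t = map (apfst t)"

lemma free_group_map_iso:
  assumes "bij_betw t S S'"
  shows "free_group_map t \<in> iso (free_group S) (free_group S')"
proof -
  have inj: "inj_on t S" and im: "t ` S = S'" using assms by (auto simp: bij_betw_def)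
  have canc: "cancels (apfst t p) (apfst t q) \<longleftrightarrow> cancels p q" if "fst p \<in> S" "fst q \<in> S" for p q
    using that inj by (cases p; cases q) (auto simp: cancels_def inj_on_eq_iff)
  have canc2: "cancels (t a, b) (t c, d) \<longleftrightarrow> cancels (a, b) (c, d)" if "a \<in> S" "c \<in> S" for a b c d
    using canc[of "(a, b)" "(c, d)"] that by simp
  have red: "freely_reduced (map (apfst t) w) \<longleftrightarrow> freely_reduced w" if "set w \<subseteq> S \<times> UNIV" for w
    unfolding successively_map using that
    by (induction w rule: induct_list012) (auto simp: canc2)
  have cons: "map (apfst t) (red_cons p w) = red_cons (apfst t p) (map (apfst t) w)"
    if "set (p # w) \<subseteq> S \<times> UNIV" for p w
    using that by (cases w) (auto simp: red_cons_simps canc2)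
  have fold: "map (apfst t) (foldr red_cons u v) = foldr red_cons (map (apfst t) u) (map (apfst t) v)"
    if "set u \<subseteq> S \<times> UNIV" "set v \<subseteq> S \<times> UNIV" for u v
    using that(1)
  proof (induction u)
    case (Cons p u)
    have "set (p # foldr red_cons u v) \<subseteq> S \<times> UNIV"
      using Cons.prems that(2) foldr_red_cons_set[of u v] by auto
    from cons[OF this] Cons show ?case by simp
  qed simp
  have "inj_on (map (apfst t)) {w. set w \<subseteq> S \<times> (UNIV :: bool set)}"
    by (rule inj_on_subset[OF inj_on_map_lists[of "apfst t" "S \<times> UNIV"]])
       (use inj in \<open>auto simp: inj_on_def\<close>)
  then have i: "inj_on (free_group_map t) (carrier (free_group S))"
    unfolding free_group_map_def by (rule inj_on_subset) (auto simp: free_group_def)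
  have "w \<in> free_group_map t ` carrier (free_group S)" if w: "w \<in> carrier (free_group S')" for w
  proof -
    let ?v = "map (apfst (inv_into S t)) w"
    have ww: "set w \<subseteq> S' \<times> UNIV" "freely_reduced w" using w by (auto simp: free_group_def)
    have "map (apfst t) ?v = w"
      using ww(1) im by (auto simp: map_idI f_inv_into_f intro!: map_idI)
    moreover have v: "set ?v \<subseteq> S \<times> UNIV" using ww(1) im by (auto intro!: inv_into_into)
    ultimately show ?thesis
      using ww(2) red[OF v] unfolding free_group_map_def free_group_def
      by (intro image_eqI[of _ _ ?v]) auto
  qed
  moreover have "free_group_map t w \<in> carrier (free_group S')" if "w \<in> carrier (free_group S)" for w
    using that red[of w] im by (force simp: free_group_def free_group_map_def)
  ultimately have "bij_betw (free_group_map t) (carrier (free_group S)) (carrier (free_group S'))"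
    using i by (auto simp: bij_betw_def)
  moreover have "free_group_map t (u \<otimes>\<^bsub>free_group S\<^esub> v) =
      free_group_map t u \<otimes>\<^bsub>free_group S'\<^esub> free_group_map t v"
    if "u \<in> carrier (free_group S)" "v \<in> carrier (free_group S)" for u v
    using that fold[of u v] by (auto simp: free_group_def free_group_map_def)
  ultimately show ?thesis by (auto simp: iso_def hom_def bij_betw_def)
qed

definition left_regular :: "('g, 'm) monoid_scheme \<Rightarrow> 'g \<Rightarrow> 'g op"
  where "left_regular G g = pull (carrier G) (\<lambda>h. inv\<^bsub>G\<^esub> g \<otimes>\<^bsub>G\<^esub> h)"

definition reduced_cstar :: "('g, 'm) monoid_scheme \<Rightarrow> 'g op set"
  where "reduced_cstar G = cstar_generated (carrier G) (left_regular G ` carrier G)"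

definition group_vac :: "('g, 'm) monoid_scheme \<Rightarrow> 'g ell2"
  where "group_vac G = ket \<one>\<^bsub>G\<^esub>"

definition group_state :: "('g, 'm) monoid_scheme \<Rightarrow> 'g op \<Rightarrow> complex"
  where "group_state G a = cinner (group_vac G) (a (group_vac G))"

definition group_unitary :: "('g, 'm) monoid_scheme \<Rightarrow> ('g \<Rightarrow> 'g) \<Rightarrow> 'g op"
  where "group_unitary G T = pull (carrier G) (inv_into (carrier G) T)"

definition group_aut :: "('g, 'm) monoid_scheme \<Rightarrow> ('g \<Rightarrow> 'g) \<Rightarrow> 'g op \<Rightarrow> 'g op"
  where "group_aut G T a = group_unitary G T o\<^sub>L a o\<^sub>L adj (group_unitary G T)"

definition ergodic :: "('g, 'm) monoid_scheme \<Rightarrow> ('g \<Rightarrow> 'g) \<Rightarrow> bool"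
  where "ergodic G T \<longleftrightarrow>
    {x \<in> ell2_on (carrier G). \<forall>n. int_iterate (ell2_on (carrier G)) (group_unitary G T) n x = x} =
    {scaleC c (group_vac G) | c. True}"

definition identity_system :: "('g, 'm) monoid_scheme \<Rightarrow> ('g \<Rightarrow> 'g) \<Rightarrow> bool"
  where "identity_system G T \<longleftrightarrow> (\<forall>a\<in>reduced_cstar G. group_aut G T a = a)"

section \<open>The reduced free product\<close>

datatype fp_index = I1 | I2

text \<open>
  Since \<open>H\<^sub>\<iota>\<^sup>\<circ>\<close> consists of the square-summable functions on \<open>\<Gamma>\<^sub>\<iota> - {1}\<close>, the Hilbert
  space \<open>H\<close> of the free product is \<open>ell2_on (fp_words G)\<close>: the word \<open>[(\<iota>\<^sub>1, g\<^sub>1), \<dots>, (\<iota>\<^sub>n, g\<^sub>n)]\<close> stands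
  for the basis vector \<open>ket g\<^sub>1 \<otimes> \<cdots> \<otimes> ket g\<^sub>n\<close> of \<open>H\<^sub>\<iota>\<^sub>1\<^sup>\<circ> \<otimes> \<cdots> \<otimes> H\<^sub>\<iota>\<^sub>n\<^sup>\<circ>\<close>, and the empty word for \<open>\<Omega>\<close>.
\<close>

definition fp_words :: "(fp_index \<Rightarrow> ('g, 'm) monoid_scheme) \<Rightarrow> (fp_index \<times> 'g) list set"
  where "fp_words G = {w. (\<forall>(\<iota>, g)\<in>set w. g \<in> carrier (G \<iota>) \<and> g \<noteq> \<one>\<^bsub>G \<iota>\<^esub>) \<and> distinct_adj (map fst w)}"

definition fp_words_not :: "(fp_index \<Rightarrow> ('g, 'm) monoid_scheme) \<Rightarrow> fp_index \<Rightarrow> (fp_index \<times> 'g) list set"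
  where "fp_words_not G \<iota> = {w \<in> fp_words G. w \<noteq> [] \<longrightarrow> fst (hd w) \<noteq> \<iota>}"

text \<open>
  \<open>H(\<iota>)\<close> is \<open>ell2_on (fp_words_not G \<iota>)\<close>. The unitary \<open>V\<^sub>\<iota> : H\<^sub>\<iota> \<otimes> H(\<iota>) \<rightarrow> H\<close> maps basis vectors
  to basis vectors; \<open>fp_split G \<iota>\<close> is the inverse of the underlying
  bijection \<open>\<Gamma>\<^sub>\<iota> \<times> fp_words_not G \<iota> \<rightarrow> fp_words G\<close>.
\<close>

definition fp_split :: "(fp_index \<Rightarrow> ('g, 'm) monoid_scheme) \<Rightarrow> fp_index \<Rightarrow> (fp_index \<times> 'g) list \<Rightarrow>
    'g \<times> (fp_index \<times> 'g) list"
  where "fp_split G \<iota> w = (if w \<noteq> [] \<and> fst (hd w) = \<iota> then (snd (hd w), tl w) else (\<one>\<^bsub>G \<iota>\<^esub>, w))"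

definition fp_V :: "(fp_index \<Rightarrow> ('g, 'm) monoid_scheme) \<Rightarrow> fp_index \<Rightarrow>
    ('g \<times> (fp_index \<times> 'g) list) ell2 \<Rightarrow>\<^sub>L (fp_index \<times> 'g) list ell2"
  where "fp_V G \<iota> = pull (fp_words G) (fp_split G \<iota>)"

definition fp_embed :: "(fp_index \<Rightarrow> ('g, 'm) monoid_scheme) \<Rightarrow> fp_index \<Rightarrow> 'g op \<Rightarrow> (fp_index \<times> 'g) list op"
  where "fp_embed G \<iota> a = fp_V G \<iota> o\<^sub>L amp a o\<^sub>L adj (fp_V G \<iota>)"

definition fp_algebra :: "(fp_index \<Rightarrow> ('g, 'm) monoid_scheme) \<Rightarrow> (fp_index \<times> 'g) list op set"
  where "fp_algebra G = cstar_generated (fp_words G) (\<Union>\<iota>. fp_embed G \<iota> ` reduced_cstar (G \<iota>))"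

definition fp_state :: "(fp_index \<Rightarrow> ('g, 'm) monoid_scheme) \<Rightarrow> (fp_index \<times> 'g) list op \<Rightarrow> complex"
  where "fp_state G = (\<lambda>a\<in>fp_algebra G. cinner (ket []) (blinfun_apply a (ket [])))"

definition fp_unitary :: "(fp_index \<Rightarrow> ('g, 'm) monoid_scheme) \<Rightarrow> (fp_index \<Rightarrow> 'g \<Rightarrow> 'g) \<Rightarrow> (fp_index \<times> 'g) list op"
  where "fp_unitary G T =
    pull (fp_words G) (map (\<lambda>(\<iota>, g). (\<iota>, inv_into (carrier (G \<iota>)) (T \<iota>) g)))"

definition fp_aut :: "(fp_index \<Rightarrow> ('g, 'm) monoid_scheme) \<Rightarrow> (fp_index \<Rightarrow> 'g \<Rightarrow> 'g) \<Rightarrow>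
    (fp_index \<times> 'g) list op \<Rightarrow> (fp_index \<times> 'g) list op"
  where "fp_aut G T a = fp_unitary G T o\<^sub>L a o\<^sub>L adj (fp_unitary G T)"

text \<open>Functionals on the algebra are represented by extensional functions, so that they are equal iff
  they agree on it.\<close>

definition r_joinings :: "(fp_index \<Rightarrow> ('g, 'm) monoid_scheme) \<Rightarrow> (fp_index \<Rightarrow> 'g \<Rightarrow> 'g) \<Rightarrow>
    ((fp_index \<times> 'g) list op \<Rightarrow> complex) set"
  where "r_joinings G T = {\<omega> \<in> extensional (fp_algebra G).
    is_state (fp_words G) (fp_algebra G) \<omega> \<and>
    (\<forall>\<iota>. \<forall>a\<in>reduced_cstar (G \<iota>). \<omega> (fp_embed G \<iota> a) = group_state (G \<iota>) a) \<and>
    (\<forall>n. \<forall>a\<in>fp_algebra G. \<omega> (int_iterate (fp_algebra G) (fp_aut G T) n a) = \<omega> a)}"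

definition r_disjoint :: "(fp_index \<Rightarrow> ('g, 'm) monoid_scheme) \<Rightarrow> (fp_index \<Rightarrow> 'g \<Rightarrow> 'g) \<Rightarrow> bool"
  where "r_disjoint G T \<longleftrightarrow> r_joinings G T = {fp_state G}"

subsection \<open>Elementary tensors\<close>

text \<open>
  The vector \<open>x\<^sub>1 \<otimes> \<cdots> \<otimes> x\<^sub>n\<close> of \<open>H\<^sub>\<iota>\<^sub>1\<^sup>\<circ> \<otimes> \<cdots> \<otimes> H\<^sub>\<iota>\<^sub>n\<^sup>\<circ>\<close>. The remaining facts of this theory
  confirm that \<open>fp_V\<close> and \<open>fp_unitary\<close> act on these vectors as required of \<open>V\<^sub>\<iota>\<close> and \<open>U\<close>.
\<close>

fun etensor :: "(fp_index \<times> 'g ell2) list \<Rightarrow> (fp_index \<times> 'g) list ell2"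
  where "etensor [] = ket []"
  | "etensor ((\<iota>, x) # xs) =
      pull {w. w \<noteq> [] \<and> fst (hd w) = \<iota>} (\<lambda>w. (snd (hd w), tl w)) (x \<otimes>\<^sub>2 etensor xs)"

definition fp_vectors :: "(fp_index \<Rightarrow> ('g, 'm) monoid_scheme) \<Rightarrow> (fp_index \<times> 'g ell2) list \<Rightarrow> bool"
  where "fp_vectors G xs \<longleftrightarrow>
    (\<forall>(\<iota>, x)\<in>set xs. x \<in> ell2_on (carrier (G \<iota>) - {\<one>\<^bsub>G \<iota>\<^esub>})) \<and> distinct_adj (map fst xs)"

lemma coef_etensor:
  "coef (etensor []) w = (if w = [] then 1 else 0)"
  "coef (etensor ((\<iota>, x) # xs)) [] = 0"
  "coef (etensor ((\<iota>, x) # xs)) ((\<kappa>, g) # w) = (if \<kappa> = \<iota> then coef x g * coef (etensor xs) w else 0)"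
proof -
  have "inj_on (\<lambda>w. (snd (hd w), tl w)) {w :: (fp_index \<times> 'a) list. w \<noteq> [] \<and> fst (hd w) = \<iota>}"
    by (rule inj_onI) (auto simp: neq_Nil_conv)
  note c = coef_pull[OF this]
  show "coef (etensor ((\<iota>, x) # xs)) [] = 0" by (simp add: c)
  show "coef (etensor ((\<iota>, x) # xs)) ((\<kappa>, g) # w) =
      (if \<kappa> = \<iota> then coef x g * coef (etensor xs) w else 0)"
    by (simp add: c tensor.rep_eq)
qed (simp add: coef_ket)

lemma etensor_ket: "etensor (map (apsnd ket) w) = ket w"
proof (induction w)
  case (Cons p w)
  show ?case
  proof (rule coef_eqI)
    fix v show "coef (etensor (map (apsnd ket) (p # w))) v = coef (ket (p # w)) v"
      by (cases p; cases v) (auto simp: coef_etensor coef_ket Cons split: if_splits simp del: etensor.simps)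
  qed
qed simp

lemma etensor_support:
  assumes "fp_vectors G xs" "coef (etensor xs) w \<noteq> 0"
  shows "map fst w = map fst xs \<and> w \<in> fp_words G"
proof -
  have *: "map fst w = map fst xs \<and> (\<forall>(\<iota>, g)\<in>set w. g \<in> carrier (G \<iota>) \<and> g \<noteq> \<one>\<^bsub>G \<iota>\<^esub>)"
    if "\<forall>(\<iota>, x)\<in>set xs. x \<in> ell2_on (carrier (G \<iota>) - {\<one>\<^bsub>G \<iota>\<^esub>})" "coef (etensor xs) w \<noteq> 0"
    using that
  proof (induction xs arbitrary: w)
    case Nil
    then show ?case by (auto simp: coef_etensor split: if_splits simp del: etensor.simps)
  next
    case (Cons p xs)
    obtain \<iota> x where p: "p = (\<iota>, x)" by (cases p)
    show ?case
    proof (cases w)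
      case Nil
      then show ?thesis using Cons.prems p by (simp add: coef_etensor del: etensor.simps)
    next
      case (Cons q v)
      obtain \<kappa> g where q: "q = (\<kappa>, g)" by (cases q)
      have "\<kappa> = \<iota>" "coef x g \<noteq> 0" "coef (etensor xs) v \<noteq> 0"
        using Cons.prems p q Cons by (auto simp: coef_etensor split: if_splits simp del: etensor.simps)
      moreover have "x \<in> ell2_on (carrier (G \<iota>) - {\<one>\<^bsub>G \<iota>\<^esub>})" using Cons.prems p by auto
      ultimately show ?thesis using Cons.IH[of v] Cons.prems p q Cons by (auto simp: ell2_on_def)
    qed
  qed
  show ?thesis using * assms by (auto simp: fp_vectors_def fp_words_def)
qed

lemma inj_on_fp_split: "inj_on (fp_split G \<iota>) (fp_words G)"
  by (rule inj_onI) (auto simp: fp_split_def fp_words_def neq_Nil_conv split: if_splits)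

lemma fp_split_image: 
  assumes "group (G \<iota>)"
  shows "fp_split G \<iota> ` fp_words G = carrier (G \<iota>) \<times> fp_words_not G \<iota>"
proof (intro equalityI subsetI)
  fix p assume "p \<in> fp_split G \<iota> ` fp_words G"
  then obtain w where w: "w \<in> fp_words G" "p = fp_split G \<iota> w" by auto
  show "p \<in> carrier (G \<iota>) \<times> fp_words_not G \<iota>"
    using w group.is_monoid[OF assms] monoid.one_closed[of "G \<iota>"]
    by (cases w) (auto simp: fp_split_def fp_words_def fp_words_not_def distinct_adj_Cons hd_map)
next
  fix p assume p: "p \<in> carrier (G \<iota>) \<times> fp_words_not G \<iota>"
  then obtain g w where gw: "p = (g, w)" "g \<in> carrier (G \<iota>)" "w \<in> fp_words G" "w \<noteq> [] \<longrightarrow> fst (hd w) \<noteq> \<iota>"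
    by (auto simp: fp_words_not_def)
  show "p \<in> fp_split G \<iota> ` fp_words G"
  proof (cases "g = \<one>\<^bsub>G \<iota>\<^esub>")
    case True
    then have "p = fp_split G \<iota> w" using gw by (auto simp: fp_split_def)
    then show ?thesis using gw by blast
  next
    case False
    then have "(\<iota>, g) # w \<in> fp_words G"
      using gw by (cases w) (auto simp: fp_words_def distinct_adj_Cons)
    moreover have "p = fp_split G \<iota> ((\<iota>, g) # w)" using gw by (simp add: fp_split_def)
    ultimately show ?thesis by blast
  qed
qed

lemma fp_V_vac:
  assumes "fp_vectors G xs" "xs \<noteq> [] \<longrightarrow> fst (hd xs) \<noteq> \<iota>"
  shows "fp_V G \<iota> (group_vac (G \<iota>) \<otimes>\<^sub>2 etensor xs) = etensor xs"
proof (rule coef_eqI)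
  fix w
  have *: "coef (etensor xs) w = 0" if "w \<noteq> []" "fst (hd w) = \<iota>"
  proof (rule ccontr)
    assume "coef (etensor xs) w \<noteq> 0"
    then have "map fst w = map fst xs" using etensor_support[OF assms(1)] by blast
    then have "xs \<noteq> []" "fst (hd w) = fst (hd xs)" using that by (cases w; cases xs; simp)+
    then show False using that assms by simp
  qed
  have "coef (fp_V G \<iota> (group_vac (G \<iota>) \<otimes>\<^sub>2 etensor xs)) w =
      (if w \<in> fp_words G then coef (group_vac (G \<iota>) \<otimes>\<^sub>2 etensor xs) (fp_split G \<iota> w) else 0)"
    unfolding fp_V_def by (rule coef_pull[OF inj_on_fp_split])
  also have "\<dots> = coef (etensor xs) w"
    using * etensor_support[OF assms(1), of w]
    by (cases w) (auto simp: fp_split_def tensor.rep_eq group_vac_def coef_ket fp_words_def)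
  finally show "coef (fp_V G \<iota> (group_vac (G \<iota>) \<otimes>\<^sub>2 etensor xs)) w = coef (etensor xs) w" .
qed

lemma fp_V_Cons:
  assumes "fp_vectors G ((\<iota>, x) # xs)"
  shows "fp_V G \<iota> (x \<otimes>\<^sub>2 etensor xs) = etensor ((\<iota>, x) # xs)"
proof (rule coef_eqI)
  fix w
  have x: "coef x \<one>\<^bsub>G \<iota>\<^esub> = 0" using assms by (auto simp: fp_vectors_def ell2_on_def)
  have "coef (fp_V G \<iota> (x \<otimes>\<^sub>2 etensor xs)) w =
      (if w \<in> fp_words G then coef (x \<otimes>\<^sub>2 etensor xs) (fp_split G \<iota> w) else 0)"
    unfolding fp_V_def by (rule coef_pull[OF inj_on_fp_split])
  also have "\<dots> = coef (etensor ((\<iota>, x) # xs)) w"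
    using x etensor_support[OF assms, of w]
    by (cases w) (auto simp: fp_split_def tensor.rep_eq coef_etensor simp del: etensor.simps)
  finally show "coef (fp_V G \<iota> (x \<otimes>\<^sub>2 etensor xs)) w = coef (etensor ((\<iota>, x) # xs)) w" .
qed

lemma fp_unitary_etensor:
  assumes T: "\<And>\<iota>. bij_betw (T \<iota>) (carrier (G \<iota>)) (carrier (G \<iota>))" "\<And>\<iota>. T \<iota> \<one>\<^bsub>G \<iota>\<^esub> = \<one>\<^bsub>G \<iota>\<^esub>"
    and G: "\<And>\<iota>. group (G \<iota>)" and xs: "fp_vectors G xs"
  shows "fp_unitary G T (etensor xs) = etensor (map (\<lambda>(\<iota>, x). (\<iota>, group_unitary (G \<iota>) (T \<iota>) x)) xs)"
proof (rule coef_eqI)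
  fix w
  let ?f = "\<lambda>(\<iota>, g). (\<iota>, inv_into (carrier (G \<iota>)) (T \<iota>) g)"
  let ?ys = "map (\<lambda>(\<iota>, x). (\<iota>, group_unitary (G \<iota>) (T \<iota>) x)) xs"
  have bij: "bij_betw (inv_into (carrier (G \<iota>)) (T \<iota>)) (carrier (G \<iota>)) (carrier (G \<iota>))" for \<iota>
    by (rule bij_betw_inv_into[OF T(1)])
  have one: "\<one>\<^bsub>G \<iota>\<^esub> \<in> carrier (G \<iota>)" for \<iota>
    using group.is_monoid[OF G] by (rule monoid.one_closed)
  have inv1: "inv_into (carrier (G \<iota>)) (T \<iota>) \<one>\<^bsub>G \<iota>\<^esub> = \<one>\<^bsub>G \<iota>\<^esub>" for \<iota>
    using bij_betw_inv_into_left[OF T(1) one, of \<iota>] T(2) by simp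
  have cU: "coef (group_unitary (G \<iota>) (T \<iota>) x) g =
      (if g \<in> carrier (G \<iota>) then coef x (inv_into (carrier (G \<iota>)) (T \<iota>) g) else 0)" for \<iota> x g
    unfolding group_unitary_def by (rule coef_pull) (rule bij_betw_imp_inj_on[OF bij])
  have "inj_on ?f (SIGMA \<iota>:UNIV. carrier (G \<iota>))"
    using bij by (auto simp: inj_on_def bij_betw_def)
  then have "inj_on (map ?f) (fp_words G)"
    by (intro inj_on_subset[OF inj_on_map_lists]) (auto simp: fp_words_def)
  note c = coef_pull[OF this]
  have ys: "fp_vectors G ?ys"
    unfolding fp_vectors_def
  proof
    have "map fst ?ys = map fst xs" by auto
    then show "distinct_adj (map fst ?ys)" using xs unfolding fp_vectors_def by metis
    show "\<forall>(\<iota>, x)\<in>set ?ys. x \<in> ell2_on (carrier (G \<iota>) - {\<one>\<^bsub>G \<iota>\<^esub>})"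
      using xs one by (fastforce simp: fp_vectors_def ell2_on_def cU inv1)
  qed
  have main: "coef (etensor xs) (map ?f w) = coef (etensor ?ys) w"
    if "\<forall>(\<iota>, g)\<in>set w. g \<in> carrier (G \<iota>)" for w
    using that
  proof (induction xs arbitrary: w)
    case Nil
    then show ?case by (simp add: coef_etensor del: etensor.simps)
  next
    case (Cons p xs)
    then show ?case
      by (cases p; cases w) (auto simp: coef_etensor cU simp del: etensor.simps)
  qed
  have "coef (fp_unitary G T (etensor xs)) w = (if w \<in> fp_words G then coef (etensor xs) (map ?f w) else 0)"
    unfolding fp_unitary_def by (rule c)
  also have "\<dots> = coef (etensor ?ys) w"
    using main[of w] etensor_support[OF ys, of w] by (auto simp: fp_words_def)
  finally show "coef (fp_unitary G T (etensor xs)) w = coef (etensor ?ys) w" .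
qed

end

theory Submission
  imports Defs
begin

text \<open>
  The reduced free product is the reduced C*-algebra of the free group on \<open>S\<^sub>1 \<squnion> S\<^sub>2\<close>, spanned by the
  unitaries \<open>\<lambda>(w)\<close>, so a joining \<open>\<omega>\<close> is determined by the numbers \<open>\<omega>(\<lambda>(w))\<close> (states are bounded). If all letters of
  \<open>w\<close> lie in \<open>S\<^sub>2\<close>, then \<open>\<omega>(\<lambda>(w))\<close> is prescribed by the marginal. Otherwise \<open>w = p s q\<close> with \<open>s \<in> S\<^sub>1\<close>, and by
  ergodicity the letters \<open>T\<^sup>ns\<close> are distinct. With \<open>w\<^sub>n = T\<^sup>nw = p\<^sub>n s\<^sub>n q\<^sub>n\<close>, left multiplication by \<open>w\<^sub>n\<close> maps the
  words that do not begin with \<open>(s\<^sub>n q\<^sub>n)\<^sup>-\<^sup>1\<close> into those beginning with \<open>p\<^sub>n s\<^sub>n\<close>, and both families of sets are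
  disjoint; hence \<open>\<parallel>\<lambda>(w\<^sub>1) + \<dots> + \<lambda>(w\<^sub>N)\<parallel> \<le> 2 N\<^sup>1\<^sup>/\<^sup>2\<close>. By invariance \<open>N \<bar>\<omega>(\<lambda>(w))\<bar> \<le> const N\<^sup>1\<^sup>/\<^sup>2\<close> for all \<open>N\<close>,
  so \<open>\<omega>(\<lambda>(w)) = 0\<close>.
\<close>

section \<open>Square-summable functions and adjoints\<close>

lemma sum_coef_le_norm:
  assumes "finite F"
  shows "(\<Sum>x\<in>F. (cmod (coef f x))\<^sup>2) \<le> (norm f)\<^sup>2"
  unfolding norm_ell2_sq by (intro finite_sum_le_infsum coef_summable assms) auto

lemma cmod_coef_le_norm: "cmod (coef f x) \<le> norm f"
  by (rule power2_le_imp_le) (use sum_coef_le_norm[of "{x}" f] in auto)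

text \<open>Completeness of \<open>ell2\<close> makes the bounded operators a Banach space, on which
  the fixed point argument in \<open>selfadjoint_sqrt\<close> relies. The limit is built coordinate
  by coordinate.\<close>

instance ell2 :: (type) banach
proof
  fix X :: "nat \<Rightarrow> 'a ell2" assume C: "Cauchy X"
  have "Cauchy (\<lambda>n. coef (X n) x)" for x
  proof (rule metric_CauchyI)
    fix e :: real assume "e > 0"
    then obtain M where M: "\<forall>m\<ge>M. \<forall>n\<ge>M. dist (X m) (X n) < e"
      using C unfolding Cauchy_def by blast
    have "dist (coef (X m) x) (coef (X n) x) < e" if "m \<ge> M" "n \<ge> M" for m n
      using M that cmod_coef_le_norm[of "X m - X n" x]
      by (force simp: dist_norm scaleC_simps intro: le_less_trans)
    then show "\<exists>M. \<forall>m\<ge>M. \<forall>n\<ge>M. dist (coef (X m) x) (coef (X n) x) < e" by blast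
  qed
  then have "\<exists>l. (\<lambda>n. coef (X n) x) \<longlonglongrightarrow> l" for x
    by (meson Cauchy_convergent_iff convergent_def)
  then obtain g where g: "\<And>x. (\<lambda>n. coef (X n) x) \<longlonglongrightarrow> g x" by metis
  \<comment> \<open>Finite partial sums let the limit in \<open>m\<close> pass through the sum; the
    resulting bound is uniform in \<open>F\<close>.\<close>
  have part: "(\<Sum>x\<in>F. (cmod (coef (X n) x - g x))\<^sup>2) \<le> e\<^sup>2"
    if F: "finite F" and N: "\<And>m. m \<ge> N \<Longrightarrow> dist (X n) (X m) \<le> e" for F n e N
  proof (rule LIMSEQ_le_const2)
    show "(\<lambda>m. \<Sum>x\<in>F. (cmod (coef (X n) x - coef (X m) x))\<^sup>2)
        \<longlonglongrightarrow> (\<Sum>x\<in>F. (cmod (coef (X n) x - g x))\<^sup>2)"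
      by (intro tendsto_intros g)
    have "(\<Sum>x\<in>F. (cmod (coef (X n) x - coef (X m) x))\<^sup>2) \<le> e\<^sup>2" if "m \<ge> N" for m
    proof -
      have "(\<Sum>x\<in>F. (cmod (coef (X n) x - coef (X m) x))\<^sup>2) \<le> (norm (X n - X m))\<^sup>2"
        using sum_coef_le_norm[OF F, of "X n - X m"] by (simp add: scaleC_simps)
      also have "\<dots> \<le> e\<^sup>2" using N[OF that] by (intro power_mono) (auto simp: dist_norm)
      finally show ?thesis .
    qed
    then show "\<exists>N. \<forall>m\<ge>N. (\<Sum>x\<in>F. (cmod (coef (X n) x - coef (X m) x))\<^sup>2) \<le> e\<^sup>2" by blast
  qed
  have C': "\<exists>N. \<forall>n\<ge>N. \<forall>m\<ge>N. dist (X n) (X m) \<le> e" if "e > 0" for e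
    using C that unfolding Cauchy_def by (meson less_imp_le)
  obtain N1 where N1: "\<forall>n\<ge>N1. \<forall>m\<ge>N1. dist (X n) (X m) \<le> 1" using C'[of 1] by auto
  have "(\<lambda>x. (cmod (coef (X N1) x - g x))\<^sup>2) summable_on UNIV"
    by (rule nonneg_bounded_partial_sums_imp_summable_on[where C = "1\<^sup>2"])
       (auto simp: eventually_finite_subsets_at_top intro!: exI[of _ "{}"] part[where N = N1] N1[rule_format] simp del: power_one)
  \<comment> \<open>\<open>g\<close> is one member of the sequence minus a square-summable error,
    hence square-summable itself.\<close>
  then have "(\<lambda>x. (cmod (-1 * (coef (X N1) x - g x) + coef (X N1) x))\<^sup>2) summable_on UNIV"
    by (intro sqsum_add sqsum_mult coef_summable)
  then have sg: "(\<lambda>x. (cmod (g x))\<^sup>2) summable_on UNIV" by simp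
  define L where "L = Abs_ell2 g"
  have cL: "coef L x = g x" for x
    unfolding L_def using sg by (subst Abs_ell2_inverse) auto
  have "X \<longlonglongrightarrow> L"
  proof (rule metric_LIMSEQ_I)
    fix r :: real assume "r > 0"
    then obtain N where N: "\<forall>n\<ge>N. \<forall>m\<ge>N. dist (X n) (X m) \<le> r / 2" using C'[of "r / 2"] by auto
    have "dist (X n) L < r" if "n \<ge> N" for n
    proof -
      have "(norm (X n - L))\<^sup>2 \<le> (r / 2)\<^sup>2"
        unfolding norm_ell2_sq
        by (rule infsum_le_finite_sums[OF coef_summable])
           (use part[where N = N] N that in \<open>auto simp: scaleC_simps cL\<close>)
      then have "norm (X n - L) \<le> r / 2" using \<open>r > 0\<close> by (auto intro: power2_le_imp_le)
      then show ?thesis using \<open>r > 0\<close> by (simp add: dist_norm)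
    qed
    then show "\<exists>N. \<forall>n\<ge>N. dist (X n) L < r" by blast
  qed
  then show "convergent X" by (auto simp: convergent_def)
qed

lemma cinner_add_left: "cinner (f + g) h = cinner f h + cinner g h"
  by (subst (1 2 3) cinner_commute) (simp add: cinner_add_right)

lemma cinner_scale_left: "cinner (scaleC c f) g = cnj c * cinner f g"
  by (subst (1 2) cinner_commute) (simp add: cinner_scale_right)

lemma cinner_ket_left: "cinner (ket x) f = coef f x"
  by (subst cinner_commute) (simp add: cinner_ket_right)

text \<open>Multiplying \<open>g\<close> by a suitable phase turns the complex inner product into
  its modulus, after which the real Cauchy-Schwarz inequality applies.\<close>

lemma cmod_cinner_le: "cmod (cinner f g) \<le> norm f * norm g"
proof -
  \<comment> \<open>The value 1 for a vanishing inner product keeps \<open>c\<close> of modulus one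
    in every case.\<close>
  define c where "c = (if cinner f g = 0 then 1 else cnj (cinner f g) / cmod (cinner f g))"
  have *: "cnj (cinner f g) * cinner f g = of_real (cmod (cinner f g)) * of_real (cmod (cinner f g))"
    by (metis complex_norm_square power2_eq_square of_real_power mult.commute)
  have c: "cmod c = 1" "c * cinner f g = cmod (cinner f g)"
    using * by (auto simp: c_def norm_divide)
  have n: "norm (scaleC c g) = norm g"
  proof (rule power2_eq_imp_eq)
    show "(norm (scaleC c g))\<^sup>2 = (norm g)\<^sup>2"
      by (simp add: norm_ell2_sq scaleC_simps norm_mult c)
  qed auto
  have "cmod (cinner f g) = inner f (scaleC c g)"
    by (simp add: inner_eq_Re_cinner cinner_scale_right c)
  also have "\<dots> \<le> norm f * norm g" using norm_cauchy_schwarz[of f "scaleC c g"] by (simp add: n)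
  finally show ?thesis .
qed

lemma cinner_self: "cinner f f = of_real ((norm f)\<^sup>2)"
proof -
  have "Im (cinner f f) = 0" using arg_cong[OF cinner_commute[of f f], of Im] by simp
  then show ?thesis
    by (simp add: complex_eq_iff power2_norm_eq_inner inner_eq_Re_cinner)
qed

section \<open>Complex-linear operators and their adjoints\<close>

text \<open>Operators of type \<open>\<Rightarrow>\<^sub>L\<close> are merely real linear. Complex
  linearity is carried as a separate predicate, because \<open>adj\<close> has its defining property
  only under it.\<close>

definition clinear :: "('x ell2 \<Rightarrow>\<^sub>L 'y ell2) \<Rightarrow> bool"
  where "clinear a \<longleftrightarrow> (\<forall>c f. a (scaleC c f) = scaleC c (a f))"

lemma clinear_scaleC: "clinear a \<Longrightarrow> blinfun_apply a (scaleC c f) = scaleC c (a f)"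
  by (simp add: clinear_def)

lemma scaleC_algebra:
  "scaleC c (f + g) = scaleC c f + scaleC c g" "scaleC c (scaleC d f) = scaleC (c * d) f"
  "scaleC c (f - g) = scaleC c f - scaleC c g" "scaleC c 0 = 0" "scaleC 1 f = f" "scaleC 0 f = 0"
  by (rule coef_eqI, simp add: scaleC_simps algebra_simps)+

lemma scaleR_conv_cscale: "r *\<^sub>R a = cscale (of_real r) o\<^sub>L a"
  by (rule blinfun_eqI, rule coef_eqI) (simp add: scaleC_simps blinfun.scaleR_left)

text \<open>Each vector is the norm-convergent sum of its coordinates times basis vectors, and
  bounded operators commute with such sums. Operator identities below are therefore checked on basis
  vectors.\<close>

lemma clinear_eqI:
  assumes "clinear a" "clinear b" "\<And>x. blinfun_apply a (ket x) = b (ket x)"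
  shows "a = b"
proof (rule blinfun_eqI)
  fix f
  have *: "((\<lambda>x. scaleC (coef f x) (c (ket x))) has_sum c f) UNIV" if "clinear c" for c :: "'a ell2 \<Rightarrow>\<^sub>L 'b ell2"
    using has_sum_bounded_linear[OF blinfun.bounded_linear_right ket_has_sum[of f], of c]
    by (simp add: o_def clinear_scaleC[OF that])
  show "blinfun_apply a f = b f"
    using *[OF assms(1)] *[OF assms(2)] assms(3) by (auto intro: has_sum_unique)
qed

lemma cinner_adj: "clinear a \<Longrightarrow> cinner (adj a f) g = cinner f (a g)"
  by (rule cinner_adj_left) (simp add: clinear_def)

lemma coef_adj: "clinear a \<Longrightarrow> coef (adj a f) x = cinner (a (ket x)) f"
  using cinner_adj[of a f "ket x"] cinner_commute[of "blinfun_apply a (ket x)" f]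
  by (metis cinner_ket_left cinner_commute)

lemma clinear_adj: "clinear a \<Longrightarrow> clinear (adj a)"
  unfolding clinear_def[of "adj a"]
  by (intro allI coef_eqI) (simp add: coef_adj scaleC_simps cinner_scale_right)

lemma clinear_ops:
  "clinear 0" "clinear (cscale c)"
  "clinear a \<Longrightarrow> clinear b \<Longrightarrow> clinear (a + b)" "clinear a \<Longrightarrow> clinear b \<Longrightarrow> clinear (a - b)"
  "clinear u \<Longrightarrow> clinear v \<Longrightarrow> clinear (u o\<^sub>L v)"
  by (auto simp: clinear_def blinfun.add_left blinfun.diff_left scaleC_algebra scaleC_simps mult.commute)

lemma adj_adj: "clinear a \<Longrightarrow> adj (adj a) = a"
  by (rule adj_unique) (metis cinner_adj cinner_commute)

lemma adj_compose: "clinear a \<Longrightarrow> clinear b \<Longrightarrow> adj (a o\<^sub>L b) = adj b o\<^sub>L adj a"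
  by (rule adj_unique) (simp add: cinner_adj)

lemma adj_add: "clinear a \<Longrightarrow> clinear b \<Longrightarrow> adj (a + b) = adj a + adj b"
  by (rule adj_unique) (simp add: cinner_adj cinner_add_left cinner_add_right blinfun.add_left)

lemma adj_diff: "clinear a \<Longrightarrow> clinear b \<Longrightarrow> adj (a - b) = adj a - adj b"
proof -
  assume *: "clinear a" "clinear b"
  have "adj a = adj ((a - b) + b)" by simp
  also have "\<dots> = adj (a - b) + adj b" using * by (intro adj_add clinear_ops)
  finally show ?thesis by simp
qed

lemma adj_cscale: "adj (cscale c) = cscale (cnj c)"
  by (rule adj_unique) (simp add: scaleC_simps cinner_scale_left cinner_scale_right)

lemma cscale_commute: "clinear a \<Longrightarrow> a o\<^sub>L cscale c = cscale c o\<^sub>L a"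
  by (rule blinfun_eqI) (simp add: scaleC_simps clinear_scaleC)

lemma adj_cscale_compose: "clinear a \<Longrightarrow> adj (cscale c o\<^sub>L a) = cscale (cnj c) o\<^sub>L adj a"
  by (simp add: adj_compose clinear_ops adj_cscale cscale_commute clinear_adj)

lemma adj_0: "adj 0 = 0"
  by (rule adj_unique) (simp add: cinner_def scaleC_simps)

text \<open>The square of \<open>norm (adj a f)\<close> is the inner product of \<open>f\<close>
  with \<open>a (adj a f)\<close>; after Cauchy-Schwarz one factor \<open>norm (adj a f)\<close>
  cancels.\<close>

lemma norm_adj_le:
  assumes "clinear a" shows "norm (adj a) \<le> norm a"
proof (rule norm_blinfun_bound)
  fix f
  have "of_real ((norm (adj a f))\<^sup>2) = cinner f (a (adj a f))"
    using cinner_adj[OF assms, of f "adj a f"] by (simp add: cinner_self)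
  then have "(norm (adj a f))\<^sup>2 = cmod (cinner f (a (adj a f)))"
    by (metis norm_of_real abs_of_nonneg zero_le_power2)
  also have "\<dots> \<le> norm f * norm (a (adj a f))" by (rule cmod_cinner_le)
  also have "\<dots> \<le> norm f * (norm a * norm (adj a f))" by (intro mult_left_mono norm_blinfun) auto
  finally have "norm (adj a f) * norm (adj a f) \<le> norm (adj a f) * (norm a * norm f)"
    by (simp add: power2_eq_square mult_ac)
  then show "norm (adj a f) \<le> norm a * norm f"
    by (cases "norm (adj a f) = 0") (auto simp: mult_le_cancel_left)
qed simp

text \<open>Additivity of \<open>adj\<close> is available for complex-linear operators and not on
  the whole type, so continuity is read off from the norm bound on differences.\<close>

lemma tendsto_adj:
  assumes "\<And>n. clinear (a n)" "clinear b" "a \<longlonglongrightarrow> b"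
  shows "(\<lambda>n. adj (a n)) \<longlonglongrightarrow> adj b"
proof (rule LIM_zero_cancel, rule Lim_null_comparison)
  show "(\<lambda>n. norm (a n - b)) \<longlonglongrightarrow> 0"
    using assms(3) by (simp add: LIM_zero tendsto_norm_zero)
  show "\<forall>\<^sub>F n in sequentially. norm (adj (a n) - adj b) \<le> norm (a n - b)"
    using norm_adj_le[OF clinear_ops(4)[OF assms(1,2)]] assms
    by (simp add: adj_diff[symmetric])
qed

section \<open>Operators that live on a subset of the basis\<close>

lemma ell2_onI: "(\<And>x. x \<notin> X \<Longrightarrow> coef f x = 0) \<Longrightarrow> f \<in> ell2_on X"
  by (simp add: ell2_on_def)

text \<open>Expanding a vector of the orthogonal complement into basis vectors reduces vanishing on
  the complement to vanishing on its basis.\<close>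

lemma bounded_opsI:
  assumes "clinear a" "\<And>f. a f \<in> ell2_on X" "\<And>x. x \<notin> X \<Longrightarrow> a (ket x) = 0"
  shows "a \<in> bounded_ops X"
proof -
  have "a f = 0" if f: "f \<in> ell2_on (- X)" for f
  proof -
    have "((\<lambda>x. a (scaleC (coef f x) (ket x))) has_sum a f) UNIV"
      using has_sum_bounded_linear[OF blinfun.bounded_linear_right ket_has_sum[of f], of a]
      by (simp add: o_def)
    moreover have "a (scaleC (coef f x) (ket x)) = 0" for x
      using f assms(3)[of x] by (cases "x \<in> X") (auto simp: ell2_on_def clinear_scaleC[OF assms(1)] scaleC_algebra)
    ultimately have "((\<lambda>_::'a. 0) has_sum a f) UNIV" by simp
    then show ?thesis using has_sum_unique[OF _ has_sum_0] by blast
  qed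
  then show ?thesis using assms by (simp add: bounded_ops_def clinear_def)
qed

lemma bounded_opsD:
  assumes "a \<in> bounded_ops X"
  shows "clinear a" "x \<notin> X \<Longrightarrow> coef (a f) x = 0" "f \<in> ell2_on (- X) \<Longrightarrow> a f = 0"
    "x \<notin> X \<Longrightarrow> a (ket x) = 0" "a f \<in> ell2_on X"
  using assms by (auto simp: bounded_ops_def clinear_def ell2_on_def coef_ket)

lemma bounded_ops_eqI:
  assumes "a \<in> bounded_ops X" "b \<in> bounded_ops X" "\<And>x. x \<in> X \<Longrightarrow> a (ket x) = b (ket x)"
  shows "a = b"
  using assms by (intro clinear_eqI) (metis bounded_opsD(1,4))+

text \<open>This ambient algebra bounds every \<open>cstar_generated\<close> from above.\<close>

lemma cstar_subalgebra_bounded_ops: "cstar_subalgebra X (bounded_ops X)"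
  unfolding cstar_subalgebra_def
proof (intro conjI ballI allI subset_refl)
  show "0 \<in> bounded_ops X" by (rule bounded_opsI) (auto simp: clinear_ops ell2_on_def scaleC_simps)
  fix a b c assume a: "a \<in> bounded_ops X" and b: "b \<in> bounded_ops X"
  note D = bounded_opsD(1,2,4)[OF a] bounded_opsD(1,2,4)[OF b]
  show "a + b \<in> bounded_ops X" by (rule bounded_opsI)
      (simp_all add: clinear_ops ell2_on_def scaleC_simps blinfun.add_left D)
  show "a o\<^sub>L b \<in> bounded_ops X" by (rule bounded_opsI)
      (simp_all add: clinear_ops ell2_on_def scaleC_simps D blinfun.zero_right)
next
  fix a c assume a: "a \<in> bounded_ops X"
  note D = bounded_opsD(1,2,4)[OF a]
  show "cscale c o\<^sub>L a \<in> bounded_ops X" by (rule bounded_opsI)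
      (simp_all add: clinear_ops ell2_on_def scaleC_simps scaleC_algebra D)
  show "adj a \<in> bounded_ops X"
  proof (rule bounded_opsI)
    show "adj a f \<in> ell2_on X" for f
      by (rule ell2_onI) (simp add: coef_adj D cinner_def scaleC_simps)
    show "adj a (ket x) = 0" if "x \<notin> X" for x
      by (intro coef_eqI) (simp add: coef_adj D cinner_ket_right scaleC_simps that)
  qed (simp add: clinear_adj D)
next
  show "closed (bounded_ops X)"
    unfolding closed_sequential_limits
  proof (intro allI impI)
    fix a l assume "(\<forall>n. a n \<in> bounded_ops X) \<and> a \<longlonglongrightarrow> l"
    then have a: "a n \<in> bounded_ops X" and l: "a \<longlonglongrightarrow> l" for n by auto
    \<comment> \<open>Norm convergence of operators implies convergence at each vector, so the
      conditions in \<open>bounded_opsI\<close> survive the limit.\<close>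
    have lf: "(\<lambda>n. a n f) \<longlonglongrightarrow> l f" for f
      by (rule bounded_linear.tendsto[OF blinfun.bounded_linear_left l])
    have lc: "(\<lambda>n. coef (a n f) x) \<longlonglongrightarrow> coef (l f) x" for f x
      using bounded_linear.tendsto[OF bounded_linear_cinner_right lf, of "ket x"]
      by (simp add: cinner_ket_left)
    show "l \<in> bounded_ops X"
    proof (rule bounded_opsI)
      show "clinear l" unfolding clinear_def
      proof (intro allI, rule LIMSEQ_unique[OF lf])
        fix c f
        have "(\<lambda>n. cscale c (a n f)) \<longlonglongrightarrow> cscale c (l f)"
          by (rule bounded_linear.tendsto[OF blinfun.bounded_linear_right lf])
        then show "(\<lambda>n. a n (scaleC c f)) \<longlonglongrightarrow> scaleC c (l f)"
          by (simp add: scaleC_simps clinear_scaleC[OF bounded_opsD(1)[OF a]])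
      qed
      show "l f \<in> ell2_on X" for f
      proof (rule ell2_onI, rule LIMSEQ_unique[OF lc])
        show "(\<lambda>n. coef (a n f) x) \<longlonglongrightarrow> 0" if "x \<notin> X" for x
          by (intro tendsto_eventually always_eventually allI) (use bounded_opsD(2)[OF a] that in blast)
      qed
      show "l (ket x) = 0" if "x \<notin> X" for x
        by (rule LIMSEQ_unique[OF lf]) (simp add: bounded_opsD(4)[OF a that])
    qed
  qed
qed

section \<open>Generated C*-algebras as closed linear spans\<close>

lemma cstar_subalgebraD:
  assumes "cstar_subalgebra X A"
  shows "a \<in> A \<Longrightarrow> a \<in> bounded_ops X" "0 \<in> A" "a \<in> A \<Longrightarrow> b \<in> A \<Longrightarrow> a + b \<in> A"
    "a \<in> A \<Longrightarrow> b \<in> A \<Longrightarrow> a o\<^sub>L b \<in> A" "a \<in> A \<Longrightarrow> cscale c o\<^sub>L a \<in> A" "a \<in> A \<Longrightarrow> adj a \<in> A" "closed A"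
  using assms by (auto simp: cstar_subalgebra_def)

lemma cstar_subalgebra_scaleR:
  assumes "cstar_subalgebra X A" shows "a \<in> A \<Longrightarrow> r *\<^sub>R a \<in> A"
  using cstar_subalgebraD[OF assms] by (simp add: scaleR_conv_cscale)

lemma cstar_subalgebra_diff:
  assumes "cstar_subalgebra X A" shows "a \<in> A \<Longrightarrow> b \<in> A \<Longrightarrow> a - b \<in> A"
  using cstar_subalgebraD(3)[OF assms, of a "(-1) *\<^sub>R b"] cstar_subalgebra_scaleR[OF assms, of b "-1"]
  by simp

lemma cstar_generated_minimal: "cstar_subalgebra X A \<Longrightarrow> M \<subseteq> A \<Longrightarrow> cstar_generated X M \<subseteq> A"
  by (auto simp: cstar_generated_def)

lemma cstar_generated_superset: "M \<subseteq> cstar_generated X M"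
  by (auto simp: cstar_generated_def)

lemma cstar_subalgebra_cstar_generated:
  assumes "M \<subseteq> bounded_ops X"
  shows "cstar_subalgebra X (cstar_generated X M)"
proof -
  have "cstar_generated X M \<subseteq> bounded_ops X"
    by (rule cstar_generated_minimal[OF cstar_subalgebra_bounded_ops assms])
  then show ?thesis
    unfolding cstar_subalgebra_def cstar_generated_def
    by (intro conjI closed_Inter) blast+
qed

inductive_set cspan :: "'x op set \<Rightarrow> 'x op set" for M where
  zero: "0 \<in> cspan M"
| base: "a \<in> M \<Longrightarrow> a \<in> cspan M"
| add: "a \<in> cspan M \<Longrightarrow> b \<in> cspan M \<Longrightarrow> a + b \<in> cspan M"
| scale: "a \<in> cspan M \<Longrightarrow> cscale c o\<^sub>L a \<in> cspan M"

lemma cspan_subset_cstar_subalgebra: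
  assumes "cstar_subalgebra X A" "M \<subseteq> A" shows "cspan M \<subseteq> A"
proof
  fix a assume "a \<in> cspan M"
  then show "a \<in> A" by induction (use assms cstar_subalgebraD[OF assms(1)] in auto)
qed

lemma blinfun_compose_algebra:
  "(a + b) o\<^sub>L c = (a o\<^sub>L c) + (b o\<^sub>L c)" "d o\<^sub>L (e + f) = (d o\<^sub>L e) + (d o\<^sub>L f)"
  "(a - b) o\<^sub>L c = (a o\<^sub>L c) - (b o\<^sub>L c)" "d o\<^sub>L (e - f) = (d o\<^sub>L e) - (d o\<^sub>L f)"
  "(u o\<^sub>L v) o\<^sub>L w = u o\<^sub>L (v o\<^sub>L w)"
  "0 o\<^sub>L c = 0" "d o\<^sub>L 0 = 0"
  by (rule blinfun_eqI, simp add: blinfun.add_left blinfun.add_right blinfun.diff_left blinfun.diff_right)+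

text \<open>If the generators are stable under products and adjoints, bilinearity makes their linear
  span an algebra closed under adjoints, and continuity of the operations extends this to the
  closure. Products are handled one factor at a time.\<close>

lemma cstar_subalgebra_closure_cspan:
  assumes M: "M \<subseteq> bounded_ops X" and mult: "\<And>a b. a \<in> M \<Longrightarrow> b \<in> M \<Longrightarrow> a o\<^sub>L b \<in> M"
    and adj: "\<And>a. a \<in> M \<Longrightarrow> adj a \<in> M"
  shows "cstar_subalgebra X (closure (cspan M))"
proof -
  note B = cstar_subalgebra_bounded_ops[of X]
  have sub: "cspan M \<subseteq> bounded_ops X" by (rule cspan_subset_cstar_subalgebra[OF B M])
  have cl: "closure (cspan M) \<subseteq> bounded_ops X"
    by (rule closure_minimal[OF sub cstar_subalgebraD(7)[OF B]])
  have mult1: "a o\<^sub>L b \<in> cspan M" if "a \<in> cspan M" "b \<in> M" for a b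
    using that by induction
      (auto simp: blinfun_compose_algebra blinfun_compose_algebra(5) intro: cspan.intros mult)
  have mult2: "a o\<^sub>L b \<in> cspan M" if "b \<in> cspan M" "a \<in> cspan M" for a b
    using that
  proof induction
    case (scale b c)
    then have "a o\<^sub>L (cscale c o\<^sub>L b) = cscale c o\<^sub>L (a o\<^sub>L b)"
      using sub by (metis blinfun_compose_algebra(5) bounded_opsD(1) cscale_commute subsetD)
    then show ?case using scale by (auto intro: cspan.intros)
  qed (auto simp: blinfun_compose_algebra intro: cspan.intros mult1)
  have adjP: "adj a \<in> cspan M" if "a \<in> cspan M" for a
    using that
  proof induction
    case (add a b)
    then show ?case using sub by (metis adj_add bounded_opsD(1) cspan.add subsetD)
  next
    case (scale a c)
    then show ?case using sub by (metis adj_cscale_compose bounded_opsD(1) cspan.scale subsetD)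
  qed (auto simp: adj_0 intro: cspan.intros adj)
  show ?thesis
    unfolding cstar_subalgebra_def
  proof (intro conjI ballI allI closed_closure cl)
    show "0 \<in> closure (cspan M)" using closure_subset cspan.zero by blast
    fix a b assume "a \<in> closure (cspan M)" "b \<in> closure (cspan M)"
    then obtain u v where u: "\<And>n::nat. u n \<in> cspan M" "u \<longlonglongrightarrow> a" and v: "\<And>n::nat. v n \<in> cspan M" "v \<longlonglongrightarrow> b"
      by (auto simp: closure_sequential)
    show "a + b \<in> closure (cspan M)"
      unfolding closure_sequential using u v
      by (intro exI[of _ "\<lambda>n. u n + v n"]) (auto intro: cspan.add tendsto_add)
    show "a o\<^sub>L b \<in> closure (cspan M)"
      unfolding closure_sequential using u v
      by (intro exI[of _ "\<lambda>n. u n o\<^sub>L v n"])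
        (auto intro: mult2 bounded_bilinear.tendsto[OF bounded_bilinear_blinfun_compose])
  next
    fix a c assume a: "a \<in> closure (cspan M)"
    then obtain u where u: "\<And>n::nat. u n \<in> cspan M" "u \<longlonglongrightarrow> a"
      by (auto simp: closure_sequential)
    show "cscale c o\<^sub>L a \<in> closure (cspan M)"
      unfolding closure_sequential using u
      by (intro exI[of _ "\<lambda>n. cscale c o\<^sub>L u n"])
        (auto intro: cspan.scale bounded_bilinear.tendsto[OF bounded_bilinear_blinfun_compose])
    show "adj a \<in> closure (cspan M)"
      unfolding closure_sequential using u a sub cl
      by (intro exI[of _ "\<lambda>n. adj (u n)"])
        (auto intro!: adjP tendsto_adj intro: bounded_opsD(1))
  qed
qed

lemma cstar_generated_eq_closure_cspan:
  assumes "M \<subseteq> bounded_ops X" "\<And>a b. a \<in> M \<Longrightarrow> b \<in> M \<Longrightarrow> a o\<^sub>L b \<in> M" "\<And>a. a \<in> M \<Longrightarrow> adj a \<in> M"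
  shows "cstar_generated X M = closure (cspan M)"
proof
  show "cstar_generated X M \<subseteq> closure (cspan M)"
    by (rule cstar_generated_minimal[OF cstar_subalgebra_closure_cspan[OF assms]])
       (use closure_subset cspan.base in blast)+
  show "closure (cspan M) \<subseteq> cstar_generated X M"
    using cstar_subalgebra_cstar_generated[OF assms(1)]
    by (intro closure_minimal cspan_subset_cstar_subalgebra[of X] cstar_generated_superset)
       (auto simp: cstar_subalgebra_def)
qed

text \<open>Meant for conjugation by a unitary that permutes the generators; applied to the
  automorphism and to its inverse.\<close>

lemma conj_in_closure_cspan:
  assumes "clinear u" "\<And>a. a \<in> M \<Longrightarrow> u o\<^sub>L a o\<^sub>L v \<in> M" "a \<in> closure (cspan M)"
  shows "u o\<^sub>L a o\<^sub>L v \<in> closure (cspan M)"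
proof -
  obtain x where x: "\<And>n::nat. x n \<in> cspan M" "x \<longlonglongrightarrow> a"
    using assms(3) by (auto simp: closure_sequential)
  have "u o\<^sub>L b o\<^sub>L v \<in> cspan M" if "b \<in> cspan M" for b
    using that
  proof induction
    case (scale b c)
    have "u o\<^sub>L (cscale c o\<^sub>L b) o\<^sub>L v = cscale c o\<^sub>L (u o\<^sub>L b o\<^sub>L v)"
      by (rule blinfun_eqI) (simp add: scaleC_simps clinear_scaleC[OF assms(1)])
    then show ?case using scale by (simp add: cspan.scale)
  qed (auto simp: blinfun_compose_algebra(1,2,6,7) intro: cspan.intros assms(2))
  moreover have "(\<lambda>n. u o\<^sub>L x n o\<^sub>L v) \<longlonglongrightarrow> (u o\<^sub>L a o\<^sub>L v)"
    by (intro bounded_bilinear.tendsto[OF bounded_bilinear_blinfun_compose] tendsto_const x)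
  ultimately show ?thesis using x(1) unfolding closure_sequential by fast
qed

section \<open>Pullback operators\<close>

lemma clinear_pull: "inj_on \<pi> X \<Longrightarrow> clinear (pull X \<pi>)"
  unfolding clinear_def by (intro allI coef_eqI) (simp add: coef_pull scaleC_simps)

lemma pull_in_ell2_on: "inj_on \<pi> X \<Longrightarrow> pull X \<pi> f \<in> ell2_on X"
  by (rule ell2_onI) (simp add: coef_pull)

lemma pull_in_bounded_ops:
  assumes "inj_on \<pi> X" "\<pi> ` X \<subseteq> X" shows "pull X \<pi> \<in> bounded_ops X"
  by (rule bounded_opsI)
     (use assms in \<open>auto intro!: coef_eqI simp: clinear_pull pull_in_ell2_on coef_pull coef_ket scaleC_simps image_subset_iff\<close>)

lemma pull_ket: "inj_on \<pi> X \<Longrightarrow> x \<in> X \<Longrightarrow> pull X \<pi> (ket (\<pi> x)) = ket x"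
  by (rule coef_eqI) (auto simp: coef_pull coef_ket inj_on_def)

text \<open>\<open>pull\<close> composes functions with \<pi>, so its adjoint pushes basis vectors
  forward along \<pi>.\<close>

lemma adj_pull_ket: "inj_on \<pi> X \<Longrightarrow> adj (pull X \<pi>) (ket x) = (if x \<in> X then ket (\<pi> x) else 0)"
  by (rule coef_eqI)
     (auto simp: coef_adj clinear_pull cinner_ket_right coef_pull coef_ket scaleC_simps)

lemma norm_pull_apply_le:
  assumes "inj_on \<pi> X" shows "norm (pull X \<pi> f) \<le> norm f"
proof (rule power2_le_imp_le)
  have "(norm (pull X \<pi> f))\<^sup>2 = (\<Sum>\<^sub>\<infinity>x\<in>X. (cmod (coef f (\<pi> x)))\<^sup>2)"
    unfolding norm_ell2_sq coef_pull[OF assms] by (rule infsum_cong_neutral) auto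
  also have "\<dots> = (\<Sum>\<^sub>\<infinity>y\<in>\<pi> ` X. (cmod (coef f y))\<^sup>2)"
    by (subst infsum_reindex[OF assms]) (simp add: o_def)
  also have "\<dots> \<le> (norm f)\<^sup>2"
    unfolding norm_ell2_sq by (rule infsum_mono2) (auto intro: coef_summable)
  finally show "(norm (pull X \<pi> f))\<^sup>2 \<le> (norm f)\<^sup>2" .
qed simp

lemma norm_pull_le: "inj_on \<pi> X \<Longrightarrow> norm (pull X \<pi>) \<le> 1"
  by (rule norm_blinfun_bound) (auto simp: norm_pull_apply_le)

lemma coef_unit_op: "coef (unit_op X f) x = (if x \<in> X then coef f x else 0)"
  by (simp add: unit_op_def coef_pull)

lemma unit_op_in_bounded_ops: "unit_op X \<in> bounded_ops X"
  unfolding unit_op_def by (rule pull_in_bounded_ops) auto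

lemma unit_op_ket: "unit_op X (ket x) = (if x \<in> X then ket x else 0)"
  by (rule coef_eqI) (simp add: coef_unit_op coef_ket scaleC_simps)

lemma adj_unit_op: "adj (unit_op X) = unit_op X"
  by (rule clinear_eqI)
     (auto simp: clinear_adj bounded_opsD(1)[OF unit_op_in_bounded_ops] unit_op_ket,
      auto simp: unit_op_def adj_pull_ket)

lemma unit_op_compose:
  assumes "a \<in> bounded_ops X" shows "unit_op X o\<^sub>L a = a" "a o\<^sub>L unit_op X = a"
proof -
  show "unit_op X o\<^sub>L a = a"
    by (rule blinfun_eqI, rule coef_eqI) (simp add: coef_unit_op bounded_opsD(2)[OF assms])
  show "a o\<^sub>L unit_op X = a"
    by (rule bounded_ops_eqI[of _ X])
       (use assms unit_op_in_bounded_ops[of X] cstar_subalgebraD(4)[OF cstar_subalgebra_bounded_ops]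
         in \<open>auto simp: unit_op_ket\<close>)
qed

lemma norm_unit_op_apply_le: "norm (unit_op X f) \<le> norm f"
  unfolding unit_op_def by (rule norm_pull_apply_le) auto

section \<open>Automatic continuity of states\<close>

section \<open>Boundedness of states\<close>

text \<open>The element \<open>y = 1 - sqrt (1 - b)\<close> is a fixed point of the contraction \<open>y \<mapsto> (b + y\<^sup>2) / 2\<close>.\<close>

lemma selfadjoint_sqrt:
  assumes A: "cstar_subalgebra X A" and b: "b \<in> A" "adj b = b" "norm b \<le> 1 / 2"
  obtains y where "y \<in> A" "adj y = y" "y + y = b + (y o\<^sub>L y)"
proof -
  \<comment> \<open>On the ball of radius 3/4 the values of \<open>F\<close> have norm at most (1/2
    + 9/16)/2 = 17/32, and \<open>F\<close> has Lipschitz constant 3/4. Selfadjointness is a closed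
    condition and is put into \<open>K\<close>, so that the fixed point inherits it.\<close>
  define K where "K = {y\<in>A. adj y = y \<and> norm y \<le> 3 / 4}"
  define F where "F y = (1 / 2) *\<^sub>R (b + (y o\<^sub>L y))" for y
  note A' = cstar_subalgebraD[OF A]
  have lin: "y \<in> A \<Longrightarrow> clinear y" for y using A'(1) bounded_opsD(1) by blast
  have adjR: "y \<in> A \<Longrightarrow> adj (r *\<^sub>R y) = r *\<^sub>R adj y" for y and r :: real
    by (simp add: scaleR_conv_cscale adj_cscale_compose lin)
  have "closed K" unfolding closed_sequential_limits
  proof (intro allI impI)
    fix u l assume "(\<forall>n. u n \<in> K) \<and> u \<longlonglongrightarrow> l"
    then have u: "\<And>n. u n \<in> A" "\<And>n. adj (u n) = u n" "\<And>n. norm (u n) \<le> 3 / 4" and l: "u \<longlonglongrightarrow> l"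
      by (auto simp: K_def)
    have lA: "l \<in> A" using A'(7) u(1) l by (auto simp: closed_sequential_limits)
    moreover have "adj l = l"
      using tendsto_adj[of u, OF lin[OF u(1)] lin[OF lA] l] l by (simp add: u LIMSEQ_unique)
    moreover have "norm l \<le> 3 / 4"
      by (rule LIMSEQ_le_const2[OF tendsto_norm[OF l]]) (use u in auto)
    ultimately show "l \<in> K" by (simp add: K_def)
  qed
  then have "complete K" by (simp add: complete_eq_closed)
  moreover have "0 \<in> K" using A' by (simp add: K_def adj_0)
  moreover have "F ` K \<subseteq> K"
  proof clarify
    fix y assume "y \<in> K"
    then have y: "y \<in> A" "adj y = y" "norm y \<le> 3 / 4" by (auto simp: K_def)
    have "norm (y o\<^sub>L y) \<le> norm y * norm y" by (rule norm_blinfun_compose)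
    also have "\<dots> \<le> 3 / 4 * (3 / 4)" using y by (intro mult_mono) auto
    finally have "norm (b + (y o\<^sub>L y)) \<le> 1 / 2 + 9 / 16" using b by (intro norm_triangle_le) auto
    then show "F y \<in> K"
      using A' b y cstar_subalgebra_scaleR[OF A]
      by (auto simp: K_def F_def adjR adj_add adj_compose lin)
  qed
  moreover have "dist (F y) (F z) \<le> 3 / 4 * dist y z" if "y \<in> K \<and> z \<in> K" for y z
  proof -
    \<comment> \<open>Difference of squares without commutativity: y^2 - z^2 = y(y - z) + (y -
      z)z.\<close>
    have "F y - F z = (1 / 2) *\<^sub>R ((y o\<^sub>L (y - z)) + ((y - z) o\<^sub>L z))"
      by (simp add: F_def blinfun_compose_algebra algebra_simps)
    then have "dist (F y) (F z) = (1 / 2) * norm ((y o\<^sub>L (y - z)) + ((y - z) o\<^sub>L z))"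
      by (simp add: dist_norm)
    also have "\<dots> \<le> (1 / 2) * (norm y * norm (y - z) + norm (y - z) * norm z)"
      by (intro mult_left_mono norm_triangle_le add_mono norm_blinfun_compose) auto
    also have "\<dots> \<le> (1 / 2) * (3 / 4 * norm (y - z) + norm (y - z) * (3 / 4))"
      using that by (intro mult_left_mono add_mono mult_right_mono) (auto simp: K_def)
    finally show ?thesis by (simp add: dist_norm)
  qed
  ultimately have "\<exists>!y\<in>K. F y = y" by (intro Banach_fix[of K "3 / 4"]) auto
  then obtain y where y: "y \<in> K" "F y = y" by blast
  have "y + y = 2 *\<^sub>R F y" using y(2) by (simp add: scaleR_2)
  then have "y + y = b + (y o\<^sub>L y)" by (simp add: F_def)
  then show ?thesis using that y by (auto simp: K_def)
qed

lemma is_state_linear: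
  assumes A: "cstar_subalgebra X A" and \<omega>: "is_state X A \<omega>"
  shows "a \<in> A \<Longrightarrow> b \<in> A \<Longrightarrow> \<omega> (a + b) = \<omega> a + \<omega> b" "a \<in> A \<Longrightarrow> \<omega> (cscale c o\<^sub>L a) = c * \<omega> a"
    "a \<in> A \<Longrightarrow> \<omega> (r *\<^sub>R a) = of_real r * \<omega> a" "\<omega> 0 = 0"
    "a \<in> A \<Longrightarrow> b \<in> A \<Longrightarrow> \<omega> (a - b) = \<omega> a - \<omega> b"
    "(\<And>i. i \<in> I \<Longrightarrow> f i \<in> A) \<Longrightarrow> \<omega> (\<Sum>i\<in>I. f i) = (\<Sum>i\<in>I. \<omega> (f i)) \<and> (\<Sum>i\<in>I. f i) \<in> A"
proof -
  show 1: "a \<in> A \<Longrightarrow> b \<in> A \<Longrightarrow> \<omega> (a + b) = \<omega> a + \<omega> b" for a b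
    using \<omega> by (simp add: is_state_def)
  show 2: "a \<in> A \<Longrightarrow> \<omega> (cscale c o\<^sub>L a) = c * \<omega> a" for a c
    using \<omega> by (simp add: is_state_def)
  show 3: "a \<in> A \<Longrightarrow> \<omega> (r *\<^sub>R a) = of_real r * \<omega> a" for a r
    by (simp add: 2 scaleR_conv_cscale)
  show 4: "\<omega> 0 = 0" using 3[of 0 0] cstar_subalgebraD(2)[OF A] by simp
  show "a \<in> A \<Longrightarrow> b \<in> A \<Longrightarrow> \<omega> (a - b) = \<omega> a - \<omega> b"
    using 1[of a "(-1) *\<^sub>R b"] 3[of b "-1"] cstar_subalgebra_scaleR[OF A, of b "-1"] by simp
  show "(\<And>i. i \<in> I \<Longrightarrow> f i \<in> A) \<Longrightarrow> \<omega> (\<Sum>i\<in>I. f i) = (\<Sum>i\<in>I. \<omega> (f i)) \<and> (\<Sum>i\<in>I. f i) \<in> A"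
    by (induction I rule: infinite_finite_induct) (auto simp: 4 1 cstar_subalgebraD[OF A])
qed

text \<open>For selfadjoint \<open>b\<close> of norm at most 1/2, the element 1 - b is the square of
  a selfadjoint one, so positivity makes \<open>\<omega> b\<close> real and at most 1; the same
  applies to -b. Scaling gives the constant 2 on selfadjoint elements, and splitting
  \<open>a\<close> into real and imaginary parts gives 4.\<close>

lemma state_bounded:
  assumes A: "cstar_subalgebra X A" and \<omega>: "is_state X A \<omega>" and one: "unit_op X \<in> A" and a: "a \<in> A"
  shows "cmod (\<omega> a) \<le> 4 * norm a"
proof -
  note A' = cstar_subalgebraD[OF A]
  note lin\<omega> = is_state_linear[OF A \<omega>]
  have lin: "y \<in> A \<Longrightarrow> clinear y" for y using A'(1) bounded_opsD(1) by blast
  have adjR: "y \<in> A \<Longrightarrow> adj (r *\<^sub>R y) = r *\<^sub>R adj y" for y and r :: real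
    by (simp add: scaleR_conv_cscale adj_cscale_compose lin)
  have pos: "1 - \<omega> b \<in> \<real>\<^sub>\<ge>\<^sub>0" if b: "b \<in> A" "adj b = b" "norm b \<le> 1 / 2" for b
  proof -
    obtain y where y: "y \<in> A" "adj y = y" "y + y = b + (y o\<^sub>L y)"
      using selfadjoint_sqrt[OF A b] .
    let ?c = "unit_op X - y"
    \<comment> \<open>Since \<open>y\<close> is selfadjoint, this is (1 - y)^2 = 1 - 2y + y^2, which
      equals 1 - b by the choice of \<open>y\<close>.\<close>
    have "adj ?c o\<^sub>L ?c = unit_op X - (y + y) + (y o\<^sub>L y)"
      using y(1,2) by (simp add: adj_diff lin one adj_unit_op blinfun_compose_algebra unit_op_compose A' unit_op_in_bounded_ops algebra_simps)
    also have "\<dots> = unit_op X - b" by (simp add: y)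
    finally have "\<omega> (unit_op X - b) \<in> \<real>\<^sub>\<ge>\<^sub>0"
      using \<omega> y one cstar_subalgebra_diff[OF A one y(1)] unfolding is_state_def by metis
    moreover have "\<omega> (unit_op X) = 1" using \<omega> by (simp add: is_state_def)
    ultimately show ?thesis using one b by (simp add: lin\<omega>)
  qed
  have le1: "cmod (\<omega> b) \<le> 1" if b: "b \<in> A" "adj b = b" "norm b \<le> 1 / 2" for b
  proof -
    have m: "(-1) *\<^sub>R b \<in> A" "adj ((-1) *\<^sub>R b) = (-1) *\<^sub>R b" "norm ((-1) *\<^sub>R b) \<le> 1 / 2"
      using b adjR[OF b(1), of "-1"] cstar_subalgebra_scaleR[OF A b(1), of "-1"] by auto
    have "\<omega> ((-1) *\<^sub>R b) = - \<omega> b" using lin\<omega>(3)[OF b(1), of "-1"] by simp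
    then show ?thesis
      using pos[OF b] pos[OF m] by (simp add: complex_nonneg_Reals_iff cmod_eq_Re abs_le_iff)
  qed
  have sa: "cmod (\<omega> b) \<le> 2 * norm b" if b: "b \<in> A" "adj b = b" for b
  proof (cases "b = 0")
    case False
    \<comment> \<open>Scales \<open>b\<close> to norm exactly 1/2.\<close>
    let ?r = "1 / (2 * norm b)"
    have "cmod (\<omega> (?r *\<^sub>R b)) \<le> 1"
      using False b by (intro le1 cstar_subalgebra_scaleR[OF A] b) (simp_all add: adjR)
    then show ?thesis using False b by (simp add: lin\<omega> norm_mult norm_divide field_simps)
  qed (simp add: lin\<omega>)
  \<comment> \<open>\<open>?h\<close> is twice the real part of \<open>a\<close>, and
    \<open>?k\<close> is minus twice its imaginary part.\<close>
  let ?h = "a + adj a" and ?k = "cscale \<i> o\<^sub>L (a - adj a)"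
  have c: "cscale (- \<i>) o\<^sub>L (cscale \<i> o\<^sub>L b) = b" for b :: "'a op"
    by (rule blinfun_eqI) (simp add: scaleC_simps scaleC_algebra)
  have mem: "adj a \<in> A" "?h \<in> A" "?k \<in> A" "a - adj a \<in> A"
    using a A' cstar_subalgebra_diff[OF A] by auto
  have "adj ?h = ?h" using a mem by (simp add: adj_add adj_adj lin add.commute)
  then have "cmod (\<omega> ?h) \<le> 2 * norm ?h" using sa mem by blast
  also have "norm ?h \<le> 2 * norm a" using norm_adj_le[OF lin[OF a]] by (intro norm_triangle_le) auto
  finally have h: "cmod (\<omega> ?h) \<le> 4 * norm a" by simp
  have "adj ?k = ?k"
    using a mem by (simp add: adj_cscale_compose adj_diff adj_adj lin)
      (rule blinfun_eqI, rule coef_eqI, simp add: scaleC_simps blinfun.diff_left algebra_simps)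
  then have "cmod (\<omega> ?k) \<le> 2 * norm ?k" using sa mem by blast
  also have "norm ?k \<le> norm (cscale \<i> :: 'a op) * norm (a - adj a)" by (rule norm_blinfun_compose)
  also have "\<dots> \<le> 1 * (2 * norm a)"
  proof (intro mult_mono)
    show "norm (cscale \<i> :: 'a op) \<le> 1"
    proof (rule norm_blinfun_bound)
      fix f :: "'a ell2"
      have "(norm (cscale \<i> f))\<^sup>2 = (norm f)\<^sup>2" by (simp add: norm_ell2_sq scaleC_simps norm_mult)
      then show "norm (cscale \<i> f) \<le> 1 * norm f" by simp
    qed simp
    show "norm (a - adj a) \<le> 2 * norm a"
      using norm_adj_le[OF lin[OF a]] norm_triangle_ineq4[of a "adj a"] by simp
  qed auto
  finally have k: "cmod (\<omega> ?k) \<le> 4 * norm a" by simp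
  have "2 *\<^sub>R a = ?h + (cscale (- \<i>) o\<^sub>L ?k)" by (simp add: c scaleR_2)
  then have "\<omega> (2 *\<^sub>R a) = \<omega> ?h + (- \<i>) * \<omega> ?k"
    using mem A'(5)[OF mem(3)] by (simp add: lin\<omega> del: minus_mult_left)
  then have "2 * \<omega> a = \<omega> ?h + (- \<i>) * \<omega> ?k" using a by (simp add: lin\<omega>)
  then have "2 * cmod (\<omega> a) \<le> cmod (\<omega> ?h) + cmod (\<omega> ?k)"
    by (metis norm_mult norm_numeral norm_triangle_ineq norm_minus_cancel norm_ii mult_1)
  then show ?thesis using h k by simp
qed

section \<open>Ping-pong\<close>

lemma norm_sum_disjoint_support:
  assumes "finite I" "disjoint_family_on E I" "\<And>i x. i \<in> I \<Longrightarrow> x \<notin> E i \<Longrightarrow> coef (u i) x = 0"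
  shows "(norm (\<Sum>i\<in>I. u i))\<^sup>2 = (\<Sum>i\<in>I. (norm (u i))\<^sup>2)"
proof (rule norm_sum_Pythagorean[OF assms(1)], rule pairwiseI)
  fix i j assume ij: "i \<in> I" "j \<in> I" "i \<noteq> j"
  have *: "(\<lambda>x. cnj (coef (u i) x) * coef (u j) x) = (\<lambda>_. 0)"
    using assms(3)[of i] assms(3)[of j] disjoint_family_onD[OF assms(2) ij] ij by fastforce
  show "orthogonal (u i) (u j)" unfolding orthogonal_def inner_ell2_def * by simp
qed

text \<open>Each summand is cut at \<open>E i\<close>. The parts inside the disjoint sets
  \<open>E i\<close> are orthogonal, so their sum has norm at most
  \<open>sqrt (card I) * norm f\<close>. The part outside \<open>E i\<close> reads \<open>f\<close>
  only on \<open>D i\<close>; as the \<open>D i\<close> are disjoint, the squared norms of these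
  parts add up to at most that of \<open>f\<close>, and Cauchy-Schwarz yields the same bound
  again.\<close>

lemma norm_sum_pull_le:
  assumes I: "finite I" and inj: "\<And>i. i \<in> I \<Longrightarrow> inj_on (\<pi> i) X"
    and E: "disjoint_family_on E I" and D: "disjoint_family_on D I"
    and ED: "\<And>i x. i \<in> I \<Longrightarrow> x \<in> X \<Longrightarrow> x \<notin> E i \<Longrightarrow> \<pi> i x \<in> D i"
  shows "norm (\<Sum>i\<in>I. pull X (\<pi> i)) \<le> 2 * sqrt (card I)"
proof (rule norm_blinfun_bound)
  fix f
  define g h where "g i = unit_op (E i) (pull X (\<pi> i) f)" and "h i = unit_op (- E i) (pull X (\<pi> i) f)" for i
  have gh: "pull X (\<pi> i) f = g i + h i" for i
    by (rule coef_eqI) (simp add: g_def h_def coef_unit_op scaleC_simps)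
  have "norm (\<Sum>i\<in>I. g i) \<le> sqrt (card I) * norm f"
  proof (rule power2_le_imp_le)
    have "(norm (\<Sum>i\<in>I. g i))\<^sup>2 = (\<Sum>i\<in>I. (norm (g i))\<^sup>2)"
      by (rule norm_sum_disjoint_support[OF I E]) (simp add: g_def coef_unit_op)
    also have "\<dots> \<le> (\<Sum>i\<in>I. (norm f)\<^sup>2)"
    proof (intro sum_mono power_mono)
      show "norm (g i) \<le> norm f" if "i \<in> I" for i
        unfolding g_def using norm_unit_op_apply_le norm_pull_apply_le[OF inj[OF that]] order_trans by blast
    qed auto
    also have "\<dots> = (sqrt (card I) * norm f)\<^sup>2" by (simp add: power_mult_distrib)
    finally show "(norm (\<Sum>i\<in>I. g i))\<^sup>2 \<le> (sqrt (card I) * norm f)\<^sup>2" .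
  qed simp
  moreover have "norm (\<Sum>i\<in>I. h i) \<le> sqrt (card I) * norm f"
  proof -
    \<comment> \<open>\<open>k i\<close> is the portion of \<open>f\<close> that \<open>h i\<close>
      can see, because \<pi> sends the complement of \<open>E i\<close> into
      \<open>D i\<close>.\<close>
    define k where "k i = unit_op (D i) f" for i
    have hk: "norm (h i) \<le> norm (k i)" if i: "i \<in> I" for i
    proof -
      have "h i = unit_op (- E i) (pull X (\<pi> i) (k i))"
        by (rule coef_eqI) (use ED[OF i] in \<open>auto simp: h_def k_def coef_unit_op coef_pull inj i\<close>)
      then show ?thesis
        using norm_unit_op_apply_le norm_pull_apply_le[OF inj[OF i]] order_trans by metis
    qed
    have "(\<Sum>i\<in>I. (norm (k i))\<^sup>2) = (norm (\<Sum>i\<in>I. k i))\<^sup>2"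
      by (rule norm_sum_disjoint_support[OF I D, symmetric]) (simp add: k_def coef_unit_op)
    also have "(\<Sum>i\<in>I. k i) = unit_op (\<Union>i\<in>I. D i) f"
    proof (rule coef_eqI)
      fix x
      show "coef (\<Sum>i\<in>I. k i) x = coef (unit_op (\<Union>i\<in>I. D i) f) x"
      proof (cases "\<exists>j\<in>I. x \<in> D j")
        case True
        then obtain j where j: "j \<in> I" "x \<in> D j" by blast
        have "coef (\<Sum>i\<in>I. k i) x = (\<Sum>i\<in>I. if i = j then coef f x else 0)"
          unfolding coef_sum using D j
          by (intro sum.cong) (auto simp: k_def coef_unit_op disjoint_family_on_def)
        then show ?thesis using I j by (auto simp: coef_unit_op)
      qed (auto simp: coef_sum k_def coef_unit_op)
    qed
    also have "(norm (unit_op (\<Union>i\<in>I. D i) f))\<^sup>2 \<le> (norm f)\<^sup>2"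
      by (intro power_mono norm_unit_op_apply_le) auto
    finally have k: "(\<Sum>i\<in>I. (norm (k i))\<^sup>2) \<le> (norm f)\<^sup>2" .
    have "norm (\<Sum>i\<in>I. h i) \<le> (\<Sum>i\<in>I. norm (k i))"
      by (intro sum_norm_le hk)
    also have "\<dots> \<le> sqrt (card I) * norm f"
    proof (rule power2_le_imp_le)
      have "(\<Sum>i\<in>I. 1 * norm (k i))\<^sup>2 \<le> (\<Sum>i\<in>I. 1\<^sup>2) * (\<Sum>i\<in>I. (norm (k i))\<^sup>2)"
        by (rule Cauchy_Schwarz_ineq_sum)
      also have "\<dots> \<le> (sqrt (card I) * norm f)\<^sup>2"
        using k by (simp add: power_mult_distrib mult_left_mono)
      finally show "(\<Sum>i\<in>I. norm (k i))\<^sup>2 \<le> (sqrt (card I) * norm f)\<^sup>2" by simp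
    qed simp
    finally show ?thesis .
  qed
  ultimately show "norm ((\<Sum>i\<in>I. pull X (\<pi> i)) f) \<le> 2 * sqrt (card I) * norm f"
    by (simp add: blinfun.sum_left gh sum.distrib) (rule norm_triangle_le, simp)
qed simp

section \<open>Amplification and embedding\<close>

lemma tensor_ket: "ket x \<otimes>\<^sub>2 ket y = ket (x, y)"
  by (rule coef_eqI) (auto simp: tensor.rep_eq coef_ket split: prod.splits)

lemma amp_ket: "clinear a \<Longrightarrow> amp a (ket (x, y)) = a (ket x) \<otimes>\<^sub>2 ket y"
  using amp_tensor[of a "ket x" "ket y"] by (simp add: clinear_def tensor_ket)

lemma clinear_amp: "clinear a \<Longrightarrow> clinear (amp a)"
  unfolding clinear_def
proof (intro allI coef_eqI)
  fix c p and f :: "('a \<times> 'b) ell2" assume a: "\<forall>c f. a (scaleC c f) = scaleC c (a f)"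
  have "slice y (scaleC c f) = scaleC c (slice y f)" for y
    by (rule coef_eqI) (simp add: slice.rep_eq scaleC_simps)
  with a show "coef (amp a (scaleC c f)) p = coef (scaleC c (amp a f)) p"
    by (cases p) (simp add: coef_amp scaleC_simps)
qed

text \<open>The bound holds on every slice, and the squared norms of the slices add up to that of
  the vector.\<close>

lemma norm_amp_le: "norm (amp a :: ('x \<times> 'y) op) \<le> norm a"
proof (rule norm_blinfun_bound)
  fix f :: "('x \<times> 'y) ell2"
  show "norm (amp a f) \<le> norm a * norm f"
  proof (rule power2_le_imp_le)
    have "slice y (amp a f) = a (slice y f)" for y
      by (rule coef_eqI) (simp add: slice.rep_eq coef_amp)
    then have "(norm (slice y (amp a f)))\<^sup>2 \<le> (norm a)\<^sup>2 * (norm (slice y f))\<^sup>2" for y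
      using power_mono[OF norm_blinfun[of a "slice y f"], of 2] by (simp add: power_mult_distrib)
    then show "(norm (amp a f))\<^sup>2 \<le> (norm a * norm f)\<^sup>2"
      unfolding power_mult_distrib
      by (rule has_sum_mono[OF norm_slice_has_sum has_sum_cmult_right[OF norm_slice_has_sum]])
  qed simp
qed simp

lemma amp_linear:
  "amp (a + b) = amp a + amp b" "amp (a - b) = amp a - amp b"
  "amp (cscale c o\<^sub>L a) = cscale c o\<^sub>L amp a" "amp 0 = 0"
  by (rule blinfun_eqI, rule coef_eqI,
      simp add: split_paired_all coef_amp scaleC_simps blinfun.add_left blinfun.diff_left)+

lemma clinear_fp_V: "clinear (fp_V G \<iota>)"
  unfolding fp_V_def by (rule clinear_pull[OF inj_on_fp_split])

lemma fp_embed_linear: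
  "fp_embed G \<iota> (a + b) = fp_embed G \<iota> a + fp_embed G \<iota> b"
  "fp_embed G \<iota> (a - b) = fp_embed G \<iota> a - fp_embed G \<iota> b"
  "fp_embed G \<iota> (cscale c o\<^sub>L a) = cscale c o\<^sub>L fp_embed G \<iota> a"
  "fp_embed G \<iota> 0 = 0"
proof -
  show "fp_embed G \<iota> (cscale c o\<^sub>L a) = cscale c o\<^sub>L fp_embed G \<iota> a"
    by (rule blinfun_eqI)
       (simp add: fp_embed_def amp_linear scaleC_simps clinear_scaleC[OF clinear_fp_V])
qed (simp_all add: fp_embed_def amp_linear blinfun_compose_algebra)

lemma norm_fp_embed_le: "norm (fp_embed G \<iota> a) \<le> norm a"
proof -
  have V: "norm (fp_V G \<iota>) \<le> 1" unfolding fp_V_def by (rule norm_pull_le[OF inj_on_fp_split])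
  have V': "norm (adj (fp_V G \<iota>)) \<le> 1" using norm_adj_le[OF clinear_fp_V] V order_trans by blast
  have "norm (fp_embed G \<iota> a) \<le> norm (fp_V G \<iota> o\<^sub>L amp a) * norm (adj (fp_V G \<iota>))"
    unfolding fp_embed_def by (rule norm_blinfun_compose)
  also have "\<dots> \<le> norm (fp_V G \<iota> o\<^sub>L amp a) * 1" by (intro mult_left_mono V') auto
  also have "\<dots> \<le> norm (fp_V G \<iota>) * norm (amp a :: ('a \<times> (fp_index \<times> 'a) list) op)"
    using norm_blinfun_compose by simp
  also have "\<dots> \<le> 1 * norm a" by (intro mult_mono V norm_amp_le) auto
  finally show ?thesis by simp
qed

lemma tendsto_fp_embed: "u \<longlonglongrightarrow> a \<Longrightarrow> (\<lambda>n. fp_embed G \<iota> (u n)) \<longlonglongrightarrow> fp_embed G \<iota> a"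
proof (rule LIM_zero_cancel, rule Lim_null_comparison)
  assume "u \<longlonglongrightarrow> a"
  then show "(\<lambda>n. norm (u n - a)) \<longlonglongrightarrow> 0" by (simp add: LIM_zero tendsto_norm_zero)
qed (auto simp: norm_fp_embed_le simp flip: fp_embed_linear)

lemma fp_embed_in_bounded_ops: "clinear a \<Longrightarrow> fp_embed G \<iota> a \<in> bounded_ops (fp_words G)"
  unfolding fp_embed_def
  by (rule bounded_opsI)
     (auto simp: clinear_ops clinear_amp clinear_adj fp_V_def clinear_pull[OF inj_on_fp_split]
       pull_in_ell2_on[OF inj_on_fp_split] adj_pull_ket[OF inj_on_fp_split])

text \<open>Splitting off the first syllable, applying \<open>a\<close> to it and gluing again leads
  from a basis vector to a basis vector. The word \<open>v'\<close> exists because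
  \<open>fp_split\<close> maps onto the product set.\<close>

lemma fp_embed_ket:
  assumes G: "group (G \<iota>)" and a: "clinear a" and v: "v \<in> fp_words G" and s: "fp_split G \<iota> v = (g, u)"
    and ag: "a (ket g) = ket g'" "g' \<in> carrier (G \<iota>)"
  obtains v' where "v' \<in> fp_words G" "fp_split G \<iota> v' = (g', u)" "fp_embed G \<iota> a (ket v) = ket v'"
proof -
  have "(g, u) \<in> carrier (G \<iota>) \<times> fp_words_not G \<iota>" using fp_split_image[where G = G and \<iota> = \<iota>, OF G] imageI[OF v, of "fp_split G \<iota>"] s by simp
  then have "(g', u) \<in> fp_split G \<iota> ` fp_words G"
    using ag fp_split_image[where G = G and \<iota> = \<iota>, OF G] by simp
  then obtain v' where v': "v' \<in> fp_words G" "fp_split G \<iota> v' = (g', u)" by force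
  moreover have "fp_embed G \<iota> a (ket v) = fp_V G \<iota> (ket (fp_split G \<iota> v'))"
    using v s v' by (simp add: fp_embed_def fp_V_def adj_pull_ket[OF inj_on_fp_split] amp_ket a ag tensor_ket)
  moreover have "fp_V G \<iota> (ket (fp_split G \<iota> v')) = ket v'"
    unfolding fp_V_def by (rule pull_ket[OF inj_on_fp_split v'(1)])
  ultimately show ?thesis using that by simp
qed

text \<open>The vacuum splits into the unit and the empty word. This gives the marginals of
  \<open>fp_state\<close>. Slices are used because \<open>amp_ket\<close> asks for complex
  linearity.\<close>

lemma cinner_vac_fp_embed:
  "cinner (ket []) (fp_embed G \<iota> a (ket [])) = group_state (G \<iota>) a"
proof -
  have "[] \<in> fp_words G" "fp_split G \<iota> [] = (\<one>\<^bsub>G \<iota>\<^esub>, [])" by (auto simp: fp_words_def fp_split_def)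
  moreover have "slice y (ket (x, y)) = ket x" for x :: 'a and y :: "(fp_index \<times> 'a) list"
    by (rule coef_eqI) (simp add: slice.rep_eq coef_ket)
  ultimately show ?thesis
    by (simp add: cinner_ket_left group_state_def group_vac_def fp_embed_def fp_V_def
      adj_pull_ket[OF inj_on_fp_split] coef_pull[OF inj_on_fp_split] coef_amp)
qed

section \<open>The left regular representation\<close>

lemma inj_on_left_mult: "group G \<Longrightarrow> g \<in> carrier G \<Longrightarrow> inj_on (\<lambda>h. inv\<^bsub>G\<^esub> g \<otimes>\<^bsub>G\<^esub> h) (carrier G)"
  by (simp add: group.inj_on_cmult group.inv_closed)

lemma left_regular_in_bounded_ops:
  assumes "group G" "g \<in> carrier G" shows "left_regular G g \<in> bounded_ops (carrier G)"
proof -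
  interpret group G by fact
  show ?thesis unfolding left_regular_def
    by (rule pull_in_bounded_ops[OF inj_on_left_mult[OF assms]]) (use assms in auto)
qed

lemma left_regular_ket:
  assumes "group G" "g \<in> carrier G" "h \<in> carrier G"
  shows "left_regular G g (ket h) = ket (g \<otimes>\<^bsub>G\<^esub> h)"
proof -
  interpret group G by fact
  have "inv\<^bsub>G\<^esub> g \<otimes>\<^bsub>G\<^esub> (g \<otimes>\<^bsub>G\<^esub> h) = h" using assms by (simp add: m_assoc[symmetric])
  then show ?thesis
    unfolding left_regular_def using pull_ket[OF inj_on_left_mult[OF assms(1,2)], of "g \<otimes>\<^bsub>G\<^esub> h"] assms by simp
qed

lemma left_regular_mult:
  assumes "group G" "g \<in> carrier G" "h \<in> carrier G"
  shows "left_regular G g o\<^sub>L left_regular G h = left_regular G (g \<otimes>\<^bsub>G\<^esub> h)"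
proof -
  interpret group G by fact
  show ?thesis
    by (rule bounded_ops_eqI[of _ "carrier G"])
       (use assms in \<open>auto simp: left_regular_in_bounded_ops left_regular_ket m_assoc
         intro: cstar_subalgebraD(4)[OF cstar_subalgebra_bounded_ops]\<close>)
qed

lemma adj_left_regular:
  assumes "group G" "g \<in> carrier G"
  shows "adj (left_regular G g) = left_regular G (inv\<^bsub>G\<^esub> g)"
proof -
  interpret group G by fact
  show ?thesis
  proof (rule bounded_ops_eqI[of _ "carrier G"])
    show "adj (left_regular G g) \<in> bounded_ops (carrier G)"
      using assms by (intro cstar_subalgebraD(6)[OF cstar_subalgebra_bounded_ops] left_regular_in_bounded_ops)
    show "adj (left_regular G g) (ket h) = left_regular G (inv\<^bsub>G\<^esub> g) (ket h)" if "h \<in> carrier G" for h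
      using that assms by (subst left_regular_ket)
        (auto simp: left_regular_def adj_pull_ket[OF inj_on_left_mult[OF assms]])
  qed (use assms in \<open>auto intro: left_regular_in_bounded_ops\<close>)
qed

lemma reduced_cstar_eq:
  assumes "group G"
  shows "reduced_cstar G = closure (cspan (left_regular G ` carrier G))"
proof -
  interpret group G by fact
  show ?thesis unfolding reduced_cstar_def
    by (rule cstar_generated_eq_closure_cspan)
       (auto simp: left_regular_in_bounded_ops[OF assms] left_regular_mult[OF assms] adj_left_regular[OF assms])
qed

lemma reduced_cstar_clinear:
  assumes "group G" "a \<in> reduced_cstar G" shows "clinear a"
proof -
  have "reduced_cstar G \<subseteq> bounded_ops (carrier G)"
    unfolding reduced_cstar_def
    by (rule cstar_generated_minimal[OF cstar_subalgebra_bounded_ops])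
       (auto simp: left_regular_in_bounded_ops[OF assms(1)])
  then show ?thesis using assms(2) bounded_opsD(1) by blast
qed

section \<open>Words\<close>

abbreviation word_inv :: "('s \<times> bool) list \<Rightarrow> ('s \<times> bool) list"
  where "word_inv u \<equiv> rev (map (apsnd Not) u)"

lemma free_group_simps:
  "w \<in> carrier (free_group S) \<longleftrightarrow> set w \<subseteq> S \<times> UNIV \<and> freely_reduced w"
  "u \<otimes>\<^bsub>free_group S\<^esub> v = foldr red_cons u v" "\<one>\<^bsub>free_group S\<^esub> = []"
  by (auto simp: free_group_def)

lemma foldr_red_cons_append: "freely_reduced (u @ z) \<Longrightarrow> foldr red_cons u z = u @ z"
proof (induction u)
  case (Cons p u)
  then show ?case by (cases "u @ z") (auto simp: red_cons_simps)
qed simp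

lemma cancels_iff: "cancels p q \<longleftrightarrow> q = apsnd Not p"
  by (cases p; cases q) (auto simp: cancels_def)

text \<open>A letter of \<open>u\<close> can cancel only after everything to its right has been
  consumed by \<open>y\<close>. Otherwise the head of the remaining part survives in front, and the
  next letter of \<open>u\<close> does not cancel against it because \<open>u\<close> is
  reduced.\<close>

lemma foldr_red_cons_cases:
  assumes "u \<noteq> []" "freely_reduced u" "freely_reduced y"
  shows "(\<exists>z. y = word_inv u @ z) \<or> (\<exists>r. foldr red_cons u y = hd u # r)"
  using assms(1,2)
proof (induction u)
  case (Cons s q)
  have *: "(\<exists>z'. z = apsnd Not s # z') \<or> (\<exists>r. red_cons s z = s # r)" for z
    by (cases z) (auto simp: red_cons_simps cancels_iff)
  show ?case
  proof (cases "q = []")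
    case True
    then show ?thesis using *[of y] by auto
  next
    case False
    then have q: "freely_reduced q" "\<not> cancels s (hd q)"
      using Cons.prems by (cases q; simp)+
    from Cons.IH[OF False q(1)] show ?thesis
    proof
      assume "\<exists>z. y = word_inv q @ z"
      then obtain z where z: "y = word_inv q @ z" by blast
      have "freely_reduced z" using assms(3) z by (simp add: successively_append_iff)
      \<comment> \<open>Together with the next fact this shows that multiplying \<open>y\<close> by
        \<open>q\<close> leaves exactly \<open>z\<close>.\<close>
      then have "foldr red_cons (word_inv (word_inv q)) (foldr red_cons (word_inv q) z) = z"
        by (rule foldr_red_cons_inv)
      moreover have "foldr red_cons (word_inv q) z = y"
        using assms(3) unfolding z by (rule foldr_red_cons_append)
      moreover have "word_inv (word_inv q) = q" by (auto simp: rev_map o_def apsnd_compose intro!: map_idI)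
      ultimately have "foldr red_cons q y = z" by simp
      then show ?thesis using *[of z] z by auto
    next
      assume "\<exists>r. foldr red_cons q y = hd q # r"
      then show ?thesis using q(2) by (auto simp: red_cons_simps)
    qed
  qed
qed simp

text \<open>The ping-pong property, by contraposition: if the quotient does not begin with the
  inverse of \<open>s # q\<close>, then \<open>s\<close> survives when it is multiplied by
  \<open>s # q\<close>. Nothing of \<open>p\<close> can then cancel, and the product, which is
  \<open>x\<close>, begins with \<open>p @ [s]\<close>.\<close>

lemma mult_starts_with:
  assumes w: "p @ s # q \<in> carrier (free_group S)" and x: "x \<in> carrier (free_group S)"
    and start: "take (Suc (length p)) x \<noteq> p @ [s]"
  shows "take (Suc (length q)) (inv\<^bsub>free_group S\<^esub> (p @ s # q) \<otimes>\<^bsub>free_group S\<^esub> x) = word_inv (s # q)"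
proof (rule ccontr)
  interpret group "free_group S" by (rule group_free_group)
  let ?y = "inv\<^bsub>free_group S\<^esub> (p @ s # q) \<otimes>\<^bsub>free_group S\<^esub> x"
  assume no: "take (Suc (length q)) ?y \<noteq> word_inv (s # q)"
  have y: "?y \<in> carrier (free_group S)" using w x by (intro m_closed inv_closed)
  have red: "freely_reduced (p @ s # q)" using w by (simp add: free_group_simps)
  have "\<not> (\<exists>z. ?y = word_inv (s # q) @ z)" using no by fastforce
  then obtain r where r: "foldr red_cons (s # q) ?y = s # r"
    using foldr_red_cons_cases[of "s # q" ?y] red y by (auto simp: free_group_simps successively_append_iff)
  have "freely_reduced (s # r)"
    using foldr_red_cons_reduced[of ?y "s # q"] y r by (simp add: free_group_simps)
  then have "freely_reduced (p @ s # r)" using red by (auto simp: successively_append_iff)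
  then have "foldr red_cons p (s # r) = p @ s # r" by (rule foldr_red_cons_append)
  then have "(p @ s # q) \<otimes>\<^bsub>free_group S\<^esub> ?y = p @ s # r"
    using r by (simp add: free_group_simps)
  moreover have "(p @ s # q) \<otimes>\<^bsub>free_group S\<^esub> ?y = x"
    using w x by (simp add: m_assoc[symmetric])
  ultimately show False using start by simp
qed

lemma funpow_free_group_map:
  fixes f :: "'s \<Rightarrow> 's"
  shows "free_group_map f ^^ n = free_group_map (f ^^ n)"
  by (induction n) (auto simp: free_group_map_def fun_eq_iff apfst_def map_prod_def split: prod.splits)

lemma left_regular_in_reduced_cstar: "h \<in> carrier H \<Longrightarrow> left_regular H h \<in> reduced_cstar H"
  unfolding reduced_cstar_def using cstar_generated_superset by fastforce

section \<open>The free product as a free group\<close>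

locale fp_alphabets =
  fixes S :: "fp_index \<Rightarrow> 's set"
begin

abbreviation (input) "G \<equiv> \<lambda>\<iota>. free_group (S \<iota>)"
abbreviation (input) "X \<equiv> fp_words G"
abbreviation (input) "F \<equiv> free_group (Sigma UNIV S)"

text \<open>Erases the syllable boundaries. Each letter keeps the index of its factor as a tag, so
  the boundaries can be recovered as the places where the tag changes.\<close>

definition flatten :: "(fp_index \<times> ('s \<times> bool) list) list \<Rightarrow> ((fp_index \<times> 's) \<times> bool) list"
  where "flatten v = concat (map (\<lambda>(\<iota>, g). free_group_map (Pair \<iota>) g) v)"

lemma flatten_simps: "flatten [] = []" "flatten ((\<iota>, g) # v) = free_group_map (Pair \<iota>) g @ flatten v"
  by (simp_all add: flatten_def)

lemma fp_words_Cons: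
  "(\<iota>, g) # v \<in> X \<longleftrightarrow> g \<in> carrier (G \<iota>) \<and> g \<noteq> [] \<and> v \<in> fp_words_not G \<iota>"
  by (cases v) (auto simp: fp_words_def fp_words_not_def free_group_simps)

lemma flatten_hd: "v \<in> X \<Longrightarrow> v \<noteq> [] \<Longrightarrow> flatten v \<noteq> [] \<and> fst (fst (hd (flatten v))) = fst (hd v)"
proof -
  assume v: "v \<in> X" "v \<noteq> []"
  then obtain \<iota> g u where u: "v = (\<iota>, g) # u" by (metis surj_pair list.exhaust)
  then have "g \<noteq> []" using v fp_words_Cons by auto
  then show ?thesis by (cases g) (auto simp: u flatten_simps free_group_map_def)
qed

lemma flatten_not: "v \<in> fp_words_not G \<iota> \<Longrightarrow> flatten v = [] \<or> fst (fst (hd (flatten v))) \<noteq> \<iota>"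
  using flatten_hd[of v] by (cases "v = []") (auto simp: fp_words_not_def flatten_simps)

lemma flatten_split: "fp_split G \<iota> v = (g, u) \<Longrightarrow> flatten v = free_group_map (Pair \<iota>) g @ flatten u"
  by (cases v) (auto simp: fp_split_def flatten_simps free_group_simps free_group_map_def split: if_splits)

lemma map_Pair_in_free_group:
  assumes "g \<in> carrier (G \<iota>)" shows "free_group_map (Pair \<iota>) g \<in> carrier F"
proof -
  have "freely_reduced (map (apfst (Pair \<iota>)) g)"
    using assms by (auto simp: free_group_simps successively_map cancels_def elim!: successively_mono)
  then show ?thesis using assms by (auto simp: free_group_simps free_group_map_def)
qed

text \<open>Letters meeting at a syllable boundary carry different tags, so they do not
  cancel.\<close>

lemma flatten_in_free_group: "v \<in> X \<Longrightarrow> flatten v \<in> carrier F"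
proof (induction v)
  case (Cons q v)
  obtain \<iota> g where q: "q = (\<iota>, g)" by (cases q)
  then have g: "g \<in> carrier (G \<iota>)" "g \<noteq> []" "v \<in> fp_words_not G \<iota>" using Cons.prems fp_words_Cons by auto
  then have "flatten v \<in> carrier F" using Cons.IH by (simp add: fp_words_not_def)
  moreover have "\<not> cancels (last (free_group_map (Pair \<iota>) g)) (hd (flatten v))" if "flatten v \<noteq> []"
  proof -
    have "fst (fst (last (free_group_map (Pair \<iota>) g))) = \<iota>"
      using g(2) by (simp add: free_group_map_def last_map)
    then show ?thesis using flatten_not[OF g(3)] that unfolding cancels_def by metis
  qed
  ultimately show ?case
    using map_Pair_in_free_group[OF g(1)]
    by (auto simp: q flatten_simps free_group_simps successively_append_iff)
qed (simp add: flatten_simps free_group_simps)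

text \<open>The first syllable is recovered as the longest prefix whose letters carry the tag of the
  first letter.\<close>

lemma inj_on_flatten: "inj_on flatten X"
proof (rule inj_onI)
  fix v v' assume "v \<in> X" "v' \<in> X" "flatten v = flatten v'"
  then show "v = v'"
  proof (induction v arbitrary: v')
    case Nil
    then show ?case using flatten_hd[of v'] by (auto simp: flatten_simps)
  next
    case (Cons q v)
    obtain \<iota> g where q: "q = (\<iota>, g)" by (cases q)
    have "v' \<noteq> []" using Cons.prems flatten_hd[of "q # v"] by (auto simp: flatten_simps)
    then obtain \<iota>' g' u where u: "v' = (\<iota>', g') # u" by (metis surj_pair list.exhaust)
    have eq: "\<iota>' = \<iota>" using flatten_hd[of "q # v"] flatten_hd[of v'] Cons.prems q u by simp
    have m: "v \<in> fp_words_not G \<iota>" "u \<in> fp_words_not G \<iota>"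
      using Cons.prems q u eq fp_words_Cons by auto
    have split: "takeWhile (\<lambda>p. fst (fst p) = \<iota>) (free_group_map (Pair \<iota>) h @ flatten w) = free_group_map (Pair \<iota>) h
       \<and> dropWhile (\<lambda>p. fst (fst p) = \<iota>) (free_group_map (Pair \<iota>) h @ flatten w) = flatten w"
      if "w \<in> fp_words_not G \<iota>" for h w
    proof -
      have "\<forall>p\<in>set (free_group_map (Pair \<iota>) h). fst (fst p) = \<iota>" by (auto simp: free_group_map_def)
      moreover have "takeWhile (\<lambda>p. fst (fst p) = \<iota>) (flatten w) = []"
        "dropWhile (\<lambda>p. fst (fst p) = \<iota>) (flatten w) = flatten w"
        using flatten_not[OF that] by (cases "flatten w"; auto)+
      ultimately show ?thesis by (simp add: takeWhile_append2 dropWhile_append2)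
    qed
    have e: "free_group_map (Pair \<iota>) g @ flatten v = free_group_map (Pair \<iota>) g' @ flatten u"
      using Cons.prems q u eq by (simp add: flatten_simps)
    have "free_group_map (Pair \<iota>) g = free_group_map (Pair \<iota>) g'" "flatten v = flatten u"
      using split[OF m(1), of g] split[OF m(2), of g'] unfolding e by auto
    moreover have "inj (free_group_map (Pair \<iota>))"
      unfolding free_group_map_def by (auto intro!: inj_mapI simp: inj_def)
    ultimately show ?case
      using Cons.IH[of u] m q u eq by (auto simp: fp_words_not_def dest: injD)
  qed
qed

text \<open>A letter with tag \<iota> can cancel only within the syllable \<open>g\<close>, since
  \<open>flatten u\<close> is empty or begins with another tag. This includes the case of empty
  \<open>g\<close>.\<close>

lemma red_cons_flatten:
  assumes "u \<in> fp_words_not G \<iota>"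
  shows "red_cons (apfst (Pair \<iota>) p) (free_group_map (Pair \<iota>) g @ flatten u) =
    free_group_map (Pair \<iota>) (red_cons p g) @ flatten u"
proof (cases g)
  case Nil
  then show ?thesis
    using flatten_not[OF assms] by (cases p; cases "flatten u") (auto simp: red_cons_simps free_group_map_def cancels_def)
next
  case (Cons q g')
  then show ?thesis by (cases p; cases q) (auto simp: red_cons_simps free_group_map_def cancels_def)
qed

lemma foldr_red_cons_flatten:
  assumes "u \<in> fp_words_not G \<iota>"
  shows "foldr red_cons (free_group_map (Pair \<iota>) h) (free_group_map (Pair \<iota>) g @ flatten u) =
    free_group_map (Pair \<iota>) (foldr red_cons h g) @ flatten u"
proof (induction h)
  case (Cons p h)
  have "free_group_map (Pair \<iota>) (p # h) = apfst (Pair \<iota>) p # free_group_map (Pair \<iota>) h"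
    by (simp add: free_group_map_def)
  then show ?case using Cons red_cons_flatten[OF assms] by simp
qed (simp add: free_group_map_def)

lemma fp_split_image_free: "fp_split G \<iota> ` X = carrier (G \<iota>) \<times> fp_words_not G \<iota>"
  by (rule fp_split_image[where G = G, OF group_free_group])

lemma fp_split_mem:
  assumes "v \<in> X" "fp_split G \<iota> v = (g, u)"
  shows "g \<in> carrier (G \<iota>)" "u \<in> fp_words_not G \<iota>"
  using imageI[OF assms(1), of "fp_split G \<iota>"] unfolding fp_split_image_free assms(2) by auto

text \<open>Left multiplication in one factor, as performed on the first component of
  \<open>fp_split\<close>, becomes left multiplication in \<open>F\<close>.\<close>

lemma flatten_mult:
  assumes "v \<in> X" "fp_split G \<iota> v = (g, u)" "v' \<in> X" "fp_split G \<iota> v' = (h \<otimes>\<^bsub>G \<iota>\<^esub> g, u)"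
  shows "flatten v' = free_group_map (Pair \<iota>) h \<otimes>\<^bsub>F\<^esub> flatten v"
  using flatten_split[OF assms(2)] flatten_split[OF assms(4)]
    foldr_red_cons_flatten[OF fp_split_mem(2)[OF assms(1,2)], of h g]
  by (simp add: free_group_simps)

text \<open>For surjectivity, a word is built up letter by letter: prepending a letter is left
  multiplication by a one-letter element of one factor, and reducedness ensures that nothing
  cancels.\<close>

lemma bij_betw_flatten: "bij_betw flatten X (carrier F)"
proof -
  have "\<exists>v\<in>X. flatten v = w" if "w \<in> carrier F" for w
    using that
  proof (induction w)
    case Nil
    show ?case by (rule bexI[of _ "[]"]) (auto simp: flatten_simps fp_words_def)
  next
    case (Cons p w)
    obtain \<iota> s b where p: "p = ((\<iota>, s), b)" by (metis surj_pair)
    have w: "w \<in> carrier F" and s: "[(s, b)] \<in> carrier (G \<iota>)" and red: "red_cons p w = p # w"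
      using Cons.prems p by (auto simp: free_group_simps red_cons_def successively_Cons)
    obtain v where v: "v \<in> X" "flatten v = w" using Cons.IH[OF w] by blast
    obtain g u where gu: "fp_split G \<iota> v = (g, u)" by fastforce
    have "g \<in> carrier (G \<iota>)" "u \<in> fp_words_not G \<iota>" using fp_split_mem[OF v(1) gu] .
    then have "([(s, b)] \<otimes>\<^bsub>G \<iota>\<^esub> g, u) \<in> fp_split G \<iota> ` X"
      unfolding fp_split_image_free using s by (auto intro!: monoid.m_closed group.is_monoid group_free_group)
    then obtain v' where v': "v' \<in> X" "fp_split G \<iota> v' = ([(s, b)] \<otimes>\<^bsub>G \<iota>\<^esub> g, u)" by force
    have "flatten v' = p # w"
      using flatten_mult[OF v(1) gu v'] red v(2) p by (simp add: free_group_simps free_group_map_def)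
    then show ?case using v' by blast
  qed
  then show ?thesis
    using inj_on_flatten flatten_in_free_group by (auto simp: bij_betw_def)
qed

definition unflatten :: "((fp_index \<times> 's) \<times> bool) list \<Rightarrow> (fp_index \<times> ('s \<times> bool) list) list"
  where "unflatten = inv_into X flatten"

lemma unflatten:
  "w \<in> carrier F \<Longrightarrow> unflatten w \<in> X" "w \<in> carrier F \<Longrightarrow> flatten (unflatten w) = w"
  "v \<in> X \<Longrightarrow> unflatten (flatten v) = v" "unflatten [] = []"
proof -
  show "w \<in> carrier F \<Longrightarrow> unflatten w \<in> X" "w \<in> carrier F \<Longrightarrow> flatten (unflatten w) = w"
    using bij_betw_flatten unfolding unflatten_def bij_betw_def by (metis inv_into_into f_inv_into_f)+
  show *: "v \<in> X \<Longrightarrow> unflatten (flatten v) = v" for v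
    unfolding unflatten_def by (rule inv_into_f_f[OF inj_on_flatten])
  show "unflatten [] = []" using *[of "[]"] by (simp add: flatten_simps fp_words_def)
qed

section \<open>Translations and the free product algebra\<close>

text \<open>The left regular representation of \<open>F\<close>, carried over to the free product
  space by \<open>flatten\<close>. The inverse of \<open>w\<close> appears because
  \<open>pull\<close> composes functions with its argument map.\<close>

definition translation :: "((fp_index \<times> 's) \<times> bool) list \<Rightarrow> (fp_index \<times> ('s \<times> bool) list) list op"
  where "translation w = pull X (\<lambda>v. unflatten (inv\<^bsub>F\<^esub> w \<otimes>\<^bsub>F\<^esub> flatten v))"

lemma translation_inj:
  assumes "w \<in> carrier F"
  shows "inj_on (\<lambda>v. unflatten (inv\<^bsub>F\<^esub> w \<otimes>\<^bsub>F\<^esub> flatten v)) X"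
proof (rule inj_onI)
  interpret group F by (rule group_free_group)
  fix v v' assume v: "v \<in> X" "v' \<in> X"
    and eq: "unflatten (inv\<^bsub>F\<^esub> w \<otimes>\<^bsub>F\<^esub> flatten v) = unflatten (inv\<^bsub>F\<^esub> w \<otimes>\<^bsub>F\<^esub> flatten v')"
  have "inv\<^bsub>F\<^esub> w \<otimes>\<^bsub>F\<^esub> flatten v = inv\<^bsub>F\<^esub> w \<otimes>\<^bsub>F\<^esub> flatten v'"
    using arg_cong[OF eq, of flatten] v assms by (simp add: unflatten flatten_in_free_group)
  then show "v = v'"
    using v assms inj_on_flatten by (simp add: flatten_in_free_group inj_on_eq_iff)
qed

lemma translation_in_bounded_ops: "w \<in> carrier F \<Longrightarrow> translation w \<in> bounded_ops X"
proof -
  interpret group F by (rule group_free_group)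
  assume "w \<in> carrier F"
  then show ?thesis unfolding translation_def
    by (intro pull_in_bounded_ops translation_inj) (auto simp: unflatten flatten_in_free_group)
qed

lemma translation_ket:
  assumes "w \<in> carrier F" "u \<in> carrier F"
  shows "translation w (ket (unflatten u)) = ket (unflatten (w \<otimes>\<^bsub>F\<^esub> u))"
proof -
  interpret group F by (rule group_free_group)
  have "inv\<^bsub>F\<^esub> w \<otimes>\<^bsub>F\<^esub> (w \<otimes>\<^bsub>F\<^esub> u) = u" using assms by (simp add: m_assoc[symmetric])
  then show ?thesis
    unfolding translation_def
    using pull_ket[OF translation_inj[OF assms(1)], of "unflatten (w \<otimes>\<^bsub>F\<^esub> u)"] assms by (simp add: unflatten)
qed

lemma fp_words_ops_eqI:
  assumes "a \<in> bounded_ops X" "b \<in> bounded_ops X"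
    "\<And>u. u \<in> carrier F \<Longrightarrow> a (ket (unflatten u)) = b (ket (unflatten u))"
  shows "a = b"
  using assms by (intro bounded_ops_eqI[of a X b]) (metis flatten_in_free_group unflatten(3))+

lemma translation_mult:
  assumes "w \<in> carrier F" "w' \<in> carrier F"
  shows "translation w o\<^sub>L translation w' = translation (w \<otimes>\<^bsub>F\<^esub> w')"
proof -
  interpret group F by (rule group_free_group)
  show ?thesis
    by (rule fp_words_ops_eqI)
       (use assms in \<open>auto simp: translation_in_bounded_ops translation_ket m_assoc
         intro: cstar_subalgebraD(4)[OF cstar_subalgebra_bounded_ops]\<close>)
qed

lemma adj_translation:
  assumes "w \<in> carrier F" shows "adj (translation w) = translation (inv\<^bsub>F\<^esub> w)"
proof -
  interpret group F by (rule group_free_group)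
  show ?thesis
  proof (rule fp_words_ops_eqI)
    show "adj (translation w) \<in> bounded_ops X"
      by (intro cstar_subalgebraD(6)[OF cstar_subalgebra_bounded_ops] translation_in_bounded_ops assms)
    show "adj (translation w) (ket (unflatten u)) = translation (inv\<^bsub>F\<^esub> w) (ket (unflatten u))"
      if "u \<in> carrier F" for u
      using that assms
      by (simp add: translation_ket) (simp add: translation_def adj_pull_ket[OF translation_inj] unflatten)
  qed (use assms in \<open>auto intro: translation_in_bounded_ops\<close>)
qed

lemma translation_Nil: "translation [] = unit_op X"
proof -
  interpret group F by (rule group_free_group)
  have "[] \<in> carrier F" by (simp add: free_group_simps)
  then show ?thesis
    by (intro fp_words_ops_eqI translation_in_bounded_ops unit_op_in_bounded_ops)
       (simp_all add: translation_ket unit_op_ket unflatten free_group_simps(2))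
qed

text \<open>This links the Hilbert space construction with \<open>F\<close>: both sides move basis
  vectors in the same way by \<open>flatten_mult\<close>.\<close>

lemma fp_embed_left_regular:
  assumes h: "h \<in> carrier (G \<iota>)"
  shows "fp_embed G \<iota> (left_regular (G \<iota>) h) = translation (free_group_map (Pair \<iota>) h)"
proof (rule fp_words_ops_eqI)
  have lin: "clinear (left_regular (G \<iota>) h)"
    by (rule bounded_opsD(1)[OF left_regular_in_bounded_ops[OF group_free_group h]])
  show "fp_embed G \<iota> (left_regular (G \<iota>) h) \<in> bounded_ops X"
    by (rule fp_embed_in_bounded_ops[OF lin])
  show "translation (free_group_map (Pair \<iota>) h) \<in> bounded_ops X"
    by (rule translation_in_bounded_ops[OF map_Pair_in_free_group[OF h]])
  fix w assume w: "w \<in> carrier F"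
  let ?v = "unflatten w"
  obtain g u where gu: "fp_split G \<iota> ?v = (g, u)" by fastforce
  have g: "g \<in> carrier (G \<iota>)" using fp_split_mem(1)[OF unflatten(1)[OF w] gu] .
  have hg: "h \<otimes>\<^bsub>G \<iota>\<^esub> g \<in> carrier (G \<iota>)"
    using g h by (intro monoid.m_closed group.is_monoid group_free_group)
  obtain v' where v': "v' \<in> X" "fp_split G \<iota> v' = (h \<otimes>\<^bsub>G \<iota>\<^esub> g, u)"
    "fp_embed G \<iota> (left_regular (G \<iota>) h) (ket ?v) = ket v'"
    using fp_embed_ket[where G = G and \<iota> = \<iota>, OF group_free_group lin unflatten(1)[OF w] gu
      left_regular_ket[OF group_free_group h g] hg] .
  have "flatten v' = free_group_map (Pair \<iota>) h \<otimes>\<^bsub>F\<^esub> w"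
    using flatten_mult[OF unflatten(1)[OF w] gu v'(1,2)] w by (simp add: unflatten)
  then have "v' = unflatten (free_group_map (Pair \<iota>) h \<otimes>\<^bsub>F\<^esub> w)" using v'(1) unflatten(3) by metis
  then show "fp_embed G \<iota> (left_regular (G \<iota>) h) (ket ?v) = translation (free_group_map (Pair \<iota>) h) (ket ?v)"
    using v'(3) translation_ket[OF map_Pair_in_free_group[OF h] w] by simp
qed

lemma fp_generators_in_bounded_ops: "(\<Union>\<iota>. fp_embed G \<iota> ` reduced_cstar (G \<iota>)) \<subseteq> bounded_ops X"
  by (auto intro!: fp_embed_in_bounded_ops reduced_cstar_clinear group_free_group)

lemma cstar_subalgebra_fp_algebra: "cstar_subalgebra X (fp_algebra G)"
  unfolding fp_algebra_def by (rule cstar_subalgebra_cstar_generated[OF fp_generators_in_bounded_ops])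

lemma fp_embed_in_fp_algebra: "a \<in> reduced_cstar (G \<iota>) \<Longrightarrow> fp_embed G \<iota> a \<in> fp_algebra G"
  unfolding fp_algebra_def using cstar_generated_superset by fastforce

text \<open>A translation is the product of the translations by its letters, and each of these comes
  from one of the two factors.\<close>

lemma translation_in_fp_algebra: "w \<in> carrier F \<Longrightarrow> translation w \<in> fp_algebra G"
proof (induction w)
  case Nil
  have "[] \<in> carrier (G I1)" by (simp add: free_group_simps)
  from fp_embed_in_fp_algebra[OF left_regular_in_reduced_cstar[OF this]] fp_embed_left_regular[OF this]
  show ?case by (simp add: free_group_map_def)
next
  case (Cons p w)
  obtain \<iota> s b where p: "p = ((\<iota>, s), b)" by (metis surj_pair)
  have w: "w \<in> carrier F" "[p] \<in> carrier F" and s: "[(s, b)] \<in> carrier (G \<iota>)" and red: "red_cons p w = p # w"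
    using Cons.prems p by (auto simp: free_group_simps red_cons_def successively_Cons)
  have "translation [p] \<in> fp_algebra G"
    using fp_embed_in_fp_algebra[OF left_regular_in_reduced_cstar[OF s]] fp_embed_left_regular[OF s] p
    by (simp add: free_group_map_def)
  then have "translation [p] o\<^sub>L translation w \<in> fp_algebra G"
    using Cons.IH[OF w(1)] cstar_subalgebraD(4)[OF cstar_subalgebra_fp_algebra] by blast
  then show ?case using translation_mult[OF w(2,1)] red by (simp add: free_group_simps)
qed

text \<open>The reduced free product is thereby the reduced C*-algebra of \<open>F\<close>. The
  embeddings are continuous and send spans of left regular unitaries to spans of translations, which
  gives the inclusion from left to right.\<close>

lemma fp_algebra_eq: "fp_algebra G = closure (cspan (translation ` carrier F))"
proof
  interpret group F by (rule group_free_group)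
  let ?C = "cspan (translation ` carrier F)"
  have sub: "cstar_subalgebra X (closure ?C)"
    by (rule cstar_subalgebra_closure_cspan)
       (auto simp: translation_in_bounded_ops translation_mult adj_translation)
  show "fp_algebra G \<subseteq> closure ?C"
    unfolding fp_algebra_def
  proof (rule cstar_generated_minimal[OF sub], clarify)
    fix \<iota> a assume "a \<in> reduced_cstar (G \<iota>)"
    then obtain x where x: "\<And>n::nat. x n \<in> cspan (left_regular (G \<iota>) ` carrier (G \<iota>))" "x \<longlonglongrightarrow> a"
      unfolding reduced_cstar_eq[OF group_free_group] by (auto simp: closure_sequential)
    have "fp_embed G \<iota> b \<in> ?C" if "b \<in> cspan (left_regular (G \<iota>) ` carrier (G \<iota>))" for b
      using that
      by induction (auto simp: fp_embed_linear fp_embed_left_regular map_Pair_in_free_group intro: cspan.intros)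
    then show "fp_embed G \<iota> a \<in> closure ?C"
      using x tendsto_fp_embed unfolding closure_sequential by fast
  qed
  show "closure ?C \<subseteq> fp_algebra G"
    using cstar_subalgebra_fp_algebra translation_in_fp_algebra
    by (intro closure_minimal cspan_subset_cstar_subalgebra[of X]) (auto dest: cstar_subalgebraD(7))
qed

lemma unit_op_in_fp_algebra: "unit_op X \<in> fp_algebra G"
  using translation_in_fp_algebra[of "[]"] translation_Nil by (simp add: free_group_simps)

section \<open>States are determined by their values on translations\<close>

text \<open>A nontrivial translation moves the vacuum to a different, hence orthogonal, basis
  vector.\<close>

lemma fp_state_translation:
  assumes "w \<in> carrier F" "w \<noteq> []" shows "fp_state G (translation w) = 0"
proof -
  have "[] \<in> carrier F" by (simp add: free_group_simps)
  then have "translation w (ket []) = ket (unflatten w)"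
    using translation_ket[OF assms(1), of "[]"] foldr_red_cons_Nil[of w] assms(1)
    by (simp add: unflatten free_group_simps)
  moreover have "unflatten w \<noteq> []" using unflatten(2)[OF assms(1)] assms(2) by (auto simp: flatten_simps)
  ultimately show ?thesis
    using translation_in_fp_algebra[OF assms(1)] by (simp add: fp_state_def cinner_ket_left coef_ket)
qed

lemma is_state_fp_state: "is_state X (fp_algebra G) (fp_state G)"
proof -
  note A = cstar_subalgebraD[OF cstar_subalgebra_fp_algebra]
  have "cinner (ket []) ((adj a o\<^sub>L a) (ket [])) \<in> \<real>\<^sub>\<ge>\<^sub>0" if a: "a \<in> fp_algebra G" for a
  proof -
    have "clinear a" using A(1)[OF a] by (rule bounded_opsD(1))
    then have "cinner (ket []) ((adj a o\<^sub>L a) (ket [])) = cinner (a (ket [])) (a (ket []))"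
      by (metis adj_adj cinner_adj clinear_adj blinfun_apply_blinfun_compose)
    then show ?thesis by (simp add: cinner_self complex_nonneg_Reals_iff)
  qed
  moreover have "[] \<in> X" by (simp add: fp_words_def)
  ultimately show ?thesis
    using A unit_op_in_fp_algebra
    by (simp add: is_state_def fp_state_def blinfun.add_left cinner_add_right scaleC_simps cinner_scale_right
      unit_op_ket) (simp add: cinner_ket_left coef_ket)
qed

text \<open>Agreement extends linearly to the span of the translations, and then to its closure by
  \<open>state_bounded\<close>.\<close>

lemma state_eqI:
  assumes \<omega>: "is_state X (fp_algebra G) \<omega>" and \<phi>: "is_state X (fp_algebra G) \<phi>"
    and eq: "\<And>w. w \<in> carrier F \<Longrightarrow> \<omega> (translation w) = \<phi> (translation w)" and a: "a \<in> fp_algebra G"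
  shows "\<omega> a = \<phi> a"
proof -
  note C = cstar_subalgebra_fp_algebra
  note A = cstar_subalgebraD[OF C]
  let ?C = "cspan (translation ` carrier F)"
  have sub: "?C \<subseteq> fp_algebra G" using fp_algebra_eq closure_subset by blast
  have C: "\<omega> b = \<phi> b" if "b \<in> ?C" for b
    using that
    by induction (use sub eq in \<open>auto simp: is_state_linear[OF C \<omega>] is_state_linear[OF C \<phi>] subset_iff\<close>)
  obtain x where x: "\<And>n::nat. x n \<in> ?C" "x \<longlonglongrightarrow> a"
    using a unfolding fp_algebra_eq by (auto simp: closure_sequential)
  have lim: "(\<lambda>n. \<psi> (x n)) \<longlonglongrightarrow> \<psi> a" if \<psi>: "is_state X (fp_algebra G) \<psi>" for \<psi>
  proof (rule LIM_zero_cancel, rule Lim_null_comparison)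
    show "(\<lambda>n. 4 * norm (x n - a)) \<longlonglongrightarrow> 0"
      using x(2) by (intro tendsto_mult_right_zero tendsto_norm_zero) (simp add: LIM_zero)
    have "norm (\<psi> (x n) - \<psi> a) \<le> 4 * norm (x n - a)" for n
    proof -
      have "x n \<in> fp_algebra G" using x(1) sub by blast
      then show ?thesis
        using state_bounded[OF cstar_subalgebra_fp_algebra \<psi> unit_op_in_fp_algebra, of "x n - a"] a
        by (simp add: is_state_linear[OF cstar_subalgebra_fp_algebra \<psi>]
          cstar_subalgebra_diff[OF cstar_subalgebra_fp_algebra])
    qed
    then show "\<forall>\<^sub>F n in sequentially. norm (\<psi> (x n) - \<psi> a) \<le> 4 * norm (x n - a)" by simp
  qed
  show ?thesis using lim[OF \<omega>] lim[OF \<phi>] C[OF x(1)] by (simp add: LIMSEQ_unique)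
qed

end

section \<open>The automorphism\<close>

locale fp_shift = fp_alphabets S for S :: "fp_index \<Rightarrow> 's set" +
  fixes t :: "fp_index \<Rightarrow> 's \<Rightarrow> 's"
  assumes bij: "\<And>\<iota>. bij_betw (t \<iota>) (S \<iota>) (S \<iota>)"
begin

abbreviation (input) "T \<equiv> \<lambda>\<iota>. free_group_map (t \<iota>)"

definition letter_shift :: "fp_index \<times> 's \<Rightarrow> fp_index \<times> 's"
  where "letter_shift = (\<lambda>(\<iota>, s). (\<iota>, t \<iota> s))"

abbreviation "shift \<equiv> free_group_map letter_shift"

definition word_shift :: "(fp_index \<times> ('s \<times> bool) list) list \<Rightarrow> (fp_index \<times> ('s \<times> bool) list) list"
  where "word_shift = map (\<lambda>(\<iota>, g). (\<iota>, T \<iota> g))"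

lemma shift_iso: "shift \<in> iso F F"
proof (rule free_group_map_iso)
  have *: "t \<iota> ` S \<iota> = S \<iota>" "inj_on (t \<iota>) (S \<iota>)" for \<iota> using bij[of \<iota>] by (auto simp: bij_betw_def)
  have "letter_shift ` Sigma UNIV S = Sigma UNIV (\<lambda>\<iota>. t \<iota> ` S \<iota>)"
    by (force simp: letter_shift_def)
  then have "letter_shift ` Sigma UNIV S = Sigma UNIV S" by (simp add: *)
  moreover have "inj_on letter_shift (Sigma UNIV S)"
    using *(2) by (auto simp: inj_on_def letter_shift_def)
  ultimately show "bij_betw letter_shift (Sigma UNIV S) (Sigma UNIV S)" by (simp add: bij_betw_def)
qed

lemma shift_facts:
  "u \<in> carrier F \<Longrightarrow> shift u \<in> carrier F"
  "u \<in> carrier F \<Longrightarrow> v \<in> carrier F \<Longrightarrow> shift (u \<otimes>\<^bsub>F\<^esub> v) = shift u \<otimes>\<^bsub>F\<^esub> shift v"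
  "bij_betw shift (carrier F) (carrier F)"
  using shift_iso by (auto simp: iso_def hom_def)

lemma shift_surj: "w \<in> carrier F \<Longrightarrow> \<exists>u\<in>carrier F. w = shift u"
  using shift_facts(3) by (auto simp: bij_betw_def)

lemma T_bij: "bij_betw (T \<iota>) (carrier (G \<iota>)) (carrier (G \<iota>))"
  using free_group_map_iso[OF bij] by (simp add: iso_def)

text \<open>Through \<open>flatten\<close>, applying the automorphisms syllable by syllable is one
  automorphism of \<open>F\<close> induced by a permutation of its letters.\<close>

lemma flatten_word_shift: "flatten (word_shift v) = shift (flatten v)"
  by (induction v) (auto simp: word_shift_def flatten_simps free_group_map_def letter_shift_def)

lemma word_shift_in_fp_words: "v \<in> X \<Longrightarrow> word_shift v \<in> X"
proof -
  assume v: "v \<in> X"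
  have "map fst (word_shift v) = map fst v" by (auto simp: word_shift_def)
  then have "distinct_adj (map fst (word_shift v))" using v by (simp add: fp_words_def)
  moreover have "free_group_map (t \<iota>) g \<in> carrier (G \<iota>)" if "g \<in> carrier (G \<iota>)" for \<iota> g
    using T_bij that by (auto simp: bij_betw_def)
  ultimately show ?thesis
    using v by (force simp: fp_words_def word_shift_def free_group_simps(3) free_group_map_def)
qed

lemma word_shift_unflatten: "u \<in> carrier F \<Longrightarrow> word_shift (unflatten u) = unflatten (shift u)"
  by (metis flatten_word_shift unflatten(1,2,3) word_shift_in_fp_words)

lemma word_shift_surj: "v \<in> X \<Longrightarrow> \<exists>v'\<in>X. v = word_shift v'"
proof -
  assume v: "v \<in> X"
  then obtain u where "u \<in> carrier F" "flatten v = shift u"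
    using flatten_in_free_group shift_surj by blast
  then show ?thesis using v word_shift_unflatten unflatten(1,3) by metis
qed

text \<open>\<open>M\<close> is the map in the definition of \<open>fp_unitary\<close>. It inverts
  \<open>word_shift\<close>, which is onto, and this yields the injectivity that \<open>pull\<close>
  demands.\<close>

lemma word_unshift:
  defines "M \<equiv> map (\<lambda>(\<iota>, g). (\<iota>, inv_into (carrier (G \<iota>)) (T \<iota>) g))"
  shows "v \<in> X \<Longrightarrow> M (word_shift v) = v" "inj_on M X" "M ` X \<subseteq> X"
proof -
  show *: "M (word_shift v) = v" if "v \<in> X" for v
    using that bij_betw_inv_into_left[OF T_bij]
    by (fastforce simp: M_def word_shift_def fp_words_def intro!: map_idI)
  show "inj_on M X"
  proof (rule inj_onI)
    fix v v' assume "v \<in> X" "v' \<in> X" "M v = M v'"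
    then show "v = v'" using word_shift_surj * by metis
  qed
  show "M ` X \<subseteq> X" using word_shift_surj * by (metis image_subsetI)
qed

lemma fp_unitary_in_bounded_ops: "fp_unitary G T \<in> bounded_ops X"
  unfolding fp_unitary_def by (rule pull_in_bounded_ops[OF word_unshift(2,3)])

lemma fp_unitary_ket:
  assumes "v \<in> X"
  shows "fp_unitary G T (ket v) = ket (word_shift v)" "adj (fp_unitary G T) (ket (word_shift v)) = ket v"
proof -
  show "fp_unitary G T (ket v) = ket (word_shift v)"
    using pull_ket[OF word_unshift(2) word_shift_in_fp_words[OF assms]]
    by (simp add: fp_unitary_def word_unshift(1)[OF assms])
  show "adj (fp_unitary G T) (ket (word_shift v)) = ket v"
    by (simp add: fp_unitary_def adj_pull_ket[OF word_unshift(2)] word_shift_in_fp_words[OF assms]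
      word_unshift(1)[OF assms])
qed

lemma fp_unitary_unflatten:
  assumes "u \<in> carrier F"
  shows "fp_unitary G T (ket (unflatten u)) = ket (unflatten (shift u))"
    "adj (fp_unitary G T) (ket (unflatten (shift u))) = ket (unflatten u)"
  using fp_unitary_ket[OF unflatten(1)[OF assms]] word_shift_unflatten[OF assms] by simp_all

lemma conj_fp_unitary_in_bounded_ops:
  assumes "a \<in> bounded_ops X"
  shows "fp_aut G T a \<in> bounded_ops X" "adj (fp_unitary G T) o\<^sub>L a o\<^sub>L fp_unitary G T \<in> bounded_ops X"
  unfolding fp_aut_def
  by (intro cstar_subalgebraD(4,6)[OF cstar_subalgebra_bounded_ops] fp_unitary_in_bounded_ops assms)+

text \<open>Checked on basis vectors, each of which is the image of another one under the unitary.
  The second identity describes the inverse automorphism.\<close>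

lemma fp_aut_translation:
  assumes "w \<in> carrier F"
  shows "fp_aut G T (translation w) = translation (shift w)"
    "adj (fp_unitary G T) o\<^sub>L translation (shift w) o\<^sub>L fp_unitary G T = translation w"
proof -
  interpret group F by (rule group_free_group)
  show "fp_aut G T (translation w) = translation (shift w)"
  proof (rule fp_words_ops_eqI)
    fix u assume "u \<in> carrier F"
    then obtain x where x: "x \<in> carrier F" "u = shift x"
      using shift_surj by blast
    then show "fp_aut G T (translation w) (ket (unflatten u)) = translation (shift w) (ket (unflatten u))"
      using assms by (simp add: fp_aut_def fp_unitary_unflatten translation_ket shift_facts)
  qed (intro conj_fp_unitary_in_bounded_ops translation_in_bounded_ops shift_facts assms)+
  show "adj (fp_unitary G T) o\<^sub>L translation (shift w) o\<^sub>L fp_unitary G T = translation w"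
  proof (rule fp_words_ops_eqI)
    fix u assume "u \<in> carrier F"
    then show "(adj (fp_unitary G T) o\<^sub>L translation (shift w) o\<^sub>L fp_unitary G T) (ket (unflatten u)) =
        translation w (ket (unflatten u))"
      using assms
      by (simp add: fp_unitary_unflatten translation_ket shift_facts(1) m_closed flip: shift_facts(2))
  qed (intro conj_fp_unitary_in_bounded_ops translation_in_bounded_ops shift_facts assms)+
qed

lemma fp_aut_in_fp_algebra: "a \<in> fp_algebra G \<Longrightarrow> fp_aut G T a \<in> fp_algebra G"
  unfolding fp_algebra_eq fp_aut_def
proof (rule conj_in_closure_cspan)
  show "clinear (fp_unitary G T)" by (rule bounded_opsD(1)[OF fp_unitary_in_bounded_ops])
  fix a assume "a \<in> translation ` carrier F"
  then show "fp_unitary G T o\<^sub>L a o\<^sub>L adj (fp_unitary G T) \<in> translation ` carrier F"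
    using fp_aut_translation(1) shift_facts(1) unfolding fp_aut_def by auto
qed

text \<open>Negative powers in \<open>int_iterate\<close> are formed with \<open>inv_into\<close>,
  which behaves as an inverse only on the image. The preimage is the reverse conjugation, which also
  preserves the algebra.\<close>

lemma fp_aut_surj:
  assumes a: "a \<in> fp_algebra G" shows "a \<in> fp_aut G T ` fp_algebra G"
proof (rule image_eqI)
  let ?U = "fp_unitary G T"
  have aB: "a \<in> bounded_ops X" using a cstar_subalgebraD(1)[OF cstar_subalgebra_fp_algebra] by blast
  show "adj ?U o\<^sub>L a o\<^sub>L ?U \<in> fp_algebra G"
    using a unfolding fp_algebra_eq
  proof (rule conj_in_closure_cspan[rotated 2])
    show "clinear (adj ?U)" by (rule clinear_adj[OF bounded_opsD(1)[OF fp_unitary_in_bounded_ops]])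
    fix b assume "b \<in> translation ` carrier F"
    then obtain w where w: "w \<in> carrier F" "b = translation (shift w)"
      using shift_surj by blast
    then show "adj ?U o\<^sub>L b o\<^sub>L ?U \<in> translation ` carrier F" by (simp add: fp_aut_translation)
  qed
  have one: "?U o\<^sub>L adj ?U = unit_op X"
  proof (rule bounded_ops_eqI)
    show "?U o\<^sub>L adj ?U \<in> bounded_ops X"
      by (intro cstar_subalgebraD(4,6)[OF cstar_subalgebra_bounded_ops] fp_unitary_in_bounded_ops)
    fix v assume "v \<in> X"
    then show "(?U o\<^sub>L adj ?U) (ket v) = unit_op X (ket v)"
      using word_shift_surj[of v] by (auto simp: fp_unitary_ket unit_op_ket)
  qed (rule unit_op_in_bounded_ops)
  have "fp_aut G T (adj ?U o\<^sub>L a o\<^sub>L ?U) = (?U o\<^sub>L adj ?U) o\<^sub>L a o\<^sub>L (?U o\<^sub>L adj ?U)"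
    by (rule blinfun_eqI) (simp add: fp_aut_def)
  then show "a = fp_aut G T (adj ?U o\<^sub>L a o\<^sub>L ?U)" by (simp add: one unit_op_compose aB)
qed

lemma fp_state_fp_aut:
  assumes "a \<in> fp_algebra G" shows "fp_state G (fp_aut G T a) = fp_state G a"
proof -
  have "[] \<in> X" "word_shift [] = []" by (auto simp: fp_words_def word_shift_def)
  moreover from this have "adj (fp_unitary G T) (ket []) = ket []" using fp_unitary_ket(2)[of "[]"] by simp
  moreover have "coef (fp_unitary G T f) [] = coef f []" for f
    using \<open>[] \<in> X\<close> by (simp add: fp_unitary_def coef_pull[OF word_unshift(2)])
  ultimately show ?thesis
    using assms fp_aut_in_fp_algebra by (simp add: fp_state_def cinner_ket_left) (simp add: fp_aut_def)
qed

lemma fp_state_int_iterate: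
  assumes "a \<in> fp_algebra G"
  shows "fp_state G (int_iterate (fp_algebra G) (fp_aut G T) n a) = fp_state G a"
proof -
  \<comment> \<open>Stated for an arbitrary \<open>f\<close>, so that it serves both the
    automorphism and its \<open>inv_into\<close>.\<close>
  have iter: "(f ^^ k) a \<in> fp_algebra G \<and> fp_state G ((f ^^ k) a) = fp_state G a"
    if "\<And>b. b \<in> fp_algebra G \<Longrightarrow> f b \<in> fp_algebra G \<and> fp_state G (f b) = fp_state G b" for f k
    by (induction k) (simp_all add: assms that)
  have inv: "inv_into (fp_algebra G) (fp_aut G T) b \<in> fp_algebra G \<and>
      fp_state G (inv_into (fp_algebra G) (fp_aut G T) b) = fp_state G b" if "b \<in> fp_algebra G" for b
  proof -
    note surj = fp_aut_surj[OF that]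
    show ?thesis
      using fp_state_fp_aut[OF inv_into_into[OF surj]] inv_into_into[OF surj] by (simp add: f_inv_into_f[OF surj])
  qed
  have "fp_state G ((fp_aut G T ^^ k) a) = fp_state G a" for k
    by (rule iter[THEN conjunct2]) (simp add: fp_aut_in_fp_algebra fp_state_fp_aut)
  moreover have "fp_state G ((inv_into (fp_algebra G) (fp_aut G T) ^^ k) a) = fp_state G a" for k
    by (rule iter[THEN conjunct2, OF inv])
  ultimately show ?thesis by (simp only: int_iterate_def split: if_split) simp
qed

text \<open>Supplies one inclusion in \<open>r_disjoint\<close>, and later the common value of all
  joinings on words over the second alphabet.\<close>

lemma fp_state_in_r_joinings: "fp_state G \<in> r_joinings G T"
proof -
  have "fp_state G \<in> extensional (fp_algebra G)" by (simp add: fp_state_def)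
  moreover have "fp_state G (fp_embed G \<iota> a) = group_state (G \<iota>) a" if "a \<in> reduced_cstar (G \<iota>)" for \<iota> a
    using fp_embed_in_fp_algebra[OF that] cinner_vac_fp_embed[of G \<iota> a] by (simp add: fp_state_def)
  ultimately show ?thesis
    by (simp add: r_joinings_def is_state_fp_state fp_state_int_iterate)
qed

section \<open>Joinings vanish on words with a letter of infinite orbit\<close>

lemma joining_shift:
  assumes "\<omega> \<in> r_joinings G T" "w \<in> carrier F"
  shows "(shift ^^ n) w \<in> carrier F \<and> \<omega> (translation ((shift ^^ n) w)) = \<omega> (translation w)"
proof (induction n)
  case (Suc n)
  let ?w = "(shift ^^ n) w"
  have "\<omega> (int_iterate (fp_algebra G) (fp_aut G T) 1 (translation ?w)) = \<omega> (translation ?w)"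
    using assms(1) translation_in_fp_algebra Suc by (auto simp: r_joinings_def)
  then show ?case using Suc by (simp add: int_iterate_def fp_aut_translation shift_facts)
qed (simp add: assms)

text \<open>\<open>norm_sum_pull_le\<close> applies, with \<open>mult_starts_with\<close> as the
  ping-pong condition for the shifted words.\<close>

lemma norm_sum_translation_le:
  assumes w: "p @ (l, b) # q \<in> carrier F" and orbit: "inj (\<lambda>n. (letter_shift ^^ n) l)"
  shows "norm (\<Sum>n<N. translation ((shift ^^ n) (p @ (l, b) # q))) \<le> 2 * sqrt N"
proof -
  let ?f = "\<lambda>n. free_group_map (letter_shift ^^ n)"
  let ?s = "\<lambda>n. ((letter_shift ^^ n) l, b)"
  have split: "(shift ^^ n) (p @ (l, b) # q) = ?f n p @ ?s n # ?f n q" for n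
    by (simp add: funpow_free_group_map) (simp add: free_group_map_def)
  have wn: "?f n p @ ?s n # ?f n q \<in> carrier F" for n
    using shift_facts(1) w unfolding split[symmetric] by (induction n) auto
  have len: "length (?f n u) = length u" for n and u :: "((fp_index \<times> 's) \<times> bool) list"
    by (simp add: free_group_map_def)
  \<comment> \<open>The prefix lengths are the same for all \<open>n\<close>. Words in
    \<open>E n\<close> have the \<open>n\<close>-th shifted letter at position
    \<open>length p\<close>, and words in \<open>D n\<close> have its inverse at position
    \<open>length q\<close>; distinct letters make both families disjoint.\<close>
  define E where "E n = {v. take (Suc (length p)) (flatten v) = ?f n p @ [?s n]}" for n
  define D where "D n = {v. take (Suc (length q)) (flatten v) = word_inv (?s n # ?f n q)}" for n
  have ne: "?s m \<noteq> ?s n" if "m \<noteq> n" for m n using orbit that by (auto simp: inj_def)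
  have "norm (\<Sum>n<N. translation (?f n p @ ?s n # ?f n q)) \<le> 2 * sqrt (card {..<N})"
    unfolding translation_def
  proof (rule norm_sum_pull_le)
    show "disjoint_family_on E {..<N}"
      unfolding disjoint_family_on_def E_def using ne by auto
    show "disjoint_family_on D {..<N}"
      unfolding disjoint_family_on_def D_def using ne by auto
    fix n v assume v: "v \<in> X" "v \<notin> E n"
    then have "take (Suc (length q)) (inv\<^bsub>F\<^esub> (?f n p @ ?s n # ?f n q) \<otimes>\<^bsub>F\<^esub> flatten v) = word_inv (?s n # ?f n q)"
      using mult_starts_with[OF wn flatten_in_free_group[OF v(1)], of n] by (simp add: len E_def)
    moreover have "inv\<^bsub>F\<^esub> (?f n p @ ?s n # ?f n q) \<otimes>\<^bsub>F\<^esub> flatten v \<in> carrier F"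
      using wn flatten_in_free_group[OF v(1)]
      by (intro monoid.m_closed group.is_monoid group.inv_closed group_free_group)
    ultimately show "unflatten (inv\<^bsub>F\<^esub> (?f n p @ ?s n # ?f n q) \<otimes>\<^bsub>F\<^esub> flatten v) \<in> D n"
      by (simp add: D_def unflatten)
  qed (auto intro: translation_inj wn)
  then show ?thesis by (simp add: split)
qed

lemma joining_vanishes:
  assumes \<omega>: "\<omega> \<in> r_joinings G T" and w: "p @ (l, b) # q \<in> carrier F"
    and orbit: "inj (\<lambda>n. (letter_shift ^^ n) l)"
  shows "\<omega> (translation (p @ (l, b) # q)) = 0"
proof -
  let ?w = "p @ (l, b) # q"
  have st: "is_state X (fp_algebra G) \<omega>" using \<omega> by (simp add: r_joinings_def)
  \<comment> \<open>Summing \<open>k\<^sup>2\<close> translates turns the square root into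
    \<open>k\<close>: invariance and boundedness give k^2 times the modulus at most 8k.\<close>
  have "real k * cmod (\<omega> (translation ?w)) \<le> 8" for k :: nat
  proof (cases "k = 0")
    case False
    let ?a = "\<Sum>n<k\<^sup>2. translation ((shift ^^ n) ?w)"
    have mem: "translation ((shift ^^ n) ?w) \<in> fp_algebra G" for n
      using joining_shift[OF \<omega> w] translation_in_fp_algebra by blast
    have "\<omega> ?a = (\<Sum>n<k\<^sup>2. \<omega> (translation ((shift ^^ n) ?w)))" and a: "?a \<in> fp_algebra G"
      using is_state_linear(6)[OF cstar_subalgebra_fp_algebra st, of "{..<k\<^sup>2}"] mem by auto
    then have "\<omega> ?a = (real k)\<^sup>2 * \<omega> (translation ?w)" using joining_shift[OF \<omega> w] by simp
    then have "(real k)\<^sup>2 * cmod (\<omega> (translation ?w)) = cmod (\<omega> ?a)" by (simp add: norm_mult norm_power)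
    also have "\<dots> \<le> 4 * norm ?a"
      by (rule state_bounded[OF cstar_subalgebra_fp_algebra st unit_op_in_fp_algebra a])
    also have "\<dots> \<le> 4 * (2 * sqrt (real (k\<^sup>2)))"
      by (intro mult_left_mono norm_sum_translation_le[OF w orbit]) auto
    finally have "real k * (real k * cmod (\<omega> (translation ?w))) \<le> real k * 8"
      by (simp add: power2_eq_square mult_ac)
    then show ?thesis using False by (simp add: mult_le_cancel_left)
  qed simp
  then have "cmod (\<omega> (translation ?w)) = 0"
    by (metis real_archimedian_rdiv_eq_0 norm_ge_zero zero_le_numeral mult.commute)
  then show ?thesis by simp
qed

text \<open>By \<open>state_eqI\<close> it suffices to compare values on translations: a letter of
  the first alphabet forces both values to be 0, and all other words are governed by the second
  marginal.\<close>

lemma r_disjointI: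
  assumes orbit: "\<And>s. s \<in> S I1 \<Longrightarrow> inj (\<lambda>n. (t I1 ^^ n) s)"
  shows "r_disjoint G T"
proof -
  have ls: "(letter_shift ^^ n) (\<iota>, s) = (\<iota>, (t \<iota> ^^ n) s)" for n \<iota> s
    by (induction n) (auto simp: letter_shift_def)
  have "\<omega> = fp_state G" if \<omega>: "\<omega> \<in> r_joinings G T" for \<omega>
  proof (rule extensionalityI[of _ "fp_algebra G"])
    have st: "is_state X (fp_algebra G) \<omega>" using \<omega> by (simp add: r_joinings_def)
    have eq: "\<omega> (translation w) = fp_state G (translation w)" if w: "w \<in> carrier F" for w
    proof (cases "\<exists>s b. ((I1, s), b) \<in> set w")
      case True
      then obtain s b p q where w': "w = p @ ((I1, s), b) # q" by (metis in_set_conv_decomp)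
      then have "s \<in> S I1" using w by (auto simp: free_group_simps)
      from orbit[OF this] have "\<omega> (translation w) = 0"
        unfolding w' by (intro joining_vanishes[OF \<omega>]) (use w w' in \<open>auto simp: ls inj_def\<close>)
      then show ?thesis using fp_state_translation[OF w] w' by simp
    next
      case False
      \<comment> \<open>Strips the tags. As every tag is \<open>I2\<close>, the word stays reduced
        and is the image of \<open>?g\<close> under the embedding of the second factor.\<close>
      let ?g = "free_group_map snd w"
      have I2: "fst (fst x) = I2" if "x \<in> set w" for x
        using False that by (cases x; cases "fst x"; cases "fst (fst x)") auto
      have wg: "w = free_group_map (Pair I2) ?g"
        unfolding free_group_map_def map_map
        by (rule map_idI[symmetric]) (use I2 in \<open>simp add: prod_eq_iff\<close>)
      have "successively (\<lambda>x y. \<not> cancels (apfst snd x) (apfst snd y)) w"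
        by (rule successively_mono[of "\<lambda>p q. \<not> cancels p q"])
           (use w I2 in \<open>simp_all add: free_group_simps cancels_def prod_eq_iff\<close>)
      moreover have "snd (fst x) \<in> S I2" if "x \<in> set w" for x
      proof -
        have "fst x \<in> Sigma UNIV S" using w that by (auto simp: free_group_simps)
        then show ?thesis using I2[OF that] by auto
      qed
      ultimately have g: "?g \<in> carrier (G I2)"
        by (auto simp: free_group_simps free_group_map_def successively_map)
      let ?a = "left_regular (G I2) ?g"
      have a: "?a \<in> reduced_cstar (G I2)" by (rule left_regular_in_reduced_cstar[OF g])
      have "\<psi> (translation w) = group_state (G I2) ?a" if "\<psi> \<in> r_joinings G T" for \<psi>
      proof -
        have "\<psi> (fp_embed G I2 ?a) = group_state (G I2) ?a"
          using that a unfolding r_joinings_def by blast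
        moreover have "fp_embed G I2 ?a = translation w"
          using fp_embed_left_regular[OF g] unfolding wg[symmetric] .
        ultimately show ?thesis by simp
      qed
      \<comment> \<open>\<open>fp_state\<close> is itself a joining, so it takes the same marginal
        value.\<close>
      from this[OF \<omega>] this[OF fp_state_in_r_joinings] show ?thesis by simp
    qed
    show "\<omega> a = fp_state G a" if "a \<in> fp_algebra G" for a
      by (rule state_eqI[OF st is_state_fp_state eq that])
  qed (use \<omega> in \<open>auto simp: r_joinings_def fp_state_def\<close>)
  then show ?thesis unfolding r_disjoint_def using fp_state_in_r_joinings by blast
qed

end

section \<open>From ergodicity to infinite orbits of letters\<close>

text \<open>The sum of a finite orbit of basis vectors would be a second invariant vector.\<close>

lemma ergodic_inj_orbit:
  assumes t: "bij_betw t S S" and erg: "ergodic (free_group S) (free_group_map t)" and s: "s \<in> S"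
  shows "inj (\<lambda>n. (t ^^ n) s)"
proof (rule ccontr)
  let ?T = "free_group_map t" and ?C = "carrier (free_group S)"
  let ?U = "group_unitary (free_group S) ?T"
  have tS: "(t ^^ n) s \<in> S" for n using t s by (induction n) (auto simp: bij_betw_def)
  have inj_t: "inj_on t S" using t by (simp add: bij_betw_def)
  have Tb: "bij_betw ?T ?C ?C" using free_group_map_iso[OF t] by (simp add: iso_def)
  then have inv: "bij_betw (inv_into ?C ?T) ?C ?C" by (rule bij_betw_inv_into)
  then have inj: "inj_on (inv_into ?C ?T) ?C" by (simp add: bij_betw_def)
  have U: "?U (ket g) = ket (?T g)" if "g \<in> ?C" for g
  proof -
    have "?T g \<in> ?C" using Tb that by (auto simp: bij_betw_def)
    from pull_ket[OF inj this] show ?thesis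
      using bij_betw_inv_into_left[OF Tb that] by (simp add: group_unitary_def)
  qed
  assume "\<not> inj (\<lambda>n. (t ^^ n) s)"
  then obtain m n where mn: "m < n" "(t ^^ m) s = (t ^^ n) s"
    using linorder_injI[of "\<lambda>n. (t ^^ n) s"] by blast
  \<comment> \<open>Cancelling the injective \<open>t\<close> repeatedly turns any coincidence in
    the orbit into a return to \<open>s\<close> itself.\<close>
  have shift: "(t ^^ m) s = (t ^^ (m + k)) s \<Longrightarrow> (t ^^ k) s = s" for m k
  proof (induction m)
    case (Suc m)
    then show ?case using inj_onD[OF inj_t _ tS tS, of m "m + k"] by simp
  qed simp
  obtain k where k: "k > 0" "(t ^^ k) s = s"
    using shift[of m "n - m"] mn that[of "n - m"] by simp
  let ?w = "\<lambda>i. [((t ^^ i) s, True)]"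
  let ?x = "\<Sum>i<k. ket (?w i)"
  have w: "?w i \<in> ?C" for i using tS by (simp add: free_group_simps)
  have "?U ?x = (\<Sum>i<k. ket (?w (Suc i)))"
    by (simp add: blinfun.sum_right U w) (simp add: free_group_map_def)
  \<comment> \<open>The unitary replaces the term at 0 by the term at \<open>k\<close>, and these
    agree because \<open>k\<close> is a period.\<close>
  also have "\<dots> + ket (?w 0) = ?x + ket (?w k)"
    using sum.lessThan_Suc_shift[of "\<lambda>i. ket (?w i)" k] by (simp add: add.commute)
  finally have Ux: "?U ?x = ?x" using k by simp
  have xC: "?x \<in> ell2_on ?C" using w by (auto simp: ell2_on_def coef_sum coef_ket intro!: sum.neutral)
  \<comment> \<open>Negative powers are given by \<open>inv_into\<close>, so injectivity is what
    makes them fix \<open>?x\<close> as well.\<close>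
  have injU: "inj_on ?U (ell2_on ?C)"
  proof (rule inj_onI, rule coef_eqI)
    fix f g h assume f: "f \<in> ell2_on ?C" and g: "g \<in> ell2_on ?C" and eq: "?U f = ?U g"
    show "coef f h = coef g h"
    proof (cases "h \<in> ?C")
      case True
      then obtain h' where "h' \<in> ?C" "h = inv_into ?C ?T h'" using inv by (metis bij_betw_def imageE)
      then show ?thesis
        using arg_cong[OF eq, of "\<lambda>f. coef f h'"] by (simp add: group_unitary_def coef_pull[OF inj])
    qed (use f g in \<open>simp add: ell2_on_def\<close>)
  qed
  have fix_iter: "f ?x = ?x \<Longrightarrow> (f ^^ n) ?x = ?x" for f and n :: nat by (induction n) auto
  have "inv_into (ell2_on ?C) ?U ?x = ?x" by (rule inv_into_f_eq[OF injU xC Ux])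
  then have "int_iterate (ell2_on ?C) ?U n ?x = ?x" for n
    using fix_iter[of ?U] fix_iter[of "inv_into (ell2_on ?C) ?U"] Ux by (simp add: int_iterate_def)
  then obtain c where "?x = scaleC c (group_vac (free_group S))"
    using erg xC unfolding ergodic_def by blast
  \<comment> \<open>The vacuum is supported on the empty word, while \<open>?w 0\<close> has one
    letter.\<close>
  then have "coef ?x (?w 0) = 0" by (simp add: scaleC_simps group_vac_def coef_ket free_group_simps)
  moreover have "Re (coef ?x (?w 0)) = (\<Sum>i<k. if (t ^^ i) s = s then 1 else 0)"
    by (auto simp: coef_sum coef_ket intro!: sum.cong)
  \<comment> \<open>The period \<open>k\<close> may not be minimal, so the same word can occur
    several times in \<open>?x\<close>; the index 0 alone contributes 1 and no term is
    negative.\<close>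
  moreover have "\<dots> \<ge> (\<Sum>i\<in>{0}. 1::real)"
    using k by (intro order_trans[OF _ sum_mono2[of "{..<k}" "{0}"]]) auto
  ultimately show False by simp
qed

theorem theorem3p4:
  fixes S :: "fp_index \<Rightarrow> 's set" and t :: "fp_index \<Rightarrow> 's \<Rightarrow> 's"
  assumes "\<And>\<iota>. bij_betw (t \<iota>) (S \<iota>) (S \<iota>)"
    and "ergodic (free_group (S I1)) (free_group_map (t I1))"
    and "countable (S I1)" and "infinite (S I1)"
    and "identity_system (free_group (S I2)) (free_group_map (t I2))"
    and "countable (S I2)"
  shows "r_disjoint (\<lambda>\<iota>. free_group (S \<iota>)) (\<lambda>\<iota>. free_group_map (t \<iota>))"
proof -
  interpret fp_shift S t by unfold_locales (rule assms(1))
  show ?thesis by (rule r_disjointI) (rule ergodic_inj_orbit[OF assms(1,2)])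
qed

end
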